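(* Assume Hypotheses (H1)-(H4) of the context hold. Then there exist $C_4>0$ and $\gamma>0$ such that, for all $r>0$ small enough and all $n\ge0$, $$m^*\otimes\mathbb P\left\{(x,\omega): S_n(x,\omega)>-\frac{\lambda}{2}n\ \text{ or }\ Z_n(x,\omega,r)>-\sqrt r\log(r)\,n\right\}<C_4e^{-\gamma n}.$$
   Context: **Setting.** $M$ is a smooth compact $k$-dimensional manifold with Lebesgue (volume) measure $m$; $|x-y|$ and $\mathrm{dist}$ denote distance on $M$, $\|\cdot\|$ the operator norm. Fix $\sigma>0$, let $\nu$ be normalized Lebesgue measure on $[-\sigma,\sigma]^k$, $\Omega=([-\sigma,\sigma]^k)^{\mathbb N}$, $\mathbb P=\nu^{\otimes\mathbb N}$ (product $\sigma$-algebra), $\omega=(\omega_i)_{i\ge0}$, and $\theta(\{\omega_i\}_{i\ge 0})=\{\omega_{i+1}\}_{i\ge 0}$. Given $g:M\times[-\sigma,\sigma]^k\to M$, put $f_\omega(x)=g(x,\omega_0)$ and $f^n_\omega=f_{\theta^{n-1}\omega}\circ\cdots\circ f_\omega$; $df_\omega(x)=d_xg(x,\omega_0)$ is the derivative in $x$. The iterations define a Markov process on $M$. **(H1)** $g$ is continuous and, for each $\omega_0\in[-\sigma,\sigma]^k$, $g(\cdot,\omega_0)$ is $C^{1+\beta}$, $\beta>0$, outside a critical set $\mathcal C_{\omega_0}\subset M$ where this map is not differentiable or the derivative is not invertible. For all $x\in M$, $g(x,\cdot):[-\sigma,\sigma]^k\to M$ is a diffeomorphism onto its image, and $(x,\omega_0)\mapsto\det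 d_{\omega_0}g(x,\omega_0)$ is Hölder continuous. In particular there are $c_1,c_2>0$ with $c_1\ge|\det(d_{\omega_0}g(x,\omega_0))|\ge c_2>0$ for all $(x,\omega_0)\in M\times[-\sigma,\sigma]^k$. **(H2)** For all $\omega_0\in[-\sigma,\sigma]^k$, $\mathcal C_{\omega_0}$ is closed with zero Lebesgue measure, and there are constants $B>1$, $\alpha>0$ (and $\beta$ as in (H1)), such that for all $\omega_0\in[-\sigma,\sigma]^k$: (1) for all $x\in M\setminus\mathcal C_{\omega_0}$ and $0\ne v\in T_xM$, $\frac1B\mathrm{dist}(x,\mathcal C_{\omega_0})^\alpha\le\frac{|d_xg(x,\omega_0)\cdot v|}{|v|}\le B\,\mathrm{dist}(x,\mathcal C_{\omega_0})^{-\alpha}$; (2) for all $x,y\in M\setminus\mathcal C_{\omega_0}$ with $|x-y|\le\mathrm{dist}(x,\mathcal C_{\omega_0})/2$, both $\big|\log\|d_xg(x,\omega_0)^{-1}\|-\log\|d_xg(y,\omega_0)^{-1}\|\big|$ and $\big|\log|\det d_xg(x,\omega_0)|-\log|\det d_xg(y,\omega_0)|\big|$ are at most $\frac{B}{\mathrm{dist}(x,\mathcal C_{\omega_0})^\alpha}|x-y|^\beta$. Furthermore $\omega_0\mapsto\mathcal C_{\omega_0}$ is upper semi-continuous in the Hausdorff topology. **(H3)** The Markov process associated to $f^n_\omega$ admits an ergodic stationary measure $\mu$ with $\lambda=-\int_{M\times\Omega}\log\|df_\omega(x)^{-1}\|\,d\mu(x)\,d\mathbb P(\omega)>0$. **(H4)**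 Let $m^*=m|_{\operatorname{supp}(\mu)}$. There is $C_1>0$ such that for all $\delta>0$ small enough $m^*\otimes\mathbb P\{(x,\omega):\mathrm{dist}(x,\mathcal C_{\omega_0})\le\delta\}\le C_1\delta$. **Notation.** For $r\in(0,1)$ the truncated distance is $\mathrm{dist}_r(x,\mathcal C_{\omega_0})=1$ if $\mathrm{dist}(x,\mathcal C_{\omega_0})>r$ and $\mathrm{dist}_r(x,\mathcal C_{\omega_0})=\mathrm{dist}(x,\mathcal C_{\omega_0})$ otherwise. Set $$S_n(x,\omega)=\sum_{i=0}^n\log\|df_{\theta^i(\omega)}(f^i_\omega(x))^{-1}\|,\qquad Z_n(x,\omega,r)=-\sum_{i=0}^n\log\mathrm{dist}_r(f^i_\omega(x),\mathcal C_{\omega_i}).$$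
   Formalization: The rate γ may depend on r (C₄ does not): a γ uniform in r is impossible in general, since the i=0 term of Z_n alone can give measure at least 2exp(-√r|log r|n) for large n, and √r|log r| tends to 0 as r tends to 0. *)

theory Defs
  imports "HOL-Probability.Probability"
begin

section \<open>Riemannian manifolds\<close>

text \<open>
  The whole type \<open>'m\<close> is the manifold; \<open>real^'k\<close> is the model space, so the dimension is
  \<open>CARD('k)\<close>. A chart is a pair of its domain and its coordinate map. The Riemannian metric is
  given by its Gram matrices: \<open>gram M c x\<close> is the matrix of the inner product on the tangent space
  at \<open>x\<close>, in the coordinates of the chart \<open>c\<close>.
\<close>

type_synonym ('m, 'k) chart = "'m set \<times> ('m \<Rightarrow> real^'k)"

record ('m, 'k) riem =
  atlas :: "('m, 'k) chart set"
  gram :: "('m, 'k) chart \<Rightarrow> 'm \<Rightarrow> real^'k^'k"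

abbreviation dom_of :: "('m, 'k) chart \<Rightarrow> 'm set"
  where "dom_of c \<equiv> fst c"

abbreviation coord :: "('m, 'k) chart \<Rightarrow> 'm \<Rightarrow> real^'k"
  where "coord c \<equiv> snd c"

definition param :: "('m, 'k) chart \<Rightarrow> real^'k \<Rightarrow> 'm"
  where "param c = inv_into (dom_of c) (coord c)"

text \<open>
  Classes of differentiability. \<open>Ck_on\<close> and \<open>smooth_on\<close> are meant for open sets of a
  finite-dimensional space (all iterated directional derivatives exist and are continuous); \<open>C1_on\<close>
  is also used on sets that are not open, such as a closed cube, with one-sided derivatives.
\<close>

primrec Ck_on ::
  "nat \<Rightarrow> 'a::real_normed_vector set \<Rightarrow> ('a \<Rightarrow> 'b::real_normed_vector) \<Rightarrow> bool" where
  "Ck_on 0 = (\<lambda>S f. continuous_on S f)"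
| "Ck_on (Suc n) = (\<lambda>S f. (\<forall>x\<in>S. f differentiable (at x)) \<and>
     (\<forall>v. Ck_on n S (\<lambda>x. frechet_derivative f (at x) v)))"

definition smooth_on ::
  "'a::real_normed_vector set \<Rightarrow> ('a \<Rightarrow> 'b::real_normed_vector) \<Rightarrow> bool"
  where "smooth_on S f \<longleftrightarrow> (\<forall>n. Ck_on n S f)"

definition C1_on ::
  "'a::real_normed_vector set \<Rightarrow> ('a \<Rightarrow> 'b::real_normed_vector) \<Rightarrow> bool"
  where "C1_on S f \<longleftrightarrow> (\<exists>f' :: 'a \<Rightarrow> 'a \<Rightarrow>\<^sub>L 'b. continuous_on S f' \<and>
     (\<forall>x\<in>S. (f has_derivative blinfun_apply (f' x)) (at x within S)))"

definition smooth_atlas :: "('m::metric_space, 'k::finite) chart set \<Rightarrow> bool"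
  where "smooth_atlas A \<longleftrightarrow>
     (\<Union>c\<in>A. dom_of c) = UNIV \<and>
     (\<forall>c\<in>A. open (dom_of c) \<and> open (coord c ` dom_of c) \<and>
        homeomorphism (dom_of c) (coord c ` dom_of c) (coord c) (param c)) \<and>
     (\<forall>c\<in>A. \<forall>c'\<in>A. smooth_on (coord c ` (dom_of c \<inter> dom_of c')) (coord c' \<circ> param c))"

definition smooth_metric :: "('m::metric_space, 'k::finite) riem \<Rightarrow> bool"
  where "smooth_metric M \<longleftrightarrow>
     (\<forall>c\<in>atlas M. smooth_on (coord c ` dom_of c) (gram M c \<circ> param c)) \<and>
     (\<forall>c\<in>atlas M. \<forall>x\<in>dom_of c. transpose (gram M c x) = gram M c x \<and>
        (\<forall>v. v \<noteq> 0 \<longrightarrow> v \<bullet> (gram M c x *v v) > 0)) \<and>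
     (\<forall>c\<in>atlas M. \<forall>c'\<in>atlas M. \<forall>x\<in>dom_of c \<inter> dom_of c'.
        (let J = matrix (frechet_derivative (coord c' \<circ> param c) (at (coord c x)))
         in gram M c x = transpose J ** gram M c' x ** J))"

text \<open>
  A tangent vector at \<open>x\<close> is represented by its coordinates in the preferred chart \<open>chart_at M x\<close>.
  The norms and determinants below do not depend on how the preferred charts are chosen.
\<close>

definition chart_at :: "('m, 'k::finite) riem \<Rightarrow> 'm \<Rightarrow> ('m, 'k) chart"
  where "chart_at M x = (SOME c. c \<in> atlas M \<and> x \<in> dom_of c)"

definition gram_at :: "('m, 'k::finite) riem \<Rightarrow> 'm \<Rightarrow> real^'k^'k"
  where "gram_at M x = gram M (chart_at M x) x"

definition tnorm :: "('m, 'k::finite) riem \<Rightarrow> 'm \<Rightarrow> real^'k \<Rightarrow> real"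
  where "tnorm M x v = sqrt (v \<bullet> (gram_at M x *v v))"

definition C1_curve :: "('m::metric_space, 'k::finite) riem \<Rightarrow> (real \<Rightarrow> 'm) \<Rightarrow> bool"
  where "C1_curve M p \<longleftrightarrow> continuous_on {0..1} p \<and>
     (\<forall>c\<in>atlas M. C1_on {t\<in>{0..1}. p t \<in> dom_of c} (coord c \<circ> p))"

definition curve_length :: "('m, 'k::finite) riem \<Rightarrow> (real \<Rightarrow> 'm) \<Rightarrow> real"
  where "curve_length M p = integral {0..1} (\<lambda>t.
     tnorm M (p t) (vector_derivative (coord (chart_at M (p t)) \<circ> p) (at t within {0..1})))"

text \<open>
  The metric of \<open>'m\<close> induces the manifold topology (through \<open>smooth_atlas\<close>) and is the Riemannian
  distance on each connected component. The (finite) distance between different components, if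
  there are several, is left open.
\<close>

definition riemannian_manifold :: "('m::metric_space, 'k::finite) riem \<Rightarrow> bool"
  where "riemannian_manifold M \<longleftrightarrow> smooth_atlas (atlas M) \<and> smooth_metric M \<and>
     (\<forall>x y. let L = {curve_length M p | p. C1_curve M p \<and> p 0 = x \<and> p 1 = y}
            in L \<noteq> {} \<longrightarrow> dist x y = Inf L)"

definition volume_measure ::
  "('m::metric_space, 'k::finite) riem \<Rightarrow> 'm measure \<Rightarrow> bool"
  where "volume_measure M m \<longleftrightarrow> sets m = sets borel \<and>
     (\<forall>c\<in>atlas M. \<forall>A\<in>sets borel. A \<subseteq> dom_of c \<longrightarrow>
        emeasure m A =
          (\<integral>\<^sup>+ u\<in>coord c ` A. ennreal (sqrt (det (gram M c (param c u)))) \<partial>lborel))"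

text \<open>Derivatives of self-maps of the manifold, in the preferred charts at \<open>x\<close> and \<open>f x\<close>.\<close>

definition local_rep ::
  "('m, 'k::finite) riem \<Rightarrow> ('m \<Rightarrow> 'm) \<Rightarrow> 'm \<Rightarrow> real^'k \<Rightarrow> real^'k"
  where "local_rep M f x = coord (chart_at M (f x)) \<circ> f \<circ> param (chart_at M x)"

definition mdifferentiable ::
  "('m::metric_space, 'k::finite) riem \<Rightarrow> ('m \<Rightarrow> 'm) \<Rightarrow> 'm \<Rightarrow> bool"
  where "mdifferentiable M f x \<longleftrightarrow> isCont f x \<and>
     local_rep M f x differentiable (at (coord (chart_at M x) x))"

definition mderiv ::
  "('m, 'k::finite) riem \<Rightarrow> ('m \<Rightarrow> 'm) \<Rightarrow> 'm \<Rightarrow> real^'k \<Rightarrow> real^'k"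
  where "mderiv M f x = frechet_derivative (local_rep M f x) (at (coord (chart_at M x) x))"

text \<open>Operator norm of a linear map from the tangent space at \<open>x\<close> to the one at \<open>y\<close>.\<close>

definition opnorm ::
  "('m, 'k::finite) riem \<Rightarrow> 'm \<Rightarrow> 'm \<Rightarrow> (real^'k \<Rightarrow> real^'k) \<Rightarrow> real"
  where "opnorm M x y L = (SUP v\<in>-{0}. tnorm M y (L v) / tnorm M x v)"

definition inv_deriv_norm :: "('m, 'k::finite) riem \<Rightarrow> ('m \<Rightarrow> 'm) \<Rightarrow> 'm \<Rightarrow> real"
  where "inv_deriv_norm M f x = opnorm M (f x) x (inv (mderiv M f x))"

text \<open>
  Absolute values of determinants with respect to orthonormal bases of the tangent spaces (the sign
  has no meaning on a manifold that is not oriented): for a self-map of the manifold, and for a map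
  from a subset of \<open>real^'k\<close> into the manifold.
\<close>

definition abs_det_deriv :: "('m, 'k::finite) riem \<Rightarrow> ('m \<Rightarrow> 'm) \<Rightarrow> 'm \<Rightarrow> real"
  where "abs_det_deriv M f x = \<bar>det (matrix (mderiv M f x))\<bar> *
     sqrt (det (gram_at M (f x))) / sqrt (det (gram_at M x))"

definition abs_det_param ::
  "('m, 'k::finite) riem \<Rightarrow> (real^'k) set \<Rightarrow> (real^'k \<Rightarrow> 'm) \<Rightarrow> real^'k \<Rightarrow> real"
  where "abs_det_param M Q F t =
     \<bar>det (matrix (frechet_derivative (coord (chart_at M (F t)) \<circ> F) (at t within Q)))\<bar> *
     sqrt (det (gram_at M (F t)))"

definition diffeo_onto_image ::
  "('m::metric_space, 'k::finite) riem \<Rightarrow> (real^'k) set \<Rightarrow> (real^'k \<Rightarrow> 'm) \<Rightarrow> bool"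
  where "diffeo_onto_image M Q F \<longleftrightarrow> inj_on F Q \<and> continuous_on Q F \<and>
     (\<forall>c\<in>atlas M. C1_on {t\<in>Q. F t \<in> dom_of c} (coord c \<circ> F) \<and>
        C1_on (coord c ` (dom_of c \<inter> F ` Q)) (inv_into Q F \<circ> param c))"

text \<open>\<open>f\<close> is of class \<open>C\<^sup>1\<^sup>+\<^sup>\<beta>\<close> on the open set \<open>V\<close>: its derivative is locally \<open>\<beta>\<close>-Hoelder there
  (no uniformity near the boundary of \<open>V\<close>).\<close>

definition C1_holder_on ::
  "('m::metric_space, 'k::finite) riem \<Rightarrow> real \<Rightarrow> 'm set \<Rightarrow> ('m \<Rightarrow> 'm) \<Rightarrow> bool"
  where "C1_holder_on M \<beta> V f \<longleftrightarrow> continuous_on V f \<and>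
     (\<forall>c\<in>atlas M. \<forall>c'\<in>atlas M.
        let F = coord c' \<circ> f \<circ> param c;
            W = coord c ` {x \<in> dom_of c \<inter> V. f x \<in> dom_of c'}
        in (\<forall>p\<in>W. F differentiable (at p)) \<and>
           (\<forall>p\<in>W. \<exists>\<epsilon>>0. \<exists>K. \<forall>q\<in>W \<inter> ball p \<epsilon>. \<forall>q'\<in>W \<inter> ball p \<epsilon>.
              onorm (\<lambda>v. frechet_derivative F (at q) v - frechet_derivative F (at q') v)
                \<le> K * dist q q' powr \<beta>))"

section \<open>Random maps\<close>

text \<open>
  Throughout, \<open>g :: 'm \<Rightarrow> real^'k \<Rightarrow> 'm\<close> is only used for parameters in \<open>cube \<sigma>\<close>, and the noise
  space has exactly the sequences in \<open>cube \<sigma>\<close> as points.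
\<close>

definition cube :: "real \<Rightarrow> (real^'k::finite) set"
  where "cube \<sigma> = cbox (\<chi> i. - \<sigma>) (\<chi> i. \<sigma>)"

definition noise :: "real \<Rightarrow> (real^'k::finite) measure"
  where "noise \<sigma> = uniform_measure (restrict_space lborel (cube \<sigma>)) (cube \<sigma>)"

definition noise_seq :: "real \<Rightarrow> (nat \<Rightarrow> real^'k::finite) measure"
  where "noise_seq \<sigma> = Pi\<^sub>M UNIV (\<lambda>_. noise \<sigma>)"

definition shift :: "(nat \<Rightarrow> 'e) \<Rightarrow> nat \<Rightarrow> 'e"
  where "shift \<omega> = (\<lambda>i. \<omega> (Suc i))"

definition rmap :: "('m \<Rightarrow> 'e \<Rightarrow> 'm) \<Rightarrow> (nat \<Rightarrow> 'e) \<Rightarrow> 'm \<Rightarrow> 'm"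
  where "rmap g \<omega> = (\<lambda>x. g x (\<omega> 0))"

primrec riter :: "('m \<Rightarrow> 'e \<Rightarrow> 'm) \<Rightarrow> nat \<Rightarrow> (nat \<Rightarrow> 'e) \<Rightarrow> 'm \<Rightarrow> 'm" where
  "riter g 0 \<omega> = id"
| "riter g (Suc n) \<omega> = rmap g ((shift ^^ n) \<omega>) \<circ> riter g n \<omega>"

definition critical_set ::
  "('m::metric_space, 'k::finite) riem \<Rightarrow> ('m \<Rightarrow> real^'k \<Rightarrow> 'm) \<Rightarrow> real^'k \<Rightarrow> 'm set"
  where "critical_set M g t =
     {x. \<not> (mdifferentiable M (\<lambda>y. g y t) x \<and> bij (mderiv M (\<lambda>y. g y t) x))}"

text \<open>
  Distance to a critical set. The critical set may be empty; its distance to any point is then the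
  constant 1 (\<open>infdist\<close> would give 0), so that the truncated distance is 1, as it must be, and the
  bounds involving the distance become uniform bounds.
\<close>

definition cdist :: "'m::metric_space \<Rightarrow> 'm set \<Rightarrow> real"
  where "cdist x C = (if C = {} then 1 else infdist x C)"

definition tdist :: "real \<Rightarrow> 'm::metric_space \<Rightarrow> 'm set \<Rightarrow> real"
  where "tdist r x C = (if cdist x C > r then 1 else cdist x C)"

definition transition ::
  "('m::metric_space \<Rightarrow> real^'k::finite \<Rightarrow> 'm) \<Rightarrow> real \<Rightarrow> 'm \<Rightarrow> 'm measure"
  where "transition g \<sigma> x = distr (noise \<sigma>) borel (g x)"

definition stationary ::
  "('m::metric_space \<Rightarrow> real^'k::finite \<Rightarrow> 'm) \<Rightarrow> real \<Rightarrow> 'm measure \<Rightarrow> bool"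
  where "stationary g \<sigma> \<mu> \<longleftrightarrow> prob_space \<mu> \<and> sets \<mu> = sets borel \<and>
     (\<forall>A\<in>sets borel. emeasure \<mu> A = (\<integral>\<^sup>+ x. emeasure (transition g \<sigma> x) A \<partial>\<mu>))"

definition ergodic_stationary ::
  "('m::metric_space \<Rightarrow> real^'k::finite \<Rightarrow> 'm) \<Rightarrow> real \<Rightarrow> 'm measure \<Rightarrow> bool"
  where "ergodic_stationary g \<sigma> \<mu> \<longleftrightarrow> stationary g \<sigma> \<mu> \<and>
     (\<forall>A\<in>sets borel. (AE x in \<mu>. emeasure (transition g \<sigma> x) A = indicator A x) \<longrightarrow>
        emeasure \<mu> A = 0 \<or> emeasure \<mu> A = 1)"

definition msupport :: "'m::topological_space measure \<Rightarrow> 'm set"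
  where "msupport \<mu> = {x. \<forall>U. open U \<and> x \<in> U \<longrightarrow> emeasure \<mu> U > 0}"

definition mstar :: "'m::metric_space measure \<Rightarrow> 'm measure \<Rightarrow> 'm measure"
  where "mstar m \<mu> = restrict_space m (msupport \<mu>)"

text \<open>
  The integrand is meaningful off the critical points only, hence the completion: its arbitrary
  values there must not affect measurability. Non-integrable integrands have integral 0, so
  \<open>lyap M g \<sigma> \<mu> > 0\<close> includes integrability.
\<close>

definition lyap ::
  "('m::metric_space, 'k::finite) riem \<Rightarrow> ('m \<Rightarrow> real^'k \<Rightarrow> 'm) \<Rightarrow> real \<Rightarrow> 'm measure \<Rightarrow> real"
  where "lyap M g \<sigma> \<mu> = - (\<integral>(x, \<omega>). ln (inv_deriv_norm M (rmap g \<omega>) x)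
     \<partial>completion (\<mu> \<Otimes>\<^sub>M noise_seq \<sigma>))"

definition S_sum ::
  "('m::metric_space, 'k::finite) riem \<Rightarrow> ('m \<Rightarrow> real^'k \<Rightarrow> 'm) \<Rightarrow>
     nat \<Rightarrow> 'm \<Rightarrow> (nat \<Rightarrow> real^'k) \<Rightarrow> real"
  where "S_sum M g n x \<omega> =
     (\<Sum>i\<le>n. ln (inv_deriv_norm M (rmap g ((shift ^^ i) \<omega>)) (riter g i \<omega> x)))"

definition Z_sum ::
  "('m::metric_space, 'k::finite) riem \<Rightarrow> ('m \<Rightarrow> real^'k \<Rightarrow> 'm) \<Rightarrow>
     nat \<Rightarrow> 'm \<Rightarrow> (nat \<Rightarrow> real^'k) \<Rightarrow> real \<Rightarrow> real"
  where "Z_sum M g n x \<omega> r =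
     - (\<Sum>i\<le>n. ln (tdist r (riter g i \<omega> x) (critical_set M g (\<omega> i))))"

section \<open>Hypotheses\<close>

definition H1 ::
  "('m::metric_space, 'k::finite) riem \<Rightarrow> ('m \<Rightarrow> real^'k \<Rightarrow> 'm) \<Rightarrow> real \<Rightarrow> real \<Rightarrow> bool"
  where "H1 M g \<sigma> \<beta> \<longleftrightarrow>
     continuous_on (UNIV \<times> cube \<sigma>) (\<lambda>(x, t). g x t) \<and>
     (\<forall>t\<in>cube \<sigma>. C1_holder_on M \<beta> (- critical_set M g t) (\<lambda>x. g x t)) \<and>
     (\<forall>x. diffeo_onto_image M (cube \<sigma>) (g x)) \<and>
     (\<exists>\<eta>>0. \<exists>K. \<forall>x y. \<forall>s\<in>cube \<sigma>. \<forall>t\<in>cube \<sigma>.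
        \<bar>abs_det_param M (cube \<sigma>) (g x) s - abs_det_param M (cube \<sigma>) (g y) t\<bar>
          \<le> K * dist (x, s) (y, t) powr \<eta>) \<and>
     (\<exists>c\<^sub>1>0. \<exists>c\<^sub>2>0. \<forall>x. \<forall>t\<in>cube \<sigma>.
        c\<^sub>1 \<ge> abs_det_param M (cube \<sigma>) (g x) t \<and> abs_det_param M (cube \<sigma>) (g x) t \<ge> c\<^sub>2)"

definition H2 ::
  "('m::metric_space, 'k::finite) riem \<Rightarrow> 'm measure \<Rightarrow> ('m \<Rightarrow> real^'k \<Rightarrow> 'm) \<Rightarrow>
     real \<Rightarrow> real \<Rightarrow> bool"
  where "H2 M m g \<sigma> \<beta> \<longleftrightarrow>
     (\<forall>t\<in>cube \<sigma>. closed (critical_set M g t) \<and> critical_set M g t \<in> null_sets m) \<and>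
     (\<exists>B>1. \<exists>\<alpha>>0. \<forall>t\<in>cube \<sigma>.
        (let f = (\<lambda>x. g x t); C = critical_set M g t in
          (\<forall>x. x \<notin> C \<longrightarrow> (\<forall>v. v \<noteq> 0 \<longrightarrow>
             1 / B * cdist x C powr \<alpha> \<le> tnorm M (f x) (mderiv M f x v) / tnorm M x v \<and>
             tnorm M (f x) (mderiv M f x v) / tnorm M x v \<le> B * cdist x C powr (- \<alpha>))) \<and>
          (\<forall>x y. x \<notin> C \<longrightarrow> y \<notin> C \<longrightarrow> dist x y \<le> cdist x C / 2 \<longrightarrow>
             \<bar>ln (inv_deriv_norm M f x) - ln (inv_deriv_norm M f y)\<bar>
               \<le> B / cdist x C powr \<alpha> * dist x y powr \<beta> \<and>
             \<bar>ln (abs_det_deriv M f x) - ln (abs_det_deriv M f y)\<bar>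
               \<le> B / cdist x C powr \<alpha> * dist x y powr \<beta>))) \<and>
     (\<forall>t\<in>cube \<sigma>. \<forall>\<epsilon>>0. \<exists>\<delta>>0. \<forall>s\<in>cube \<sigma>. dist s t < \<delta> \<longrightarrow>
        critical_set M g s \<subseteq> {x. \<exists>y\<in>critical_set M g t. dist x y < \<epsilon>})"

definition H3 ::
  "('m::metric_space, 'k::finite) riem \<Rightarrow> ('m \<Rightarrow> real^'k \<Rightarrow> 'm) \<Rightarrow> real \<Rightarrow> 'm measure \<Rightarrow> bool"
  where "H3 M g \<sigma> \<mu> \<longleftrightarrow> ergodic_stationary g \<sigma> \<mu> \<and> lyap M g \<sigma> \<mu> > 0"

definition H4 ::
  "('m::metric_space, 'k::finite) riem \<Rightarrow> 'm measure \<Rightarrow> ('m \<Rightarrow> real^'k \<Rightarrow> 'm) \<Rightarrow>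
     real \<Rightarrow> 'm measure \<Rightarrow> bool"
  where "H4 M m g \<sigma> \<mu> \<longleftrightarrow> (\<exists>C\<^sub>1>0. \<forall>\<^sub>F \<delta> in at_right 0.
     emeasure (mstar m \<mu> \<Otimes>\<^sub>M noise_seq \<sigma>)
       {(x, \<omega>) \<in> space (mstar m \<mu> \<Otimes>\<^sub>M noise_seq \<sigma>). cdist x (critical_set M g (\<omega> 0)) \<le> \<delta>}
     \<le> ennreal (C\<^sub>1 * \<delta>))"

text \<open>
  The event to be estimated. At the orbits that hit a critical set, a null set, \<open>S_sum\<close> and \<open>Z_sum\<close>
  have arbitrary values; the event is therefore measured by the completion of the product measure.
\<close>

definition bad_event ::
  "('m::metric_space, 'k::finite) riem \<Rightarrow> 'm measure \<Rightarrow> ('m \<Rightarrow> real^'k \<Rightarrow> 'm) \<Rightarrow>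
     real \<Rightarrow> 'm measure \<Rightarrow> real \<Rightarrow> nat \<Rightarrow> ('m \<times> (nat \<Rightarrow> real^'k)) set"
  where "bad_event M m g \<sigma> \<mu> r n =
     {(x, \<omega>) \<in> space (mstar m \<mu> \<Otimes>\<^sub>M noise_seq \<sigma>).
        S_sum M g n x \<omega> > - (lyap M g \<sigma> \<mu> / 2) * real n \<or>
        Z_sum M g n x \<omega> r > - (sqrt r * ln r * real n)}"

end

theory Submission
  imports Defs
begin

text \<open>
  Since the noise enters through diffeomorphisms with uniformly non-degenerate derivative, one step of
  the Markov chain turns any law into one with bounded density with respect to the volume. Together
  with ergodicity this gives, for every bounded observable \<open>h\<close> on the support of \<open>\<mu>\<close>, an approximate
  solution \<open>b\<close> of the Poisson equation \<open>h - \<integral>h d\<mu> = b - T b\<close> with an error that is uniformly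
  small on the whole support. Birkhoff sums of an observable with exponential moments are then, up to a bounded term
  and a small linear one, sums of martingale differences with exponential moments, and Chernoff's
  bound applies. By (H2) and (H4) both \<open>log \<parallel>df\<inverse>\<parallel>\<close> and the logarithm of the truncated distance have
  exponential moments; the space mean of the latter is \<open>O(r\<^sup>5\<^sup>/\<^sup>8)\<close>, which is smaller than
  \<open>- \<surd>r log r\<close> for small \<open>r\<close>. The constant \<open>C\<^sub>4\<close> can be taken independent of \<open>r\<close> because the
  total mass is a trivial bound for the small times.
\<close>

section \<open>Elementary estimates\<close>

text \<open>The obstacle is that the volume on the support of \<mu> need not be absolutely
  continuous with respect to \<mu>, so a statement valid \<mu>-almost everywhere says nothing about
  m-almost every starting point. The bridge is the strong Feller property: domination of all
  one-step laws by one finite measure upgrades weak continuity of the kernel to continuity of the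
  probability of hitting any given Borel set. Hence a \<mu>-null set is hit with probability 0 from
  every point of the support, and the support is forward invariant, so the argument can live on it.
  Ergodicity alone allows periodic behaviour: iterates of the Markov operator need not converge and
  there is no spectral gap to invert it with. A least-norm argument, as in the mean ergodic theorem,
  replaces them. The exponent 3/4 has this origin: by (H4) the distance to the critical set has a
  tail linear in \<delta>, so its powers above -1 are integrable. Giving 1/8 away to the logarithm
  leaves 5/8 for the power of r, which still exceeds 1/2.\<close>

lemma exp_le_quadratic: "exp z \<le> 1 + z + z\<^sup>2 * exp \<bar>z\<bar>" for z :: real
proof (cases "0 \<le> z")
  case True
  have "exp z * (1 - z) \<le> exp z * exp (- z)"
    by (intro mult_left_mono) (use exp_ge_add_one_self[of "- z"] in auto)
  then have "exp z - 1 \<le> z * exp z" by (simp add: exp_minus algebra_simps)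
  then have "z * (exp z - 1) \<le> z * (z * exp z)" using True by (rule mult_left_mono)
  with \<open>exp z - 1 \<le> z * exp z\<close> show ?thesis using True by (simp add: algebra_simps power2_eq_square)
next
  case False
  define w where "w = - z"
  have w: "0 < w" using False by (simp add: w_def)
  have "exp (- w) \<le> inverse (1 + w)"
    unfolding exp_minus using exp_ge_add_one_self[of w] w by (intro le_imp_inverse_le) auto
  also have "\<dots> \<le> 1 - w + w\<^sup>2"
  proof -
    have "1 \<le> (1 - w + w\<^sup>2) * (1 + w)" using w by (simp add: algebra_simps power2_eq_square)
    then show ?thesis using w by (simp add: field_simps)
  qed
  also have "\<dots> \<le> 1 - w + w\<^sup>2 * exp w"
    using mult_left_mono[of 1 "exp w" "w\<^sup>2"] w by simp
  finally show ?thesis using w by (simp add: w_def)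
qed

text \<open>Prepares Chernoff's bound: the linear term will have mean zero, and the remainder is of
  order \<theta>^2. Half of the exponent \<open>\<kappa> * |y|\<close> absorbs the factor
  \<open>y^2\<close>, the other half absorbs \<open>exp (\<theta> * |y|)\<close>.\<close>

lemma exp_scaled_le:
  fixes y \<theta> \<kappa> :: real
  assumes "0 < \<theta>" "\<theta> \<le> \<kappa> / 2"
  shows "exp (\<theta> * y) \<le> 1 + \<theta> * y + 8 * \<theta>\<^sup>2 / \<kappa>\<^sup>2 * exp (\<kappa> * \<bar>y\<bar>)"
proof -
  have \<kappa>: "0 < \<kappa>" using assms by linarith
  define v where "v = \<kappa> * \<bar>y\<bar> / 2"
  have v: "0 \<le> v" "\<theta> * \<bar>y\<bar> \<le> v"
    using \<kappa> mult_right_mono[OF assms(2), of "\<bar>y\<bar>"] by (auto simp: v_def)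
  have sq: "(\<theta> * y)\<^sup>2 = 4 * \<theta>\<^sup>2 / \<kappa>\<^sup>2 * v\<^sup>2"
    using \<kappa> by (simp add: v_def power_mult_distrib power_divide)
  have v2: "v\<^sup>2 \<le> 2 * exp v" using exp_lower_Taylor_quadratic[OF v(1)] v(1) by simp
  have "(\<theta> * y)\<^sup>2 * exp \<bar>\<theta> * y\<bar> \<le> (4 * \<theta>\<^sup>2 / \<kappa>\<^sup>2 * (2 * exp v)) * exp v"
    unfolding sq using v2 v assms(1) \<kappa> by (intro mult_mono mult_left_mono) (auto simp: abs_mult)
  also have "\<dots> = 8 * \<theta>\<^sup>2 / \<kappa>\<^sup>2 * exp (\<kappa> * \<bar>y\<bar>)"
    by (simp add: v_def exp_add[symmetric] field_simps)
  finally show ?thesis using exp_le_quadratic[of "\<theta> * y"] by linarith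
qed

lemma abs_le_exp_div:
  fixes \<kappa> y :: real assumes "0 < \<kappa>" shows "\<bar>y\<bar> \<le> exp (\<kappa> * \<bar>y\<bar>) / \<kappa>"
  proof -
  have "\<kappa> * \<bar>y\<bar> \<le> exp (\<kappa> * \<bar>y\<bar>)" using exp_ge_add_one_self[of "\<kappa> * \<bar>y\<bar>"] by linarith
  then show ?thesis using assms by (simp add: field_simps)
qed

lemma exponential_Markov:
  fixes f :: "'a \<Rightarrow> real"
  assumes [measurable]: "f \<in> borel_measurable L"
  shows "emeasure L {\<omega>\<in>space L. f \<omega> > y} \<le> ennreal (exp (- y)) * (\<integral>\<^sup>+\<omega>. ennreal (exp (f \<omega>)) \<partial>L)"
proof -
  have "emeasure L {\<omega>\<in>space L. f \<omega> > y} = (\<integral>\<^sup>+\<omega>. indicator {\<omega>\<in>space L. f \<omega> > y} \<omega> \<partial>L)"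
    by simp
  also have "\<dots> \<le> (\<integral>\<^sup>+\<omega>. ennreal (exp (- y)) * ennreal (exp (f \<omega>)) \<partial>L)"
    by (intro nn_integral_mono)
      (auto simp: indicator_def ennreal_mult[symmetric] exp_add[symmetric] simp flip: ennreal_1 intro!: ennreal_leI)
  also have "\<dots> = ennreal (exp (- y)) * (\<integral>\<^sup>+\<omega>. ennreal (exp (f \<omega>)) \<partial>L)"
    by (rule nn_integral_cmult) measurable
  finally show ?thesis .
qed

lemma sum_even_odd:
  fixes f :: "nat \<Rightarrow> 'a::comm_monoid_add"
  shows "(\<Sum>i<n. f i) = (\<Sum>j<(n + 1) div 2. f (2 * j)) + (\<Sum>j<n div 2. f (2 * j + 1))"
proof (induction n)
  case (Suc n)
  show ?case
  proof (cases "even n")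
    case True
    then obtain k where "n = 2 * k" by blast
    then show ?thesis using Suc by (simp add: ac_simps)
  next
    case False
    then obtain k where "n = 2 * k + 1" using oddE by blast
    then show ?thesis using Suc by (simp add: ac_simps)
  qed
qed simp

lemma measurable_pair_compose:
  assumes "(\<lambda>z. f (fst z) (snd z)) \<in> A \<Otimes>\<^sub>M B \<rightarrow>\<^sub>M C" "u \<in> L \<rightarrow>\<^sub>M A" "h \<in> L \<rightarrow>\<^sub>M B"
  shows "(\<lambda>z. f (u z) (h z)) \<in> L \<rightarrow>\<^sub>M C"
  using measurable_compose[OF measurable_Pair[OF assms(2,3)] assms(1)] by simp

lemma measurable_case_prod_compose:
  assumes "(\<lambda>(x, y). f x y) \<in> A \<Otimes>\<^sub>M B \<rightarrow>\<^sub>M C" "u \<in> L \<rightarrow>\<^sub>M A" "h \<in> L \<rightarrow>\<^sub>M B"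
  shows "(\<lambda>z. f (u z) (h z)) \<in> L \<rightarrow>\<^sub>M C"
  using measurable_compose[OF measurable_Pair[OF assms(2,3)] assms(1)] by simp

lemma shift_funpow: "(shift ^^ n) \<omega> i = \<omega> (i + n)"
  by (induction n arbitrary: \<omega> i) (auto simp: shift_def)

lemma riter_Suc: "riter g (Suc n) \<omega> x = g (riter g n \<omega> x) (\<omega> n)"
  by (simp add: rmap_def shift_funpow)

text \<open>The Markov property at the first step. It lets one average over the first noise value
  and continue from the random point \<open>g x s\<close>, whereas \<open>riter_Suc\<close> adds
  noise at the end.\<close>

lemma riter_case_nat: "riter g (Suc n) (case_nat s \<omega>) x = riter g n \<omega> (g x s)"
proof (induction n)
  case 0 show ?case by (simp add: rmap_def)
next
  case (Suc n)
  show ?case by (subst riter_Suc, subst Suc) (simp add: riter_Suc del: riter.simps(2))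
qed

text \<open>The sums in the event have arbitrary values on orbits that meet a critical set.
  Agreement with a measurable set off a null set is all that the completion asks for.\<close>

lemma sets_completion_cong:
  assumes "B \<in> sets M" "N \<in> null_sets M" "A - N = B - N"
  shows "A \<in> sets (completion M)" "emeasure (completion M) A = emeasure M B"
proof -
  have A: "A = (B - N) \<union> (A \<inter> N)" using assms(3) by auto
  show As: "A \<in> sets (completion M)"
    by (rule sets_completionI[OF A, of N]) (use assms in auto)
  have "emeasure (completion M) A = emeasure (completion M) B"
  proof (rule emeasure_eq_AE[OF _ As])
    have "AE x in completion M. x \<notin> N" using assms(2) by (intro AE_completion AE_not_in)
    then show "AE x in completion M. x \<in> A \<longleftrightarrow> x \<in> B" by eventually_elim (use assms(3) in blast)
  qed (use assms in auto)
  then show "emeasure (completion M) A = emeasure M B" using assms(1) by simp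
qed

lemma borel_measurable_completion_cong:
  fixes f h :: "'a \<Rightarrow> real"
  assumes h: "h \<in> borel_measurable M" and N: "N \<in> null_sets M" "\<And>x. x \<in> space M - N \<Longrightarrow> f x = h x"
  shows "f \<in> borel_measurable (completion M)"
proof (rule measurableI)
  fix S :: "real set" assume "S \<in> sets borel"
  then have "h -` S \<inter> space M \<in> sets M" using h by (rule measurable_sets[rotated])
  then have "f -` S \<inter> space M \<in> sets (completion M)"
    by (rule sets_completion_cong(1)[OF _ N(1)]) (use N(2) in auto)
  then show "f -` S \<inter> space (completion M) \<in> sets (completion M)" by simp
qed simp

text \<open>Trades the constant C for a smaller rate. For large n half of the decay makes the factor
  with C less than 1. For the finitely many other n the new rate is so small that
  \<open>exp (- \<gamma>' * n)\<close> is at least 1/2, and the trivial bound T is below half of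
  \<open>2 * T + 1\<close>; the summand 1 makes the inequality strict.\<close>

lemma exponential_bound_uniform:
  fixes a :: "nat \<Rightarrow> ennreal"
  assumes T: "0 \<le> T" "\<And>n. a n \<le> ennreal T" and e: "0 < \<gamma>" "\<And>n. a n \<le> ennreal (C * exp (- \<gamma> * n))"
  shows "\<exists>\<gamma>'>0. \<forall>n. a n < ennreal ((2 * T + 1) * exp (- \<gamma>' * n))"
proof -
  have "(\<lambda>n. C * exp (- (\<gamma> / 2)) ^ n) \<longlonglongrightarrow> 0"
    by (intro tendsto_mult_right_zero LIMSEQ_power_zero) (use e in simp)
  then have "\<forall>\<^sub>F n in sequentially. C * exp (- (\<gamma> / 2)) ^ n < 1"
    by (rule order_tendstoD) simp
  then obtain N where N: "\<And>n. n \<ge> N \<Longrightarrow> C * exp (- (\<gamma> / 2)) ^ n < 1"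
    by (auto simp: eventually_sequentially)
  define \<gamma>' where "\<gamma>' = min (\<gamma> / 2) (ln 2 / Suc N)"
  have g: "0 < \<gamma>'" "\<gamma>' \<le> \<gamma> / 2" "\<gamma>' * Suc N \<le> ln 2"
  proof -
    show "0 < \<gamma>'" using e(1) by (simp add: \<gamma>'_def)
    show "\<gamma>' \<le> \<gamma> / 2" unfolding \<gamma>'_def by (rule min.cobounded1)
    have "\<gamma>' \<le> ln 2 / Suc N" by (simp add: \<gamma>'_def)
    then show "\<gamma>' * Suc N \<le> ln 2" by (simp add: field_simps)
  qed
  have "a n < ennreal ((2 * T + 1) * exp (- \<gamma>' * n))" for n
  proof (cases "n \<ge> N")
    case True
    have "C * exp (- \<gamma> * n) = (C * exp (- (\<gamma> / 2)) ^ n) * exp (- (\<gamma> / 2) * n)"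
      by (simp add: exp_of_nat_mult[symmetric] mult.assoc exp_add[symmetric] algebra_simps)
    also have "\<dots> < 1 * exp (- (\<gamma> / 2) * n)" by (intro mult_strict_right_mono N True) simp
    also have "\<dots> \<le> 1 * exp (- \<gamma>' * n)" using mult_right_mono[OF g(2), of "real n"] by simp
    also have "\<dots> \<le> (2 * T + 1) * exp (- \<gamma>' * n)" using T by (intro mult_right_mono) auto
    finally have "ennreal (C * exp (- \<gamma> * n)) < ennreal ((2 * T + 1) * exp (- \<gamma>' * n))"
      using T(1) by (intro ennreal_lessI) auto
    then show ?thesis using e(2)[of n] by (rule le_less_trans[rotated])
  next
    case False
    have "\<gamma>' * n \<le> \<gamma>' * Suc N" using False g by (intro mult_left_mono) auto
    then have "\<gamma>' * n \<le> ln 2" using g by linarith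
    then have "exp (- ln 2) \<le> exp (- \<gamma>' * n)" by simp
    then have "1 / 2 \<le> exp (- \<gamma>' * n)" by (simp add: exp_minus)
    then have "(2 * T + 1) * (1 / 2) \<le> (2 * T + 1) * exp (- \<gamma>' * n)" using T by (intro mult_left_mono) auto
    then have "T < (2 * T + 1) * exp (- \<gamma>' * n)" by simp
    then have "ennreal T < ennreal ((2 * T + 1) * exp (- \<gamma>' * n))" using T(1) by (intro ennreal_lessI) auto
    then show ?thesis using T(2)[of n] by (rule le_less_trans[rotated])
  qed
  then show ?thesis using g by blast
qed

text \<open>Turns a tail bound on the levels \<open>exp (- k)\<close> into a moment bound: with k
  the integer part of \<open>- ln y\<close>, the point lies below level k and its power is at most
  \<open>exp (q * (k + 1))\<close>.\<close>

lemma dyadic_powr_bound: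
  fixes y q :: real
  assumes "0 \<le> y" "0 < q"
  shows "ennreal (min 1 y powr - q) \<le> 1 + (\<Sum>k. ennreal (exp (q * (real k + 1))) * indicator {..exp (- real k)} y)"
proof (cases "0 < y \<and> y < 1")
  case True
  define u where "u = - ln y"
  have u: "0 < u" "y = exp (- u)" using True by (auto simp: u_def)
  define k where "k = nat \<lfloor>u\<rfloor>"
  have k: "real k \<le> u" "u < real k + 1" using u unfolding k_def by linarith+
  have yk: "y \<le> exp (- real k)" using k(1) u(2) by simp
  have "min 1 y powr - q = exp (q * u)" using True by (simp add: powr_def u_def min_def)
  also have "\<dots> \<le> exp (q * (real k + 1))" using k assms by simp
  finally have "ennreal (min 1 y powr - q) \<le> ennreal (exp (q * (real k + 1)))" by (rule ennreal_leI)
  also have "\<dots> = ennreal (exp (q * (real k + 1))) * indicator {..exp (- real k)} y"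
    using yk by simp
  also have "\<dots> = (\<Sum>k\<in>{k}. ennreal (exp (q * (real k + 1))) * indicator {..exp (- real k)} y)"
    by (subst sum.insert) (simp_all only: finite.emptyI empty_iff sum.empty add_0_right not_False_eq_True)
  also have "\<dots> \<le> (\<Sum>k. ennreal (exp (q * (real k + 1))) * indicator {..exp (- real k)} y)"
    by (rule sum_le_suminf) auto
  finally show ?thesis by (simp add: add_increasing)
next
  case False
  \<comment> \<open>By the convention that a power with base 0 is 0, the point y = 0 is covered by
    the summand 1.\<close>
  then have "y = 0 \<or> min 1 y = 1" using assms by auto
  then have "min 1 y powr - q \<le> 1" using assms by auto
  then have "ennreal (min 1 y powr - q) \<le> 1" by (simp add: ennreal_le_1)
  then show ?thesis by (simp add: add_increasing2)
qed

section \<open>Large deviations for random maps with bounded transition densities\<close>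

text \<open>To be instantiated with the volume on the support of \<mu> and with the restriction of
  \<mu> to it. \<open>density\<close> is the smoothing by one step; \<open>step_null\<close> is the
  pointwise form of the strong Feller property, which transfers \<mu>-almost sure statements to
  every starting point, also where \<open>m\<close> charges \<mu>-null sets.\<close>

locale random_map = M: finite_measure m + N: prob_space N
  for m :: "'x measure" and N :: "'e measure" +
  fixes g :: "'x \<Rightarrow> 'e \<Rightarrow> 'x" and D :: real and \<mu> :: "'x measure"
  assumes g_meas: "(\<lambda>(x, t). g x t) \<in> m \<Otimes>\<^sub>M N \<rightarrow>\<^sub>M m"
    and D_nonneg: "0 \<le> D"
    and density: "x \<in> space m \<Longrightarrow> A \<in> sets m \<Longrightarrow>
      emeasure N {t \<in> space N. g x t \<in> A} \<le> ennreal D * emeasure m A"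
    and prob_mu: "prob_space \<mu>" and sets_mu[measurable_cong]: "sets \<mu> = sets m"
    and stat: "A \<in> sets m \<Longrightarrow>
      emeasure \<mu> A = (\<integral>\<^sup>+x. emeasure N {t \<in> space N. g x t \<in> A} \<partial>\<mu>)"
    and erg: "A \<in> sets m \<Longrightarrow>
      (AE x in \<mu>. emeasure N {t \<in> space N. g x t \<in> A} = indicator A x) \<Longrightarrow>
      emeasure \<mu> A = 0 \<or> emeasure \<mu> A = 1"
    and step_null: "A \<in> null_sets \<mu> \<Longrightarrow> x \<in> space m \<Longrightarrow>
      emeasure N {t \<in> space N. g x t \<in> A} = 0"
begin

sublocale mu: prob_space \<mu> by (rule prob_mu)
sublocale muN: pair_prob_space \<mu> N ..
sublocale mN: pair_sigma_finite m N ..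

lemma space_mu[simp]: "space \<mu> = space m"
  by (rule sets_eq_imp_space_eq[OF sets_mu])

lemma g_measurable[measurable (raw)]:
  "f \<in> L \<rightarrow>\<^sub>M m \<Longrightarrow> h \<in> L \<rightarrow>\<^sub>M N \<Longrightarrow> (\<lambda>z. g (f z) (h z)) \<in> L \<rightarrow>\<^sub>M m"
  using measurable_compose[OF measurable_Pair g_meas, of f L h] by simp

lemma g_in[simp]: "x \<in> space m \<Longrightarrow> t \<in> space N \<Longrightarrow> g x t \<in> space m"
  using measurable_space[OF g_meas, of "(x, t)"] by (simp add: space_pair_measure)

section \<open>The Markov operator and integration against the stationary measure\<close>

definition T :: "('x \<Rightarrow> real) \<Rightarrow> 'x \<Rightarrow> real" where
  "T b x = (\<integral>t. b (g x t) \<partial>N)"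

text \<open>A bound at every point instead of almost everywhere, because the Poisson equation will
  be solved approximately at every starting point.\<close>

definition bdd :: "real \<Rightarrow> ('x \<Rightarrow> real) \<Rightarrow> bool" where
  "bdd B b \<longleftrightarrow> b \<in> borel_measurable m \<and> (\<forall>x\<in>space m. \<bar>b x\<bar> \<le> B)"

lemma bdd_integrable:
  assumes "bdd B b"
  shows "integrable \<mu> b" "x \<in> space m \<Longrightarrow> integrable N (\<lambda>t. b (g x t))"
    "integrable (\<mu> \<Otimes>\<^sub>M N) (\<lambda>z. b (g (fst z) (snd z)))"
proof -
  have [measurable]: "b \<in> borel_measurable m" using assms by (simp add: bdd_def)
  show "integrable \<mu> b"
    by (rule mu.integrable_const_bound[of _ B]) (use assms in \<open>auto simp: bdd_def intro!: AE_I2\<close>)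
  show "integrable N (\<lambda>t. b (g x t))" if "x \<in> space m"
    by (rule N.integrable_const_bound[of _ B]) (use assms that in \<open>auto simp: bdd_def intro!: AE_I2\<close>)
  show "integrable (\<mu> \<Otimes>\<^sub>M N) (\<lambda>z. b (g (fst z) (snd z)))"
    by (rule muN.P.integrable_const_bound[of _ B])
      (use assms in \<open>auto simp: bdd_def space_pair_measure intro!: AE_I2\<close>)
qed

lemma T_measurable[measurable (raw)]:
  assumes [measurable]: "b \<in> borel_measurable m"
  shows "T b \<in> borel_measurable m"
  unfolding T_def by measurable

lemma T_bdd: assumes "bdd B b" shows "bdd B (T b)"
proof -
  have [measurable]: "b \<in> borel_measurable m" using assms by (simp add: bdd_def)
  { fix x assume x: "x \<in> space m"
    have "\<bar>T b x\<bar> \<le> (\<integral>t. \<bar>b (g x t)\<bar> \<partial>N)" unfolding T_def by simp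
    also have "\<dots> \<le> (\<integral>t. B \<partial>N)"
      by (rule integral_mono) (use assms x bdd_integrable(2)[OF assms x] in \<open>auto simp: bdd_def\<close>)
    finally have "\<bar>T b x\<bar> \<le> B" by (simp add: N.prob_space) }
  then show ?thesis by (auto simp: bdd_def)
qed

lemma bdd_combine:
  assumes "bdd B b" "bdd C c"
  shows "bdd (\<bar>p\<bar> * B + \<bar>q\<bar> * C) (\<lambda>x. p * b x + q * c x)"
proof -
  have "\<bar>p * b x + q * c x\<bar> \<le> \<bar>p\<bar> * B + \<bar>q\<bar> * C" if "x \<in> space m" for x
  proof -
    have "\<bar>p * b x + q * c x\<bar> \<le> \<bar>p\<bar> * \<bar>b x\<bar> + \<bar>q\<bar> * \<bar>c x\<bar>"
      by (metis abs_triangle_ineq abs_mult)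
    also have "\<dots> \<le> \<bar>p\<bar> * B + \<bar>q\<bar> * C"
      using assms that by (auto simp: bdd_def intro!: add_mono mult_left_mono)
    finally show ?thesis .
  qed
  moreover have [measurable]: "b \<in> borel_measurable m" "c \<in> borel_measurable m"
    using assms by (auto simp: bdd_def)
  ultimately show ?thesis by (auto simp: bdd_def)
qed

lemma T_combine:
  assumes "bdd B b" "bdd C c" "x \<in> space m"
  shows "T (\<lambda>x. p * b x + q * c x) x = p * T b x + q * T c x"
  unfolding T_def using bdd_integrable(2)[OF assms(1,3)] bdd_integrable(2)[OF assms(2,3)] by simp

lemma emeasure_step:
  assumes [measurable]: "A \<in> sets m" and "x \<in> space m"
  shows "emeasure N {t \<in> space N. g x t \<in> A} = emeasure (distr N m (g x)) A"
  using assms(2) by (subst emeasure_distr) (auto intro!: arg_cong[where f="emeasure N"])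

text \<open>Stationarity as an image measure; in this form almost sure limits under \<mu> can be
  pulled back along one random step.\<close>

lemma distr_g: "distr (\<mu> \<Otimes>\<^sub>M N) \<mu> (\<lambda>z. g (fst z) (snd z)) = \<mu>"
proof (rule measure_eqI)
  fix A assume "A \<in> sets (distr (\<mu> \<Otimes>\<^sub>M N) \<mu> (\<lambda>z. g (fst z) (snd z)))"
  then have [measurable]: "A \<in> sets m" by (simp add: sets_mu)
  have "emeasure (distr (\<mu> \<Otimes>\<^sub>M N) \<mu> (\<lambda>z. g (fst z) (snd z))) A
    = emeasure (\<mu> \<Otimes>\<^sub>M N) ((\<lambda>z. g (fst z) (snd z)) -` A \<inter> space (\<mu> \<Otimes>\<^sub>M N))"
    by (subst emeasure_distr) auto
  also have "\<dots> = (\<integral>\<^sup>+x. emeasure N (Pair x -` ((\<lambda>z. g (fst z) (snd z)) -` A \<inter> space (\<mu> \<Otimes>\<^sub>M N))) \<partial>\<mu>)"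
    by (rule N.emeasure_pair_measure_alt) measurable
  also have "\<dots> = (\<integral>\<^sup>+x. emeasure N {t \<in> space N. g x t \<in> A} \<partial>\<mu>)"
    by (intro nn_integral_cong arg_cong[where f="emeasure N"]) (auto simp: space_pair_measure)
  also have "\<dots> = emeasure \<mu> A" by (rule stat[symmetric]) simp
  finally show "emeasure (distr (\<mu> \<Otimes>\<^sub>M N) \<mu> (\<lambda>z. g (fst z) (snd z))) A = emeasure \<mu> A" .
qed simp

lemma integral_g:
  fixes b :: "'x \<Rightarrow> real"
  assumes [measurable]: "b \<in> borel_measurable m"
  shows "(\<integral>z. b (g (fst z) (snd z)) \<partial>(\<mu> \<Otimes>\<^sub>M N)) = (\<integral>x. b x \<partial>\<mu>)"
  by (subst (2) distr_g[symmetric], subst integral_distr) auto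

lemma integral_T:
  assumes "bdd B b" shows "(\<integral>x. T b x \<partial>\<mu>) = (\<integral>x. b x \<partial>\<mu>)"
proof -
  have [measurable]: "b \<in> borel_measurable m" using assms by (simp add: bdd_def)
  have "(\<integral>x. T b x \<partial>\<mu>) = (\<integral>z. b (g (fst z) (snd z)) \<partial>(\<mu> \<Otimes>\<^sub>M N))"
    unfolding T_def using bdd_integrable(3)[OF assms]
    by (subst muN.integral_fst'[symmetric]) auto
  then show ?thesis by (simp add: integral_g)
qed

lemma step_nn_integral_le:
  assumes "x \<in> space m" and [measurable]: "h \<in> borel_measurable m"
  shows "(\<integral>\<^sup>+t. h (g x t) \<partial>N) \<le> ennreal D * (\<integral>\<^sup>+y. h y \<partial>m)"
proof -
  have [measurable]: "g x \<in> N \<rightarrow>\<^sub>M m" using assms(1) by measurable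
  have "(\<integral>\<^sup>+t. h (g x t) \<partial>N) = nn_integral (distr N m (g x)) h"
    by (subst nn_integral_distr) auto
  also have "\<dots> \<le> nn_integral (scale_measure D m) h"
    by (rule nn_integral_mono_measure)
      (auto simp: le_measure le_fun_def emeasure_step[OF _ assms(1), symmetric] intro!: density assms(1))
  finally show ?thesis by (simp add: nn_integral_scale_measure)
qed

text \<open>By stationarity \<mu> is an average of one-step laws, each dominated by D times
  \<open>m\<close>.\<close>

lemma mu_le: "A \<in> sets m \<Longrightarrow> emeasure \<mu> A \<le> ennreal D * emeasure m A"
proof -
  assume A: "A \<in> sets m"
  have "emeasure \<mu> A \<le> (\<integral>\<^sup>+x. ennreal D * emeasure m A \<partial>\<mu>)"
    unfolding stat[OF A] by (rule nn_integral_mono) (use density A in auto)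
  then show ?thesis by (simp add: mu.emeasure_space_1[simplified])
qed

lemma mu_nn_integral_le:
  assumes [measurable]: "h \<in> borel_measurable m"
  shows "(\<integral>\<^sup>+y. h y \<partial>\<mu>) \<le> ennreal D * (\<integral>\<^sup>+y. h y \<partial>m)"
proof -
  have "nn_integral \<mu> h \<le> nn_integral (scale_measure D m) h"
    by (rule nn_integral_mono_measure)
       (auto simp: le_measure le_fun_def sets_mu mu_le)
  then show ?thesis by (simp add: nn_integral_scale_measure)
qed

lemma prob_mu_space[simp]: "measure \<mu> (space m) = 1"
  using mu.prob_space by simp

lemma bdd_add: "bdd B b \<Longrightarrow> bdd C c \<Longrightarrow> bdd (B + C) (\<lambda>x. b x + c x)"
  using bdd_combine[of B b C c 1 1] by simp

lemma bdd_mult: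
  assumes "bdd B b" "bdd C c" shows "bdd (B * C) (\<lambda>x. b x * c x)"
proof -
  have [measurable]: "b \<in> borel_measurable m" "c \<in> borel_measurable m"
    using assms by (auto simp: bdd_def)
  have "\<bar>b x * c x\<bar> \<le> B * C" if "x \<in> space m" for x
    unfolding abs_mult using assms that by (intro mult_mono) (auto simp: bdd_def intro: order_trans[OF abs_ge_zero])
  then show ?thesis by (auto simp: bdd_def)
qed

lemma bdd_nonneg: "bdd B b \<Longrightarrow> 0 \<le> B"
  using mu.not_empty by (auto simp: bdd_def intro: order_trans[OF abs_ge_zero])

section \<open>From ergodicity to an approximate Poisson equation\<close>

lemma T_square_le:
  assumes "bdd B b" "x \<in> space m"
  shows "(T b x)\<^sup>2 \<le> T (\<lambda>y. b y * b y) x"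
proof -
  let ?c = "T b x"
  have i: "integrable N (\<lambda>t. b (g x t))" "integrable N (\<lambda>t. b (g x t) * b (g x t))"
    using bdd_integrable(2)[OF assms] bdd_integrable(2)[OF bdd_mult[OF assms(1,1)] assms(2)] by auto
  have "0 \<le> (\<integral>t. (b (g x t) - ?c)\<^sup>2 \<partial>N)" by simp
  also have "\<dots> = (\<integral>t. b (g x t) * b (g x t) - 2 * ?c * b (g x t) + ?c\<^sup>2 \<partial>N)"
    by (rule Bochner_Integration.integral_cong) (auto simp: power2_eq_square algebra_simps)
  also have "\<dots> = T (\<lambda>y. b y * b y) x - 2 * ?c * ?c + ?c\<^sup>2"
    using i by (simp add: T_def N.prob_space)
  finally show ?thesis by (simp add: power2_eq_square)
qed

text \<open>The set where u exceeds its mean is invariant, so it has probability 0 or 1. Probability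
  1 is absurd, since u cannot exceed its own mean almost surely; hence u is at most its mean, and
  equality of the integrals forces equality almost everywhere.\<close>

lemma harmonic_const:
  fixes u :: "'x \<Rightarrow> real"
  assumes [measurable]: "u \<in> borel_measurable m" and iu: "integrable \<mu> u"
    and ae: "AE z in \<mu> \<Otimes>\<^sub>M N. u (g (fst z) (snd z)) = u (fst z)"
  shows "AE x in \<mu>. u x = (\<integral>x. u x \<partial>\<mu>)"
proof -
  define c where "c = (\<integral>x. u x \<partial>\<mu>)"
  define A where "A = {x\<in>space m. u x > c}"
  have [measurable]: "A \<in> sets m" unfolding A_def by measurable
  have "AE x in \<mu>. AE t in N. u (g x t) = u x"
    using muN.AE_pair[OF ae] by simp
  then have "AE x in \<mu>. emeasure N {t \<in> space N. g x t \<in> A} = indicator A x"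
    using AE_space
  proof eventually_elim
    fix x assume *: "AE t in N. u (g x t) = u x" and "x \<in> space \<mu>"
    then have x: "x \<in> space m" by simp
    have gx[measurable]: "g x \<in> N \<rightarrow>\<^sub>M m" using x by measurable
    have "AE t in N. t \<in> {t \<in> space N. g x t \<in> A} \<longleftrightarrow> t \<in> {t \<in> space N. x \<in> A}"
      using * AE_space by eventually_elim (use x in \<open>auto simp: A_def\<close>)
    then have "emeasure N {t \<in> space N. g x t \<in> A} = emeasure N {t \<in> space N. x \<in> A}"
      by (rule emeasure_eq_AE) measurable
    then show "emeasure N {t \<in> space N. g x t \<in> A} = indicator A x"
      using N.emeasure_space_1 by (auto simp: indicator_def)
  qed
  then have "emeasure \<mu> A = 0 \<or> emeasure \<mu> A = 1" by (rule erg[rotated]) simp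
  moreover have False if "emeasure \<mu> A = 1"
  proof -
    have gt: "AE x in \<mu>. u x > c"
      using mu.AE_prob_1[of A] that by (auto simp: A_def measure_def elim: eventually_mono)
    then have "(\<integral>x. u x - c \<partial>\<mu>) = 0 \<longleftrightarrow> (AE x in \<mu>. u x - c = 0)"
      by (intro integral_nonneg_eq_0_iff_AE) (use iu in \<open>auto elim: eventually_mono\<close>)
    then have "AE x in \<mu>. u x - c = 0" using iu by (simp add: c_def)
    with gt have "AE x in \<mu>. False" by eventually_elim simp
    then show False by simp
  qed
  ultimately have "A \<in> null_sets \<mu>" by (auto simp: sets_mu)
  then have le: "AE x in \<mu>. u x \<le> c"
    by (rule AE_I') (auto simp: A_def)
  then have "(\<integral>x. c - u x \<partial>\<mu>) = 0 \<longleftrightarrow> (AE x in \<mu>. c - u x = 0)"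
      by (intro integral_nonneg_eq_0_iff_AE) (use iu in \<open>auto elim: eventually_mono\<close>)
  then have "AE x in \<mu>. c - u x = 0" using iu by (simp add: c_def)
  then show ?thesis by (auto simp: c_def elim: eventually_mono)
qed

text \<open>The sum of the absolute increments has finite integral, so it is finite almost
  everywhere and the sequence converges by telescoping.\<close>

lemma summable_L1_converges:
  fixes W :: "nat \<Rightarrow> 'x \<Rightarrow> real"
  assumes W: "\<And>j. bdd B (W j)"
    and le: "\<And>j. (\<integral>x. \<bar>W (Suc j) x - W j x\<bar> \<partial>\<mu>) \<le> a j" and "summable a"
  shows "AE x in \<mu>. convergent (\<lambda>j. W j x)"
proof -
  have Wm[measurable]: "\<And>j. W j \<in> borel_measurable m" using W by (auto simp: bdd_def)
  have i: "integrable \<mu> (\<lambda>x. \<bar>W (Suc j) x - W j x\<bar>)" for j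
    using bdd_integrable(1)[OF W] by auto
  have "(\<integral>\<^sup>+x. (\<Sum>j. ennreal \<bar>W (Suc j) x - W j x\<bar>) \<partial>\<mu>) = (\<Sum>j. \<integral>\<^sup>+x. ennreal \<bar>W (Suc j) x - W j x\<bar> \<partial>\<mu>)"
    by (rule nn_integral_suminf) measurable
  also have "\<dots> = (\<Sum>j. ennreal (\<integral>x. \<bar>W (Suc j) x - W j x\<bar> \<partial>\<mu>))"
    by (subst nn_integral_eq_integral[OF i]) auto
  also have "\<dots> \<le> (\<Sum>j. ennreal (a j))"
    by (intro suminf_le ennreal_leI le) auto
  also have "\<dots> = ennreal (\<Sum>j. a j)"
    using le by (intro suminf_ennreal2 \<open>summable a\<close>) (auto intro: order_trans[OF _ le])
  finally have "(\<integral>\<^sup>+x. (\<Sum>j. ennreal \<bar>W (Suc j) x - W j x\<bar>) \<partial>\<mu>) \<noteq> \<infinity>"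
    by (auto simp: top_unique)
  then have "AE x in \<mu>. (\<Sum>j. ennreal \<bar>W (Suc j) x - W j x\<bar>) \<noteq> \<infinity>"
    by (intro nn_integral_PInf_AE) auto
  then show ?thesis
  proof eventually_elim
    fix x assume "(\<Sum>j. ennreal \<bar>W (Suc j) x - W j x\<bar>) \<noteq> \<infinity>"
    then have "summable (\<lambda>j. \<bar>W (Suc j) x - W j x\<bar>)"
      by (intro summable_suminf_not_top) auto
    then have "summable (\<lambda>j. W (Suc j) x - W j x)" by (rule summable_rabs_cancel)
    then have "(\<lambda>n. \<Sum>j<n. W (Suc j) x - W j x) \<longlonglongrightarrow> (\<Sum>j. W (Suc j) x - W j x)"
      by (rule summable_LIMSEQ)
    then have "(\<lambda>n. W n x - W 0 x) \<longlonglongrightarrow> (\<Sum>j. W (Suc j) x - W j x)"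
      using sum_lessThan_telescope[of "\<lambda>j. W j x"] by simp
    then have "(\<lambda>n. (W n x - W 0 x) + W 0 x) \<longlonglongrightarrow> (\<Sum>j. W (Suc j) x - W j x) + W 0 x"
      by (intro tendsto_intros)
    then show "convergent (\<lambda>j. W j x)" by (auto simp: convergent_def)
  qed
qed

text \<open>An Egorov argument for two measures. The sets \<open>E j\<close> of late deviations
  shrink to a set that is \<mu>-null but may have positive m-measure; by \<open>step_null\<close>
  one step never sees it. What remains of \<open>E j\<close> shrinks to the empty set, so its
  m-measure tends to 0, and \<open>density\<close> turns this into a hitting probability that is
  small uniformly in x.\<close>

lemma T_uniform:
  assumes W: "\<And>j. bdd B (W j)" and lim: "AE x in \<mu>. (\<lambda>j. W j x) \<longlonglongrightarrow> c"
    and c: "\<bar>c\<bar> \<le> B" and "\<epsilon> > 0"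
  shows "\<exists>j. \<forall>x\<in>space m. \<bar>T (W j) x - c\<bar> \<le> \<epsilon>"
proof -
  have Wm[measurable]: "\<And>j. W j \<in> borel_measurable m" using W by (auto simp: bdd_def)
  have B0: "0 \<le> B" using c by linarith
  define E where "E j = {x\<in>space m. \<exists>i\<ge>j. \<bar>W i x - c\<bar> > \<epsilon>/2}" for j
  have [measurable]: "E j \<in> sets m" for j unfolding E_def by measurable
  let ?I = "\<Inter>j. E j"
  have Im[measurable]: "?I \<in> sets m" by (rule sets.countable_INT) auto
  have "AE x in \<mu>. x \<notin> ?I"
    using lim
  proof eventually_elim
    fix x assume "(\<lambda>j. W j x) \<longlonglongrightarrow> c"
    then have "\<exists>N. \<forall>j\<ge>N. norm (W j x - c) < \<epsilon>/2" using \<open>\<epsilon> > 0\<close> LIMSEQ_D[of _ c "\<epsilon>/2"] by auto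
    then obtain N where "\<forall>j\<ge>N. \<not> \<bar>W j x - c\<bar> > \<epsilon>/2" by force
    then have "x \<notin> E N" unfolding E_def by blast
    then show "x \<notin> ?I" by auto
  qed
  then have I_null: "?I \<in> null_sets \<mu>"
    by (subst AE_iff_null_sets) auto
  have "(\<lambda>j. measure m (E j - ?I)) \<longlonglongrightarrow> measure m (\<Inter>j. E j - ?I)"
    by (rule M.finite_Lim_measure_decseq) (auto simp: decseq_def E_def)
  moreover have "(\<Inter>j. E j - ?I) = {}" by auto
  ultimately have "(\<lambda>j. measure m (E j - ?I)) \<longlonglongrightarrow> 0" by simp
  then have "(\<lambda>j. 2 * B * (D * measure m (E j - ?I))) \<longlonglongrightarrow> 0"
    by (intro tendsto_mult_right_zero)
  then have "\<forall>\<^sub>F j in sequentially. 2 * B * (D * measure m (E j - ?I)) < \<epsilon>/2"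
    using \<open>\<epsilon> > 0\<close> order_tendstoD(2) half_gt_zero by blast
  then obtain j where j: "2 * B * (D * measure m (E j - ?I)) < \<epsilon>/2"
    by (auto simp: eventually_sequentially)
  show ?thesis
  proof (intro exI ballI)
    fix x assume x: "x \<in> space m"
    have [measurable]: "g x \<in> N \<rightarrow>\<^sub>M m" using x by measurable
    let ?P = "\<lambda>A. measure N {t\<in>space N. g x t \<in> A}"
    have "?P ?I = 0" using step_null[OF I_null x] by (simp add: measure_def)
    moreover have "?P (E j) \<le> ?P (E j - ?I) + ?P ?I"
    proof -
      have "{t\<in>space N. g x t \<in> E j} \<subseteq> {t\<in>space N. g x t \<in> E j - ?I} \<union> {t\<in>space N. g x t \<in> ?I}" by auto
      then have "?P (E j) \<le> measure N ({t\<in>space N. g x t \<in> E j - ?I} \<union> {t\<in>space N. g x t \<in> ?I})"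
        by (rule N.finite_measure_mono) measurable
      also have "\<dots> \<le> ?P (E j - ?I) + ?P ?I"
        by (rule measure_Un_le) measurable
      finally show ?thesis .
    qed
    moreover have "?P (E j - ?I) \<le> D * measure m (E j - ?I)"
    proof -
      have "ennreal (?P (E j - ?I)) \<le> ennreal D * ennreal (measure m (E j - ?I))"
        using density[OF x, of "E j - ?I"] by (simp add: N.emeasure_eq_measure M.emeasure_eq_measure)
      then show ?thesis using D_nonneg by (simp add: ennreal_mult[symmetric])
    qed
    ultimately have P: "?P (E j) \<le> D * measure m (E j - ?I)" by linarith
    have i: "integrable N (\<lambda>t. W j (g x t))" by (rule bdd_integrable(2)[OF W x])
    have ii: "integrable N (indicator {t\<in>space N. g x t \<in> E j} :: _ \<Rightarrow> real)"
      by (rule integrable_real_indicator) (auto simp: less_top[symmetric])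
    have "\<bar>T (W j) x - c\<bar> = \<bar>\<integral>t. W j (g x t) - c \<partial>N\<bar>"
      using i by (simp add: T_def N.prob_space)
    also have "\<dots> \<le> (\<integral>t. \<bar>W j (g x t) - c\<bar> \<partial>N)" by simp
    also have "\<dots> \<le> (\<integral>t. \<epsilon>/2 + 2 * B * indicator {t\<in>space N. g x t \<in> E j} t \<partial>N)"
    proof (rule integral_mono)
      fix t assume t: "t \<in> space N"
      then have y: "g x t \<in> space m" using x by simp
      have "\<bar>W j (g x t) - c\<bar> \<le> 2 * B" using W[of j] c y unfolding bdd_def by force
      then show "\<bar>W j (g x t) - c\<bar> \<le> \<epsilon>/2 + 2 * B * indicator {t\<in>space N. g x t \<in> E j} t"
        using \<open>\<epsilon> > 0\<close> t y by (auto simp: indicator_def E_def not_less)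
    next
      show "integrable N (\<lambda>t. \<epsilon>/2 + 2 * B * indicator {t\<in>space N. g x t \<in> E j} t)"
        using ii by simp
    qed (use i in auto)
    also have "\<dots> = \<epsilon>/2 + 2 * B * ?P (E j)"
      using ii by (subst Bochner_Integration.integral_add) (auto simp: N.prob_space intro!: arg_cong[where f="measure N"])
    also have "\<dots> \<le> \<epsilon>/2 + 2 * B * (D * measure m (E j - ?I))"
      using P B0 by (intro add_left_mono mult_left_mono) auto
    finally show "\<bar>T (W j) x - c\<bar> \<le> \<epsilon>" using j by linarith
  qed
qed

text \<open>The element of least \<open>L\<^sup>2\<close>-norm in the \<open>T\<close>-invariant convex set of functions cohomologous
  to \<open>h\<close> is invariant, hence constant by ergodicity; one application of the smoothing operator
  \<open>T\<close> turns \<open>\<mu>\<close>-almost sure convergence into uniform convergence.\<close>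

lemma approximate_poisson_equation:
  assumes h: "bdd H h" and "\<epsilon> > 0"
  shows "\<exists>b B. bdd B b \<and> (\<forall>x\<in>space m. \<bar>h x - b x + T b x - (\<integral>x. h x \<partial>\<mu>)\<bar> \<le> \<epsilon>)"
proof -
  \<comment> \<open>The functions cohomologous to h. The bound H is part of the definition:
    \<open>T\<close> and midpoints preserve it, and it dominates the limits taken below. The bound
    on \<open>b\<close> may vary from function to function.\<close>
  define V where "V w \<longleftrightarrow> bdd H w \<and> (\<exists>b B. bdd B b \<and> (\<forall>x\<in>space m. w x = h x - b x + T b x))" for w
  have H0: "0 \<le> H" using bdd_nonneg[OF h] .
  have V_bdd: "bdd H w" if "V w" for w using that by (simp add: V_def)
  have V_h: "V h"
    unfolding V_def using h by (intro conjI exI[of _ "\<lambda>_. 0"] exI[of _ 0]) (auto simp: bdd_def T_def)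
  have V_T: "V (T w)" if "V w" for w
  proof -
    from that obtain b B where b: "bdd B b" and w: "\<And>x. x\<in>space m \<Longrightarrow> w x = h x - b x + T b x" and wH: "bdd H w"
      by (auto simp: V_def)
    have "T w x = h x - (b x + w x) + T (\<lambda>x. b x + w x) x" if "x \<in> space m" for x
      using T_combine[OF b wH that, of 1 1] w[OF that] by simp
    then show ?thesis unfolding V_def using T_bdd[OF wH] bdd_add[OF b wH] by blast
  qed
  have V_mid: "V (\<lambda>x. (1/2) * v x + (1/2) * w x)" if "V v" "V w" for v w
  proof -
    from that obtain b B c C where b: "bdd B b" and v: "\<And>x. x\<in>space m \<Longrightarrow> v x = h x - b x + T b x"
      and c: "bdd C c" and w: "\<And>x. x\<in>space m \<Longrightarrow> w x = h x - c x + T c x"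
      by (auto simp: V_def)
    have "(1/2) * v x + (1/2) * w x = h x - ((1/2) * b x + (1/2) * c x) + T (\<lambda>x. (1/2) * b x + (1/2) * c x) x"
      if "x \<in> space m" for x
      unfolding T_combine[OF b c that] v[OF that] w[OF that] by (simp add: field_simps)
    moreover have "bdd H (\<lambda>x. (1/2) * v x + (1/2) * w x)"
      using bdd_combine[OF V_bdd[OF \<open>V v\<close>] V_bdd[OF \<open>V w\<close>], of "1/2" "1/2"] by simp
    ultimately show ?thesis unfolding V_def using bdd_combine[OF b c] by blast
  qed
  have V_int: "(\<integral>x. w x \<partial>\<mu>) = (\<integral>x. h x \<partial>\<mu>)" if "V w" for w
  proof -
    from that obtain b B where b: "bdd B b" and w: "\<And>x. x\<in>space m \<Longrightarrow> w x = h x - b x + T b x"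
      by (auto simp: V_def)
    have "(\<integral>x. w x \<partial>\<mu>) = (\<integral>x. h x - b x + T b x \<partial>\<mu>)"
      by (rule Bochner_Integration.integral_cong) (auto simp: w)
    also have "\<dots> = (\<integral>x. h x \<partial>\<mu>)"
      using bdd_integrable(1)[OF h] bdd_integrable(1)[OF b] bdd_integrable(1)[OF T_bdd[OF b]] integral_T[OF b]
      by simp
    finally show ?thesis .
  qed
  define q :: "('x \<Rightarrow> real) \<Rightarrow> real" where "q w = (\<integral>x. w x * w x \<partial>\<mu>)" for w
  have q0: "0 \<le> q w" for w unfolding q_def by simp
  define d where "d = Inf (q ` Collect V)"
  have d_le: "d \<le> q w" if "V w" for w
    unfolding d_def by (rule cInf_lower) (use that q0 in \<open>auto simp: bdd_below_def\<close>)
  have near: "\<exists>w. V w \<and> q w < d + e" if "e > 0" for e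
    using cInf_lessD[of "q ` Collect V" "d + e"] V_h that unfolding d_def by auto
  \<comment> \<open>The geometric rate makes the increments of this minimising sequence summable, so
    that it converges almost everywhere without passing to a subsequence.\<close>
  have "\<exists>W. \<forall>j. V (W j) \<and> q (W j) < d + (1/4)^j"
    by (intro choice allI near) simp
  then obtain W where VW: "\<And>j. V (W j)" and qW: "\<And>j. q (W j) < d + (1/4)^j" by blast
  note WH = V_bdd[OF VW]
  have Wm[measurable]: "\<And>j. W j \<in> borel_measurable m" using WH by (auto simp: bdd_def)
  \<comment> \<open>The midpoint of v and w belongs to \<open>V\<close>, so its squared norm is at
    least d. Expanding the square bounds the cross term from below, and then the distance from
    above.\<close>
  have par: "(\<integral>x. (v x - w x)\<^sup>2 \<partial>\<mu>) \<le> 2 * q v + 2 * q w - 4 * d"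
    and cross: "4 * d - q v - q w \<le> 2 * (\<integral>x. v x * w x \<partial>\<mu>)" if "V v" "V w" for v w
  proof -
    note bv = V_bdd[OF \<open>V v\<close>] and bw = V_bdd[OF \<open>V w\<close>]
    note i = bdd_integrable(1)[OF bdd_mult[OF bv bv]] bdd_integrable(1)[OF bdd_mult[OF bv bw]]
      bdd_integrable(1)[OF bdd_mult[OF bw bw]]
    have "q (\<lambda>x. (1/2) * v x + (1/2) * w x) = (\<integral>x. (1/4) * (v x * v x) + (1/2) * (v x * w x) + (1/4) * (w x * w x) \<partial>\<mu>)"
      unfolding q_def by (rule Bochner_Integration.integral_cong) (auto simp: algebra_simps)
    also have "\<dots> = (1/4) * q v + (1/2) * (\<integral>x. v x * w x \<partial>\<mu>) + (1/4) * q w"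
      using i by (simp add: q_def)
    finally show c: "4 * d - q v - q w \<le> 2 * (\<integral>x. v x * w x \<partial>\<mu>)"
      using d_le[OF V_mid[OF that]] by simp
    have "(\<integral>x. (v x - w x)\<^sup>2 \<partial>\<mu>) = (\<integral>x. (v x * v x) - 2 * (v x * w x) + (w x * w x) \<partial>\<mu>)"
      by (rule Bochner_Integration.integral_cong) (auto simp: algebra_simps power2_eq_square)
    also have "\<dots> = q v - 2 * (\<integral>x. v x * w x \<partial>\<mu>) + q w"
      using i by (simp add: q_def)
    finally show "(\<integral>x. (v x - w x)\<^sup>2 \<partial>\<mu>) \<le> 2 * q v + 2 * q w - 4 * d" using c by simp
  qed
  have L1: "(\<integral>x. \<bar>W (Suc j) x - W j x\<bar> \<partial>\<mu>) \<le> 3 * (1/2)^j" for j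
  proof -
    note bd = bdd_combine[OF WH[of "Suc j"] WH[of j], of 1 "-1", simplified]
    \<comment> \<open>From the square norm to the L^1 norm by
      \<open>2 * a <= 2^j * a^2 + 2^(-j)\<close>; by \<open>par\<close> the mean of
      \<open>a^2\<close> is of order \<open>4^(-j)\<close>, so both terms are of order
      \<open>2^(-j)\<close>.\<close>
    have "(\<integral>x. \<bar>W (Suc j) x - W j x\<bar> \<partial>\<mu>) \<le> (\<integral>x. (2^j * (W (Suc j) x - W j x)\<^sup>2 + (1/2)^j) / 2 \<partial>\<mu>)"
    proof (rule integral_mono)
      show "integrable \<mu> (\<lambda>x. \<bar>W (Suc j) x - W j x\<bar>)"
        using bdd_integrable(1)[OF bd] by simp
      show "integrable \<mu> (\<lambda>x. (2^j * (W (Suc j) x - W j x)\<^sup>2 + (1/2)^j) / 2)"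
        using bdd_integrable(1)[OF bdd_mult[OF bd bd]] by (simp add: power2_eq_square)
      fix x
      define a where "a = \<bar>W (Suc j) x - W j x\<bar>"
      have "0 \<le> 2^j * (a - (1/2)^j)\<^sup>2" by simp
      also have "\<dots> = 2^j * a\<^sup>2 - 2 * a * (2^j * (1/2)^j) + (2^j * (1/2)^j) * (1/2)^j"
        by (simp add: power2_eq_square algebra_simps)
      also have "(2::real)^j * (1/2)^j = 1" by (simp add: power_mult_distrib[symmetric])
      finally show "\<bar>W (Suc j) x - W j x\<bar> \<le> (2^j * (W (Suc j) x - W j x)\<^sup>2 + (1/2)^j) / 2"
        by (simp add: a_def)
    qed
    also have "\<dots> = (2^j * (\<integral>x. (W (Suc j) x - W j x)\<^sup>2 \<partial>\<mu>) + (1/2)^j) / 2"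
      using bdd_integrable(1)[OF bdd_mult[OF bd bd]] by (simp add: power2_eq_square)
    also have "(\<integral>x. (W (Suc j) x - W j x)\<^sup>2 \<partial>\<mu>) \<le> 4 * (1/4)^j"
      using par[OF VW VW, of "Suc j" j] qW[of j] qW[of "Suc j"] zero_le_power[of "1/4::real" j]
      unfolding power_Suc by linarith
    also have "(2^j * (4 * (1/4)^j) + (1/2)^j) / 2 \<le> (3 * (1/2)^j :: real)"
    proof -
      have "(2::real)^j * (1/4)^j = (1/2)^j" by (simp add: power_mult_distrib[symmetric])
      moreover have "0 \<le> (1/2::real)^j" by simp
      ultimately have "(2::real)^j * (4 * (1/4)^j) \<le> 5 * (1/2)^j" by (simp only: mult.left_commute[of _ 4] mult_right_mono)
      then show ?thesis by simp
    qed
    finally show ?thesis by simp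
  qed
  have conv: "AE x in \<mu>. convergent (\<lambda>j. W j x)"
    by (rule summable_L1_converges[where W = W and a = "\<lambda>j. 3 * (1/2)^j", OF WH L1]) (intro summable_mult summable_geometric, simp)
  define u where "u x = lim (\<lambda>j. W j x)" for x
  have um[measurable]: "u \<in> borel_measurable m" unfolding u_def by measurable
  have lim: "AE x in \<mu>. (\<lambda>j. W j x) \<longlonglongrightarrow> u x"
    using conv by eventually_elim (simp add: u_def convergent_LIMSEQ_iff)
  have Wle: "\<bar>W j x\<bar> \<le> H" if "x \<in> space m" for j x using WH[of j] that by (simp add: bdd_def)
  have iu: "integrable \<mu> u"
    by (rule integrable_dominated_convergence[of _ _ _ "\<lambda>_. H"]) (use lim Wle in \<open>auto intro!: AE_I2\<close>)
  have ulim: "(\<lambda>j. \<integral>x. W j x \<partial>\<mu>) \<longlonglongrightarrow> (\<integral>x. u x \<partial>\<mu>)"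
    by (rule integral_dominated_convergence[of _ _ _ "\<lambda>_. H"]) (use lim Wle in \<open>auto intro!: AE_I2\<close>)
  have c: "(\<integral>x. u x \<partial>\<mu>) = (\<integral>x. h x \<partial>\<mu>)"
    using ulim by (simp add: V_int[OF VW] LIMSEQ_const_iff)
  let ?G = "\<lambda>z. g (fst z) (snd z)"
  \<comment> \<open>An almost minimal w is almost unchanged along the random step. By stationarity
    the mean square increment is \<open>2 * q w\<close> minus twice the inner product of w with
    \<open>T w\<close>; as \<open>T w\<close> is also in \<open>V\<close> and has no larger norm,
    \<open>cross\<close> bounds this product from below.\<close>
  have inc: "(\<integral>z. (w (?G z) - w (fst z))\<^sup>2 \<partial>(\<mu> \<Otimes>\<^sub>M N)) \<le> 4 * (q w - d)" if V: "V w" for w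
  proof -
    note b = V_bdd[OF V]
    have wm[measurable]: "w \<in> borel_measurable m" using b by (simp add: bdd_def)
    have i1: "integrable (\<mu> \<Otimes>\<^sub>M N) (\<lambda>z. w (?G z) * w (?G z))"
      using bdd_integrable(3)[OF bdd_mult[OF b b]] by simp
    have i2: "integrable (\<mu> \<Otimes>\<^sub>M N) (\<lambda>z. w (fst z) * w (?G z))"
      by (rule muN.P.integrable_const_bound[of _ "H * H"])
        (use b H0 in \<open>auto simp: bdd_def abs_mult space_pair_measure intro!: AE_I2 mult_mono\<close>)
    have i3: "integrable (\<mu> \<Otimes>\<^sub>M N) (\<lambda>z. w (fst z) * w (fst z))"
      by (rule muN.P.integrable_const_bound[of _ "H * H"])
        (use bdd_mult[OF b b] in \<open>auto simp: bdd_def space_pair_measure\<close>)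
    have e1: "(\<integral>z. w (?G z) * w (?G z) \<partial>(\<mu> \<Otimes>\<^sub>M N)) = q w"
      unfolding q_def by (rule integral_g[of "\<lambda>x. w x * w x"]) measurable
    have e2: "(\<integral>z. w (fst z) * w (?G z) \<partial>(\<mu> \<Otimes>\<^sub>M N)) = (\<integral>x. w x * T w x \<partial>\<mu>)"
      using muN.integral_fst'[OF i2] by (simp add: T_def)
    have e3: "(\<integral>z. w (fst z) * w (fst z) \<partial>(\<mu> \<Otimes>\<^sub>M N)) = q w"
      using muN.integral_fst'[OF i3] by (simp add: q_def N.prob_space)
    have "q (T w) \<le> (\<integral>x. T (\<lambda>y. w y * w y) x \<partial>\<mu>)"
      unfolding q_def
      by (rule integral_mono[OF bdd_integrable(1)[OF bdd_mult[OF T_bdd T_bdd, OF b b]]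
          bdd_integrable(1)[OF T_bdd[OF bdd_mult[OF b b]]]])
        (use T_square_le[OF b] in \<open>simp add: power2_eq_square\<close>)
    also have "\<dots> = q w" unfolding q_def by (rule integral_T[OF bdd_mult[OF b b]])
    finally have qT: "q (T w) \<le> q w" .
    have "(\<integral>z. (w (?G z) - w (fst z))\<^sup>2 \<partial>(\<mu> \<Otimes>\<^sub>M N)) =
       (\<integral>z. w (?G z) * w (?G z) - 2 * (w (fst z) * w (?G z)) + w (fst z) * w (fst z) \<partial>(\<mu> \<Otimes>\<^sub>M N))"
      by (rule Bochner_Integration.integral_cong) (auto simp: power2_eq_square algebra_simps)
    also have "\<dots> = q w - 2 * (\<integral>x. w x * T w x \<partial>\<mu>) + q w"
      using i1 i2 i3 by (simp add: e1 e2 e3)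
    finally show ?thesis using cross[OF V V_T[OF V]] qT by simp
  qed
  have ae_G: "AE z in \<mu> \<Otimes>\<^sub>M N. (\<lambda>j. W j (?G z)) \<longlonglongrightarrow> u (?G z)"
    by (rule AE_distrD[of ?G _ \<mu>], measurable) (subst distr_g, rule lim)
  have ae_fst: "AE z in \<mu> \<Otimes>\<^sub>M N. (\<lambda>j. W j (fst z)) \<longlonglongrightarrow> u (fst z)"
    by (rule AE_distrD[of fst _ \<mu>], measurable) (subst N.distr_pair_fst, rule lim)
  have int0: "integrable (\<mu> \<Otimes>\<^sub>M N) (\<lambda>z. (u (?G z) - u (fst z))\<^sup>2) \<and>
     (\<lambda>j. \<integral>z. (W j (?G z) - W j (fst z))\<^sup>2 \<partial>(\<mu> \<Otimes>\<^sub>M N)) \<longlonglongrightarrow> (\<integral>z. (u (?G z) - u (fst z))\<^sup>2 \<partial>(\<mu> \<Otimes>\<^sub>M N))"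
  proof -
    have ae2: "AE z in \<mu> \<Otimes>\<^sub>M N. (\<lambda>j. (W j (?G z) - W j (fst z))\<^sup>2) \<longlonglongrightarrow> (u (?G z) - u (fst z))\<^sup>2"
      using ae_G ae_fst by eventually_elim (intro tendsto_intros)
    have "norm ((W j (?G z) - W j (fst z))\<^sup>2) \<le> (2 * H)\<^sup>2" if "z \<in> space (\<mu> \<Otimes>\<^sub>M N)" for j z
    proof -
      have "\<bar>W j (?G z)\<bar> \<le> H" "\<bar>W j (fst z)\<bar> \<le> H" using WH[of j] that by (auto simp: bdd_def space_pair_measure)
      then have "\<bar>W j (?G z) - W j (fst z)\<bar> \<le> 2 * H" by linarith
      then show ?thesis using power_mono[of "\<bar>W j (?G z) - W j (fst z)\<bar>" "2 * H" 2] by simp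
    qed
    note * = this
    show ?thesis
    proof
      show "integrable (\<mu> \<Otimes>\<^sub>M N) (\<lambda>z. (u (?G z) - u (fst z))\<^sup>2)"
        by (rule integrable_dominated_convergence[where w = "\<lambda>_. (2*H)\<^sup>2", OF _ _ _ ae2 AE_I2[OF *]]) measurable
      show "(\<lambda>j. \<integral>z. (W j (?G z) - W j (fst z))\<^sup>2 \<partial>(\<mu> \<Otimes>\<^sub>M N)) \<longlonglongrightarrow> (\<integral>z. (u (?G z) - u (fst z))\<^sup>2 \<partial>(\<mu> \<Otimes>\<^sub>M N))"
        by (rule integral_dominated_convergence[where w = "\<lambda>_. (2*H)\<^sup>2", OF _ _ _ ae2 AE_I2[OF *]]) measurable
    qed
  qed
  have "(\<integral>z. (u (?G z) - u (fst z))\<^sup>2 \<partial>(\<mu> \<Otimes>\<^sub>M N)) \<le> 0"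
  proof (rule LIMSEQ_le[OF int0[THEN conjunct2]])
    show "(\<lambda>j. 4 * (1/4)^j :: real) \<longlonglongrightarrow> 0"
      by (intro tendsto_mult_right_zero LIMSEQ_power_zero) simp
    show "\<exists>n. \<forall>j\<ge>n. (\<integral>z. (W j (?G z) - W j (fst z))\<^sup>2 \<partial>(\<mu> \<Otimes>\<^sub>M N)) \<le> 4 * (1/4)^j"
    proof (intro exI allI impI)
      fix j show "(\<integral>z. (W j (?G z) - W j (fst z))\<^sup>2 \<partial>(\<mu> \<Otimes>\<^sub>M N)) \<le> 4 * (1/4)^j"
        by (rule order_trans[OF inc[OF VW] mult_left_mono]) (use qW[of j] in \<open>auto simp: less_imp_le algebra_simps\<close>)
    qed
  qed
  then have "(\<integral>z. (u (?G z) - u (fst z))\<^sup>2 \<partial>(\<mu> \<Otimes>\<^sub>M N)) = 0"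
    by (intro antisym) auto
  then have "AE z in \<mu> \<Otimes>\<^sub>M N. u (?G z) = u (fst z)"
    using integral_nonneg_eq_0_iff_AE[OF int0[THEN conjunct1]] by simp
  then have "AE x in \<mu>. u x = (\<integral>x. h x \<partial>\<mu>)"
    using harmonic_const[OF um iu] c by simp
  with lim have lim_c: "AE x in \<mu>. (\<lambda>j. W j x) \<longlonglongrightarrow> (\<integral>x. h x \<partial>\<mu>)"
    by eventually_elim simp
  have "\<bar>\<integral>x. h x \<partial>\<mu>\<bar> \<le> (\<integral>x. \<bar>h x\<bar> \<partial>\<mu>)" by simp
  also have "\<dots> \<le> (\<integral>x. H \<partial>\<mu>)"
    by (rule integral_mono) (use bdd_integrable(1)[OF h] h in \<open>auto simp: bdd_def\<close>)
  finally have cH: "\<bar>\<integral>x. h x \<partial>\<mu>\<bar> \<le> H" by simp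
  obtain j where j: "\<forall>x\<in>space m. \<bar>T (W j) x - (\<integral>x. h x \<partial>\<mu>)\<bar> \<le> \<epsilon>"
    using T_uniform[OF WH lim_c cH \<open>\<epsilon> > 0\<close>] by blast
  \<comment> \<open>The smoothed function \<open>T (W j)\<close> still belongs to \<open>V\<close>,
    so it is itself of the form \<open>h - b + T b\<close>.\<close>
  from V_T[OF VW, of j] obtain b B where "bdd B b" "\<And>x. x\<in>space m \<Longrightarrow> T (W j) x = h x - b x + T b x"
    by (auto simp: V_def)
  with j show ?thesis by metis
qed

section \<open>The chain driven by an infinite noise sequence\<close>

abbreviation NS where "NS \<equiv> Pi\<^sub>M (UNIV :: nat set) (\<lambda>_. N)"

sublocale seq: sequence_space N ..
sublocale mNS: pair_sigma_finite m NS ..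
sublocale NN: pair_prob_space N N ..
sublocale mNN: pair_sigma_finite m "N \<Otimes>\<^sub>M N" ..
sublocale NNS: pair_prob_space N NS ..

lemma component_measurable[measurable (raw)]: "h \<in> L \<rightarrow>\<^sub>M NS \<Longrightarrow> (\<lambda>z. h z i) \<in> L \<rightarrow>\<^sub>M N"
  by (rule measurable_compose[OF _ measurable_component_singleton]) auto

lemma riter_measurable[measurable (raw)]:
  assumes [measurable]: "f \<in> L \<rightarrow>\<^sub>M m" "h \<in> L \<rightarrow>\<^sub>M NS"
  shows "(\<lambda>z. riter g n (h z) (f z)) \<in> L \<rightarrow>\<^sub>M m"
proof (induction n)
  case (Suc n)
  note [measurable] = Suc
  show ?case unfolding riter_Suc by measurable
qed simp

lemma NS_in: "\<omega> \<in> space NS \<Longrightarrow> \<omega> i \<in> space N"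
  by (auto simp: space_PiM)

lemma riter_in: "x \<in> space m \<Longrightarrow> \<omega> \<in> space NS \<Longrightarrow> riter g n \<omega> x \<in> space m"
  by (induction n) (auto simp: rmap_def shift_funpow NS_in)

lemma nn_integral_NS:
  assumes [measurable]: "f \<in> borel_measurable NS"
  shows "(\<integral>\<^sup>+\<omega>. f \<omega> \<partial>NS) = (\<integral>\<^sup>+s. \<integral>\<^sup>+\<omega>. f (case_nat s \<omega>) \<partial>NS \<partial>N)"
proof -
  have "(\<integral>\<^sup>+\<omega>. f \<omega> \<partial>NS) = (\<integral>\<^sup>+z. f (case_nat (fst z) (snd z)) \<partial>(N \<Otimes>\<^sub>M NS))"
    by (subst seq.PiM_iter[symmetric], subst nn_integral_distr) (auto simp: case_prod_beta)
  also have "\<dots> = (\<integral>\<^sup>+s. \<integral>\<^sup>+\<omega>. f (case_nat s \<omega>) \<partial>NS \<partial>N)"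
    by (subst seq.nn_integral_fst[symmetric]) auto
  finally show ?thesis .
qed

text \<open>F reads two consecutive noise values, so neighbouring terms share one of them, but the
  terms at even times use disjoint pairs. Integrating the first pair out leaves the same problem
  from a new starting point, and the bound a does not depend on it, so the factors multiply.\<close>

lemma exp_moment_even:
  fixes F :: "'x \<Rightarrow> 'e \<times> 'e \<Rightarrow> real"
  assumes Fm[measurable]: "(\<lambda>(x, z). F x z) \<in> borel_measurable (m \<Otimes>\<^sub>M (N \<Otimes>\<^sub>M N))"
    and a: "\<And>x. x \<in> space m \<Longrightarrow> (\<integral>\<^sup>+z. ennreal (exp (F x z)) \<partial>(N \<Otimes>\<^sub>M N)) \<le> a"
    and x: "x \<in> space m"
  shows "(\<integral>\<^sup>+\<omega>. ennreal (exp (\<Sum>j<n. F (riter g (2*j) \<omega> x) (\<omega> (2*j), \<omega> (2*j+1)))) \<partial>NS) \<le> a ^ n"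
  using x
proof (induction n arbitrary: x)
  case 0 show ?case using seq.emeasure_space_1 by simp
next
  case (Suc n)
  note [measurable] = \<open>x \<in> space m\<close>
  let ?S = "\<lambda>n \<omega> x. (\<Sum>j<n. F (riter g (2*j) \<omega> x) (\<omega> (2*j), \<omega> (2*j+1)))"
  note [measurable (raw)] = measurable_case_prod_compose[OF Fm]
  have shift2: "?S (Suc n) (case_nat s (case_nat t \<omega>)) x = F x (s, t) + ?S n \<omega> (g (g x s) t)" for s t \<omega>
    by (simp only: sum.lessThan_Suc_shift) (simp add: riter_case_nat del: riter.simps(2))
  have "(\<integral>\<^sup>+\<omega>. ennreal (exp (?S (Suc n) \<omega> x)) \<partial>NS)
      = (\<integral>\<^sup>+s. \<integral>\<^sup>+\<omega>. ennreal (exp (?S (Suc n) (case_nat s \<omega>) x)) \<partial>NS \<partial>N)"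
    by (rule nn_integral_NS) measurable
  also have "\<dots> = (\<integral>\<^sup>+s. \<integral>\<^sup>+t. \<integral>\<^sup>+\<omega>. ennreal (exp (?S (Suc n) (case_nat s (case_nat t \<omega>)) x)) \<partial>NS \<partial>N \<partial>N)"
    by (intro nn_integral_cong nn_integral_NS) measurable
  also have "\<dots> = (\<integral>\<^sup>+s. \<integral>\<^sup>+t. ennreal (exp (F x (s, t))) * (\<integral>\<^sup>+\<omega>. ennreal (exp (?S n \<omega> (g (g x s) t))) \<partial>NS) \<partial>N \<partial>N)"
    unfolding shift2 exp_add
    by (intro nn_integral_cong, subst nn_integral_cmult[symmetric]) (use Suc.prems in \<open>auto simp: ennreal_mult\<close>)
  also have "\<dots> \<le> (\<integral>\<^sup>+s. \<integral>\<^sup>+t. ennreal (exp (F x (s, t))) * a ^ n \<partial>N \<partial>N)"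
    by (intro nn_integral_mono mult_left_mono Suc.IH) (use Suc.prems in auto)
  also have "\<dots> = (\<integral>\<^sup>+z. ennreal (exp (F x z)) * a ^ n \<partial>(N \<Otimes>\<^sub>M N))"
    by (subst N.nn_integral_fst[symmetric]) auto
  also have "\<dots> = (\<integral>\<^sup>+z. ennreal (exp (F x z)) \<partial>(N \<Otimes>\<^sub>M N)) * a ^ n"
    by (rule nn_integral_multc) measurable
  also have "\<dots> \<le> a * a ^ n" by (intro mult_right_mono a Suc.prems) auto
  finally show ?case by simp
qed

text \<open>Averaging over the first noise value turns odd times into even ones; the bound there is
  uniform in the starting point.\<close>

lemma exp_moment_odd:
  fixes F :: "'x \<Rightarrow> 'e \<times> 'e \<Rightarrow> real"
  assumes Fm[measurable]: "(\<lambda>(x, z). F x z) \<in> borel_measurable (m \<Otimes>\<^sub>M (N \<Otimes>\<^sub>M N))"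
    and a: "\<And>x. x \<in> space m \<Longrightarrow> (\<integral>\<^sup>+z. ennreal (exp (F x z)) \<partial>(N \<Otimes>\<^sub>M N)) \<le> a"
    and x: "x \<in> space m"
  shows "(\<integral>\<^sup>+\<omega>. ennreal (exp (\<Sum>j<n. F (riter g (2*j+1) \<omega> x) (\<omega> (2*j+1), \<omega> (2*j+2)))) \<partial>NS) \<le> a ^ n"
proof -
  note [measurable] = x
  note [measurable (raw)] = measurable_case_prod_compose[OF Fm]
  have "(\<integral>\<^sup>+\<omega>. ennreal (exp (\<Sum>j<n. F (riter g (2*j+1) \<omega> x) (\<omega> (2*j+1), \<omega> (2*j+2)))) \<partial>NS)
    = (\<integral>\<^sup>+s. \<integral>\<^sup>+\<omega>. ennreal (exp (\<Sum>j<n. F (riter g (2*j) \<omega> (g x s)) (\<omega> (2*j), \<omega> (2*j+1)))) \<partial>NS \<partial>N)"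
    by (subst nn_integral_NS) (simp_all add: riter_case_nat del: riter.simps(2))
  also have "\<dots> \<le> (\<integral>\<^sup>+s. a ^ n \<partial>N)"
    by (intro nn_integral_mono exp_moment_even a) (use x in auto)
  finally show ?thesis by (simp add: N.emeasure_space_1)
qed

text \<open>If the sum exceeds \<open>2 * \<eta> * n\<close>, its even or its odd part exceeds
  \<open>\<eta> * n\<close>. For each part the vanishing mean of F removes the linear term of the
  exponential, and Chernoff's bound has a rate independent of the starting point.\<close>

lemma deviation_two_step:
  fixes F :: "'x \<Rightarrow> 'e \<times> 'e \<Rightarrow> real"
  assumes Fm[measurable]: "(\<lambda>(x, z). F x z) \<in> borel_measurable (m \<Otimes>\<^sub>M (N \<Otimes>\<^sub>M N))"
    and mean: "\<And>x. x \<in> space m \<Longrightarrow> integrable (N \<Otimes>\<^sub>M N) (F x) \<and> (\<integral>z. F x z \<partial>(N \<Otimes>\<^sub>M N)) = 0"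
    and \<kappa>: "0 < \<kappa>" and C: "0 < C"
    and expm: "\<And>x. x \<in> space m \<Longrightarrow> (\<integral>\<^sup>+z. ennreal (exp (\<kappa> * \<bar>F x z\<bar>)) \<partial>(N \<Otimes>\<^sub>M N)) \<le> ennreal C"
    and \<eta>: "0 < \<eta>"
  shows "\<exists>\<gamma>>0. \<forall>x\<in>space m. \<forall>n. emeasure NS {\<omega>\<in>space NS. (\<Sum>i<n. F (riter g i \<omega> x) (\<omega> i, \<omega> (i+1))) > 2 * \<eta> * n}
     \<le> ennreal (2 * exp (- \<gamma> * n))"
proof -
  define c where "c = 8 * C / \<kappa>\<^sup>2"
  have c: "0 < c" using C \<kappa> by (simp add: c_def)
  \<comment> \<open>With this choice the quadratic cost \<open>c * \<theta>^2\<close> of one step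
    takes at most half of the gain \<open>\<theta> * \<eta>\<close>.\<close>
  define \<theta> where "\<theta> = min (\<kappa> / 2) (\<eta> / (2 * c))"
  have \<theta>: "0 < \<theta>" "\<theta> \<le> \<kappa> / 2" "c * \<theta> \<le> \<eta> / 2"
  proof -
    show "0 < \<theta>" "\<theta> \<le> \<kappa> / 2" using \<kappa> c \<eta> by (auto simp: \<theta>_def)
    have "\<theta> \<le> \<eta> / (2 * c)" by (simp add: \<theta>_def)
    then show "c * \<theta> \<le> \<eta> / 2" using c by (simp add: field_simps)
  qed
  define a where "a = exp (c * \<theta>\<^sup>2)"
  define G where "G x z = \<theta> * F x z" for x z
  note [measurable (raw)] = measurable_case_prod_compose[OF Fm]
  have Gm[measurable]: "(\<lambda>(x, z). G x z) \<in> borel_measurable (m \<Otimes>\<^sub>M (N \<Otimes>\<^sub>M N))"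
    unfolding G_def by measurable
  have Ga: "(\<integral>\<^sup>+z. ennreal (exp (G x z)) \<partial>(N \<Otimes>\<^sub>M N)) \<le> ennreal a" if x: "x \<in> space m" for x
  proof -
    note [measurable] = x
    let ?E = "\<lambda>z. exp (\<kappa> * \<bar>F x z\<bar>)"
    have iE: "integrable (N \<Otimes>\<^sub>M N) ?E"
      by (rule integrableI_nonneg) (use expm[OF x] in \<open>auto simp: less_top[symmetric] top_unique\<close>)
    have "ennreal (\<integral>z. ?E z \<partial>(N \<Otimes>\<^sub>M N)) \<le> ennreal C"
      using expm[OF x] by (subst nn_integral_eq_integral[symmetric, OF iE]) auto
    then have EC: "(\<integral>z. ?E z \<partial>(N \<Otimes>\<^sub>M N)) \<le> C" using C by (simp add: ennreal_le_iff2)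
    have iF: "integrable (N \<Otimes>\<^sub>M N) (F x)" "(\<integral>z. F x z \<partial>(N \<Otimes>\<^sub>M N)) = 0" using mean[OF x] by auto
    have "(\<integral>\<^sup>+z. ennreal (exp (G x z)) \<partial>(N \<Otimes>\<^sub>M N)) \<le> (\<integral>\<^sup>+z. ennreal (1 + \<theta> * F x z + 8 * \<theta>\<^sup>2 / \<kappa>\<^sup>2 * ?E z) \<partial>(N \<Otimes>\<^sub>M N))"
      unfolding G_def by (intro nn_integral_mono ennreal_leI exp_scaled_le \<theta>)
    also have "\<dots> = ennreal (\<integral>z. 1 + \<theta> * F x z + 8 * \<theta>\<^sup>2 / \<kappa>\<^sup>2 * ?E z \<partial>(N \<Otimes>\<^sub>M N))"
    proof (rule nn_integral_eq_integral)
      show "AE z in N \<Otimes>\<^sub>M N. 0 \<le> 1 + \<theta> * F x z + 8 * \<theta>\<^sup>2 / \<kappa>\<^sup>2 * ?E z"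
        by (intro AE_I2 order_trans[OF _ exp_scaled_le] \<theta>) simp
    qed (use iF iE in auto)
    also have "(\<integral>z. 1 + \<theta> * F x z + 8 * \<theta>\<^sup>2 / \<kappa>\<^sup>2 * ?E z \<partial>(N \<Otimes>\<^sub>M N)) = 1 + 8 * \<theta>\<^sup>2 / \<kappa>\<^sup>2 * (\<integral>z. ?E z \<partial>(N \<Otimes>\<^sub>M N))"
      using iF iE NN.P.prob_space by simp
    also have "\<dots> \<le> 1 + 8 * \<theta>\<^sup>2 / \<kappa>\<^sup>2 * C"
      by (intro add_left_mono mult_left_mono EC) auto
    also have "\<dots> \<le> a"
      using exp_ge_add_one_self[of "c * \<theta>\<^sup>2"] by (simp add: a_def c_def field_simps)
    finally show ?thesis by (simp add: ennreal_leI)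
  qed
  \<comment> \<open>Here p is the number of terms of one parity. The crude bound
    \<open>p <= n\<close> is enough.\<close>
  have tail: "emeasure NS {\<omega>\<in>space NS. f \<omega> > \<eta> * n} \<le> ennreal (exp (- (\<theta> * \<eta> / 2) * n))"
    if [measurable]: "f \<in> borel_measurable NS" and le: "(\<integral>\<^sup>+\<omega>. ennreal (exp (\<theta> * f \<omega>)) \<partial>NS) \<le> ennreal a ^ p" and p: "p \<le> n"
    for f and p n :: nat
  proof -
    have "{\<omega>\<in>space NS. f \<omega> > \<eta> * n} = {\<omega>\<in>space NS. \<theta> * f \<omega> > \<theta> * \<eta> * n}"
      using \<theta>(1) by (simp add: mult.assoc)
    also have "emeasure NS \<dots> \<le> ennreal (exp (- (\<theta> * \<eta> * n))) * ennreal a ^ p"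
      by (rule order_trans[OF exponential_Markov mult_left_mono[OF le]]) auto
    also have "\<dots> = ennreal (exp (- (\<theta> * \<eta> * n) + p * (c * \<theta>\<^sup>2)))"
    proof -
      have "ennreal a ^ p = ennreal (exp (p * (c * \<theta>\<^sup>2)))"
        by (simp add: a_def ennreal_power exp_of_nat_mult)
      then show ?thesis by (simp only: ennreal_mult[symmetric] exp_add exp_ge_zero)
    qed
    also have "\<dots> \<le> ennreal (exp (- (\<theta> * \<eta> / 2) * n))"
    proof (intro ennreal_leI iffD2[OF exp_le_cancel_iff])
      have "p * (c * \<theta>\<^sup>2) \<le> n * (c * \<theta>\<^sup>2)" using p c by (intro mult_right_mono) auto
      also have "\<dots> = n * \<theta> * (c * \<theta>)" by (simp add: power2_eq_square)
      also have "\<dots> \<le> n * \<theta> * (\<eta> / 2)" using \<theta> by (intro mult_left_mono) auto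
      finally show "- (\<theta> * \<eta> * n) + p * (c * \<theta>\<^sup>2) \<le> - (\<theta> * \<eta> / 2) * n" by (simp add: algebra_simps)
    qed
    finally show ?thesis .
  qed
  show ?thesis
  proof (intro exI[of _ "\<theta> * \<eta> / 2"] conjI ballI allI)
    show "0 < \<theta> * \<eta> / 2" using \<theta> \<eta> by simp
    fix x and n :: nat assume x: "x \<in> space m"
    note [measurable] = x
    let ?e = "\<lambda>\<omega>. \<Sum>j<(n + 1) div 2. F (riter g (2*j) \<omega> x) (\<omega> (2*j), \<omega> (2*j+1))"
    let ?o = "\<lambda>\<omega>. \<Sum>j<n div 2. F (riter g (2*j+1) \<omega> x) (\<omega> (2*j+1), \<omega> (2*j+2))"
    have "{\<omega>\<in>space NS. (\<Sum>i<n. F (riter g i \<omega> x) (\<omega> i, \<omega> (i+1))) > 2 * \<eta> * n}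
      \<subseteq> {\<omega>\<in>space NS. ?e \<omega> > \<eta> * n} \<union> {\<omega>\<in>space NS. ?o \<omega> > \<eta> * n}"
      by (subst sum_even_odd) auto
    then have "emeasure NS {\<omega>\<in>space NS. (\<Sum>i<n. F (riter g i \<omega> x) (\<omega> i, \<omega> (i+1))) > 2 * \<eta> * n}
      \<le> emeasure NS ({\<omega>\<in>space NS. ?e \<omega> > \<eta> * n} \<union> {\<omega>\<in>space NS. ?o \<omega> > \<eta> * n})"
      by (rule emeasure_mono) measurable
    also have "\<dots> \<le> emeasure NS {\<omega>\<in>space NS. ?e \<omega> > \<eta> * n} + emeasure NS {\<omega>\<in>space NS. ?o \<omega> > \<eta> * n}"
      by (rule emeasure_subadditive) measurable
    also have "\<dots> \<le> ennreal (exp (- (\<theta> * \<eta> / 2) * n)) + ennreal (exp (- (\<theta> * \<eta> / 2) * n))"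
    proof (intro add_mono tail)
      show "(\<integral>\<^sup>+\<omega>. ennreal (exp (\<theta> * ?e \<omega>)) \<partial>NS) \<le> ennreal a ^ ((n + 1) div 2)"
        using exp_moment_even[OF Gm Ga x] by (simp add: G_def sum_distrib_left)
      show "(\<integral>\<^sup>+\<omega>. ennreal (exp (\<theta> * ?o \<omega>)) \<partial>NS) \<le> ennreal a ^ (n div 2)"
        using exp_moment_odd[OF Gm Ga x] by (simp add: G_def sum_distrib_left)
    qed (auto simp del: riter.simps(2))
    also have "\<dots> = ennreal (2 * exp (- (\<theta> * \<eta> / 2) * n))"
      by (simp add: ennreal_plus[symmetric] del: ennreal_plus)
    finally show "emeasure NS {\<omega>\<in>space NS. (\<Sum>i<n. F (riter g i \<omega> x) (\<omega> i, \<omega> (i+1))) > 2 * \<eta> * n}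
      \<le> ennreal (2 * exp (- (\<theta> * \<eta> / 2) * n))" .
  qed
qed

text \<open>The observable at time \<open>i + 1\<close> is split into a term with vanishing conditional expectation given
  the state at time \<open>i\<close> (it depends on the two noise variables \<open>\<omega> i\<close>, \<open>\<omega> (i + 1)\<close>, whence the splitting
  into even and odd times), a coboundary, and an error controlled by the approximate Poisson equation.
  Averaging over one step first makes the conditional expectation bounded.\<close>

theorem large_deviation:
  fixes \<phi> :: "'x \<Rightarrow> 'e \<Rightarrow> real"
  assumes \<phi>[measurable]: "(\<lambda>z. \<phi> (fst z) (snd z)) \<in> borel_measurable (m \<Otimes>\<^sub>M N)"
    and \<kappa>: "0 < \<kappa>"
    and I: "(\<integral>\<^sup>+z. ennreal (exp (\<kappa> * \<bar>\<phi> (fst z) (snd z)\<bar>)) \<partial>(m \<Otimes>\<^sub>M N)) < \<infinity>"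
    and \<epsilon>: "0 < \<epsilon>"
  shows "\<exists>C \<gamma>. 0 < \<gamma> \<and> (\<forall>n. emeasure (m \<Otimes>\<^sub>M NS) {z\<in>space (m \<Otimes>\<^sub>M NS).
      (\<Sum>i\<le>n. \<phi> (riter g i (snd z) (fst z)) (snd z i)) > ((\<integral>z. \<phi> (fst z) (snd z) \<partial>(\<mu> \<Otimes>\<^sub>M N)) + \<epsilon>) * n}
     \<le> ennreal (C * exp (- \<gamma> * n)))"
proof -
  let ?\<phi> = "\<lambda>z. \<phi> (fst z) (snd z)"
  note [measurable (raw)] = measurable_pair_compose[OF \<phi>]
  obtain I0 where I0: "0 \<le> I0" "(\<integral>\<^sup>+z. ennreal (exp (\<kappa> * \<bar>?\<phi> z\<bar>)) \<partial>(m \<Otimes>\<^sub>M N)) = ennreal I0"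
    using I by (cases "(\<integral>\<^sup>+z. ennreal (exp (\<kappa> * \<bar>?\<phi> z\<bar>)) \<partial>(m \<Otimes>\<^sub>M N))") auto
  \<comment> \<open>After one step the law is dominated by D times \<open>m\<close>, so the
    exponential moment is bounded uniformly in the starting point. At time 0 only the moment
    integrated over \<open>m\<close> is available, which is why the first term of the sum is
    estimated separately.\<close>
  have step: "(\<integral>\<^sup>+z. ennreal (exp (\<kappa> * \<bar>\<phi> (g x (fst z)) (snd z)\<bar>)) \<partial>(N \<Otimes>\<^sub>M N)) \<le> ennreal (D * I0)"
    if x[measurable]: "x \<in> space m" for x
  proof -
    have "(\<integral>\<^sup>+z. ennreal (exp (\<kappa> * \<bar>\<phi> (g x (fst z)) (snd z)\<bar>)) \<partial>(N \<Otimes>\<^sub>M N))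
      = (\<integral>\<^sup>+s. \<integral>\<^sup>+t. ennreal (exp (\<kappa> * \<bar>\<phi> (g x s) t\<bar>)) \<partial>N \<partial>N)"
      by (subst N.nn_integral_fst[symmetric]) auto
    also have "\<dots> \<le> ennreal D * (\<integral>\<^sup>+y. \<integral>\<^sup>+t. ennreal (exp (\<kappa> * \<bar>\<phi> y t\<bar>)) \<partial>N \<partial>m)"
      by (rule step_nn_integral_le[OF x, of "\<lambda>y. \<integral>\<^sup>+t. ennreal (exp (\<kappa> * \<bar>\<phi> y t\<bar>)) \<partial>N"]) measurable
    also have "(\<integral>\<^sup>+y. \<integral>\<^sup>+t. ennreal (exp (\<kappa> * \<bar>\<phi> y t\<bar>)) \<partial>N \<partial>m) = (\<integral>\<^sup>+z. ennreal (exp (\<kappa> * \<bar>?\<phi> z\<bar>)) \<partial>(m \<Otimes>\<^sub>M N))"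
      by (subst N.nn_integral_fst[symmetric]) auto
    finally show ?thesis using D_nonneg I0 by (simp add: ennreal_mult)
  qed
  have dom: "\<bar>y\<bar> \<le> (1 / \<kappa>) * exp (\<kappa> * \<bar>y\<bar>)" for y using abs_le_exp_div[OF \<kappa>, of y] by simp
  have iE: "integrable (N \<Otimes>\<^sub>M N) (\<lambda>z. exp (\<kappa> * \<bar>\<phi> (g x (fst z)) (snd z)\<bar>))" if x[measurable]: "x \<in> space m" for x
    by (rule integrableI_nonneg) (use step[OF x] in \<open>auto simp: less_top[symmetric] top_unique\<close>)
  have i\<phi>: "integrable (N \<Otimes>\<^sub>M N) (\<lambda>z. \<phi> (g x (fst z)) (snd z))" if x[measurable]: "x \<in> space m" for x
    by (rule Bochner_Integration.integrable_bound[OF integrable_mult_right[OF iE[OF x], of "1 / \<kappa>"]])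
      (use dom \<kappa> in \<open>auto simp: abs_mult\<close>)
  have i\<mu>: "integrable (\<mu> \<Otimes>\<^sub>M N) ?\<phi>"
  proof -
    have "(\<integral>\<^sup>+z. ennreal (exp (\<kappa> * \<bar>?\<phi> z\<bar>)) \<partial>(\<mu> \<Otimes>\<^sub>M N)) = (\<integral>\<^sup>+y. \<integral>\<^sup>+t. ennreal (exp (\<kappa> * \<bar>\<phi> y t\<bar>)) \<partial>N \<partial>\<mu>)"
      by (subst N.nn_integral_fst[symmetric]) auto
    also have "\<dots> \<le> ennreal D * (\<integral>\<^sup>+y. \<integral>\<^sup>+t. ennreal (exp (\<kappa> * \<bar>\<phi> y t\<bar>)) \<partial>N \<partial>m)"
      by (rule mu_nn_integral_le) measurable
    also have "(\<integral>\<^sup>+y. \<integral>\<^sup>+t. ennreal (exp (\<kappa> * \<bar>\<phi> y t\<bar>)) \<partial>N \<partial>m) = ennreal I0"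
      by (subst I0(2)[symmetric], subst N.nn_integral_fst[symmetric]) auto
    finally have "integrable (\<mu> \<Otimes>\<^sub>M N) (\<lambda>z. exp (\<kappa> * \<bar>?\<phi> z\<bar>))"
      by (intro integrableI_nonneg) (auto simp: less_top[symmetric] top_unique ennreal_mult_eq_top_iff)
    from Bochner_Integration.integrable_bound[OF integrable_mult_right[OF this, of "1 / \<kappa>"], of ?\<phi>]
    show ?thesis using dom \<kappa> by (auto simp: abs_mult)
  qed
  define c where "c = (\<integral>z. ?\<phi> z \<partial>(\<mu> \<Otimes>\<^sub>M N))"
  define \<Phi> where "\<Phi> y = (\<integral>t. \<phi> y t \<partial>N)" for y
  have \<Phi>m[measurable]: "\<Phi> \<in> borel_measurable m" unfolding \<Phi>_def by measurable
  have i\<Phi>: "integrable \<mu> \<Phi>" and c\<Phi>: "(\<integral>y. \<Phi> y \<partial>\<mu>) = c"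
    using muN.integrable_fst'[OF i\<mu>] muN.integral_fst'[OF i\<mu>] by (auto simp: \<Phi>_def[abs_def] c_def)
  define h where "h x = (\<integral>z. \<phi> (g x (fst z)) (snd z) \<partial>(N \<Otimes>\<^sub>M N))" for x
  have hm[measurable]: "h \<in> borel_measurable m" unfolding h_def by measurable
  have h_T: "h x = T \<Phi> x" if x: "x \<in> space m" for x
    using NN.integral_fst'[OF i\<phi>[OF x]] by (simp add: h_def T_def \<Phi>_def)
  define H where "H = D * I0 / \<kappa>"
  have hH: "bdd H h"
    unfolding bdd_def
  proof (intro conjI ballI hm)
    fix x assume x: "x \<in> space m"
    have "\<bar>h x\<bar> \<le> (\<integral>z. \<bar>\<phi> (g x (fst z)) (snd z)\<bar> \<partial>(N \<Otimes>\<^sub>M N))" by (simp add: h_def)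
    also have "\<dots> \<le> (\<integral>z. (1 / \<kappa>) * exp (\<kappa> * \<bar>\<phi> (g x (fst z)) (snd z)\<bar>) \<partial>(N \<Otimes>\<^sub>M N))"
      by (intro integral_mono integrable_mult_right iE x integrable_abs i\<phi> dom)
    also have "\<dots> = (1 / \<kappa>) * (\<integral>z. exp (\<kappa> * \<bar>\<phi> (g x (fst z)) (snd z)\<bar>) \<partial>(N \<Otimes>\<^sub>M N))"
      using iE[OF x] by simp
    also have "\<dots> \<le> (1 / \<kappa>) * (D * I0)"
    proof (rule mult_left_mono)
      have "ennreal (\<integral>z. exp (\<kappa> * \<bar>\<phi> (g x (fst z)) (snd z)\<bar>) \<partial>(N \<Otimes>\<^sub>M N)) \<le> ennreal (D * I0)"
        using step[OF x] by (subst nn_integral_eq_integral[symmetric, OF iE[OF x]]) auto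
      then show "(\<integral>z. exp (\<kappa> * \<bar>\<phi> (g x (fst z)) (snd z)\<bar>) \<partial>(N \<Otimes>\<^sub>M N)) \<le> D * I0"
        using D_nonneg I0(1) by (subst (asm) ennreal_le_iff) auto
    qed (use \<kappa> in simp)
    finally show "\<bar>h x\<bar> \<le> H" by (simp add: H_def)
  qed
  have ih: "(\<integral>x. h x \<partial>\<mu>) = c"
  proof -
    have "integrable (distr (\<mu> \<Otimes>\<^sub>M N) \<mu> (\<lambda>z. g (fst z) (snd z))) \<Phi>" unfolding distr_g by (rule i\<Phi>)
    then have "integrable (\<mu> \<Otimes>\<^sub>M N) (\<lambda>z. \<Phi> (g (fst z) (snd z)))" by (subst (asm) integrable_distr_eq) auto
    then have "(\<integral>x. T \<Phi> x \<partial>\<mu>) = (\<integral>z. \<Phi> (g (fst z) (snd z)) \<partial>(\<mu> \<Otimes>\<^sub>M N))"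
      unfolding T_def using muN.integral_fst' by fastforce
    then have "(\<integral>x. T \<Phi> x \<partial>\<mu>) = c" by (simp add: integral_g c\<Phi>)
    moreover have "(\<integral>x. h x \<partial>\<mu>) = (\<integral>x. T \<Phi> x \<partial>\<mu>)"
      by (rule Bochner_Integration.integral_cong) (auto simp: h_T)
    ultimately show ?thesis by simp
  qed
  obtain b B where b: "bdd B b" and pois: "\<And>x. x \<in> space m \<Longrightarrow> \<bar>h x - b x + T b x - c\<bar> \<le> \<epsilon> / 4"
    using approximate_poisson_equation[OF hH, of "\<epsilon> / 4"] \<epsilon> unfolding ih by auto
  have bm[measurable]: "b \<in> borel_measurable m" and bB: "\<And>x. x \<in> space m \<Longrightarrow> \<bar>b x\<bar> \<le> B"
    using b by (auto simp: bdd_def)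
  have TbB: "\<And>x. x \<in> space m \<Longrightarrow> \<bar>T b x\<bar> \<le> B" using T_bdd[OF b] by (auto simp: bdd_def)
  have hB: "\<And>x. x \<in> space m \<Longrightarrow> \<bar>h x\<bar> \<le> H" using hH by (auto simp: bdd_def)
  \<comment> \<open>Given x, the first two terms have the means \<open>h x\<close> and
    \<open>T b x\<close>, so the difference is centred.\<close>
  define F where "F x z = \<phi> (g x (fst z)) (snd z) + b (g x (fst z)) - h x - T b x" for x z
  have Tbm[measurable]: "T b \<in> borel_measurable m" by measurable
  have Fm: "(\<lambda>(x, z). F x z) \<in> borel_measurable (m \<Otimes>\<^sub>M (N \<Otimes>\<^sub>M N))"
    unfolding F_def by measurable
  have mean: "integrable (N \<Otimes>\<^sub>M N) (F x) \<and> (\<integral>z. F x z \<partial>(N \<Otimes>\<^sub>M N)) = 0" if x[measurable]: "x \<in> space m" for x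
  proof -
    have ib: "integrable (N \<Otimes>\<^sub>M N) (\<lambda>z. b (g x (fst z)))"
      by (rule NN.P.integrable_const_bound[of _ B]) (use bB x in \<open>auto simp: space_pair_measure\<close>)
    have "(\<integral>z. b (g x (fst z)) \<partial>(N \<Otimes>\<^sub>M N)) = T b x"
      using NN.integral_fst'[OF ib] by (simp add: T_def N.prob_space)
    then show ?thesis unfolding F_def[abs_def] using ib i\<phi>[OF x] NN.P.prob_space by (simp add: h_def)
  qed
  define C where "C = exp (\<kappa> * (2 * B + H)) * (D * I0) + 1"
  have C: "0 < C" using D_nonneg I0 by (auto simp: C_def intro!: add_nonneg_pos)
  have expm: "(\<integral>\<^sup>+z. ennreal (exp (\<kappa> * \<bar>F x z\<bar>)) \<partial>(N \<Otimes>\<^sub>M N)) \<le> ennreal C" if x[measurable]: "x \<in> space m" for x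
  proof -
    have "(\<integral>\<^sup>+z. ennreal (exp (\<kappa> * \<bar>F x z\<bar>)) \<partial>(N \<Otimes>\<^sub>M N))
      \<le> (\<integral>\<^sup>+z. ennreal (exp (\<kappa> * (2 * B + H))) * ennreal (exp (\<kappa> * \<bar>\<phi> (g x (fst z)) (snd z)\<bar>)) \<partial>(N \<Otimes>\<^sub>M N))"
    proof (rule nn_integral_mono)
      fix z assume "z \<in> space (N \<Otimes>\<^sub>M N)"
      then have "g x (fst z) \<in> space m" using x by (auto simp: space_pair_measure)
      then have "\<bar>F x z\<bar> \<le> (2 * B + H) + \<bar>\<phi> (g x (fst z)) (snd z)\<bar>"
        using bB[of "g x (fst z)"] TbB[OF x] hB[OF x] unfolding F_def by linarith
      then have "\<kappa> * \<bar>F x z\<bar> \<le> \<kappa> * ((2 * B + H) + \<bar>\<phi> (g x (fst z)) (snd z)\<bar>)" using \<kappa> by (intro mult_left_mono) auto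
      then show "ennreal (exp (\<kappa> * \<bar>F x z\<bar>)) \<le> ennreal (exp (\<kappa> * (2 * B + H))) * ennreal (exp (\<kappa> * \<bar>\<phi> (g x (fst z)) (snd z)\<bar>))"
        by (simp only: ennreal_mult[symmetric] exp_add[symmetric] exp_ge_zero distrib_left[symmetric]) (simp add: ennreal_leI)
    qed
    also have "\<dots> = ennreal (exp (\<kappa> * (2 * B + H))) * (\<integral>\<^sup>+z. ennreal (exp (\<kappa> * \<bar>\<phi> (g x (fst z)) (snd z)\<bar>)) \<partial>(N \<Otimes>\<^sub>M N))"
      by (rule nn_integral_cmult) measurable
    also have "\<dots> \<le> ennreal (exp (\<kappa> * (2 * B + H))) * ennreal (D * I0)"
      by (intro mult_left_mono step x) auto
    also have "\<dots> \<le> ennreal C"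
      using D_nonneg I0 by (simp add: ennreal_mult[symmetric] C_def ennreal_leI)
    finally show ?thesis .
  qed
  obtain \<gamma> where \<gamma>: "0 < \<gamma>" and dev: "\<And>x n. x\<in>space m \<Longrightarrow>
      emeasure NS {\<omega>\<in>space NS. (\<Sum>i<n. F (riter g i \<omega> x) (\<omega> i, \<omega> (i+1))) > 2 * (\<epsilon> / 8) * n} \<le> ennreal (2 * exp (- \<gamma> * n))"
    using deviation_two_step[OF Fm mean \<kappa> C expm, of "\<epsilon> / 8"] \<epsilon> by (auto simp: algebra_simps)
  note [measurable (raw)] = measurable_case_prod_compose[OF Fm]
  let ?X = "\<lambda>i z. riter g i (snd z) (fst z)"
  define SF where "SF n z = (\<Sum>i<n. F (?X i z) (snd z i, snd z (i+1)))" for n z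
  have SFm[measurable]: "SF n \<in> borel_measurable (m \<Otimes>\<^sub>M NS)" for n unfolding SF_def by measurable
  have \<phi>0m[measurable]: "(\<lambda>z. \<phi> (fst z) (snd z 0)) \<in> borel_measurable (m \<Otimes>\<^sub>M NS)" by measurable
  \<comment> \<open>The state at time i + 1 is \<open>g\<close> applied to the state and the noise
    at time i, so F contains the observable at time i + 1. The rest is \<open>h - b + T b\<close>,
    at most \<open>c + \<epsilon> / 4\<close> by \<open>pois\<close>, plus a coboundary that
    telescopes to at most \<open>2 * B\<close>.\<close>
  have decomp: "(\<Sum>i\<le>n. \<phi> (?X i z) (snd z i)) \<le> \<phi> (fst z) (snd z 0) + SF n z + n * (c + \<epsilon> / 4) + 2 * B"
    if z: "z \<in> space (m \<Otimes>\<^sub>M NS)" for n z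
  proof -
    have x: "fst z \<in> space m" "snd z \<in> space NS" using z by (auto simp: space_pair_measure)
    have X: "?X i z \<in> space m" for i using x by (intro riter_in)
    have "(\<Sum>i\<le>n. \<phi> (?X i z) (snd z i)) = \<phi> (fst z) (snd z 0) + (\<Sum>i<n. \<phi> (?X (Suc i) z) (snd z (Suc i)))"
      by (simp add: lessThan_Suc_atMost[symmetric] sum.lessThan_Suc_shift del: riter.simps(2) sum.lessThan_Suc)
    also have "(\<Sum>i<n. \<phi> (?X (Suc i) z) (snd z (Suc i)))
      \<le> (\<Sum>i<n. F (?X i z) (snd z i, snd z (i+1)) + (c + \<epsilon> / 4) + (b (?X i z) - b (?X (Suc i) z)))"
    proof (rule sum_mono)
      fix i
      show "\<phi> (?X (Suc i) z) (snd z (Suc i)) \<le> F (?X i z) (snd z i, snd z (i+1)) + (c + \<epsilon> / 4) + (b (?X i z) - b (?X (Suc i) z))"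
        using abs_le_D1[OF pois[OF X[of i]]] unfolding F_def riter_Suc by simp
    qed
    also have "\<dots> = SF n z + n * (c + \<epsilon> / 4) + (\<Sum>i<n. b (?X i z) - b (?X (Suc i) z))"
      by (simp add: sum.distrib SF_def)
    also have "(\<Sum>i<n. b (?X i z) - b (?X (Suc i) z)) = b (?X 0 z) - b (?X n z)"
      by (rule sum_lessThan_telescope')
    also have "\<dots> \<le> 2 * B" using bB[OF X[of 0]] bB[OF X[of n]] by linarith
    finally show ?thesis by linarith
  qed
  show ?thesis
  proof (intro exI conjI allI)
    let ?C = "exp (2 * B * \<kappa>) * I0 + 2 * measure m (space m)"
    let ?g = "min \<gamma> (\<kappa> * \<epsilon> / 2)"
    show "0 < ?g" using \<gamma> \<kappa> \<epsilon> by simp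
    fix n :: nat
    \<comment> \<open>The excess \<open>\<epsilon> * n\<close> is shared out: a quarter for the
      error in the Poisson equation, a quarter for the centred sum, and half for the initial term,
      which also has to outweigh the constant \<open>2 * B\<close>.\<close>
    let ?A = "{z\<in>space (m \<Otimes>\<^sub>M NS). \<kappa> * \<phi> (fst z) (snd z 0) > \<kappa> * (\<epsilon> / 2 * n - 2 * B)}"
    let ?B = "{z\<in>space (m \<Otimes>\<^sub>M NS). SF n z > 2 * (\<epsilon> / 8) * n}"
    have "{z\<in>space (m \<Otimes>\<^sub>M NS). (\<Sum>i\<le>n. \<phi> (?X i z) (snd z i)) > (c + \<epsilon>) * n} \<subseteq> ?A \<union> ?B"
    proof
      fix z assume *: "z \<in> {z\<in>space (m \<Otimes>\<^sub>M NS). (\<Sum>i\<le>n. \<phi> (?X i z) (snd z i)) > (c + \<epsilon>) * n}"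
      then have "(c + \<epsilon>) * n < \<phi> (fst z) (snd z 0) + SF n z + n * (c + \<epsilon> / 4) + 2 * B"
        using decomp[of z n] by auto
      then have "\<epsilon> / 2 * n - 2 * B < \<phi> (fst z) (snd z 0) \<or> SF n z > 2 * (\<epsilon> / 8) * n"
        by (simp add: algebra_simps) linarith
      then show "z \<in> ?A \<union> ?B" using * \<kappa> by auto
    qed
    then have "emeasure (m \<Otimes>\<^sub>M NS) {z\<in>space (m \<Otimes>\<^sub>M NS). (\<Sum>i\<le>n. \<phi> (?X i z) (snd z i)) > (c + \<epsilon>) * n}
      \<le> emeasure (m \<Otimes>\<^sub>M NS) (?A \<union> ?B)"
      by (rule emeasure_mono) measurable
    also have "\<dots> \<le> emeasure (m \<Otimes>\<^sub>M NS) ?A + emeasure (m \<Otimes>\<^sub>M NS) ?B"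
      by (rule emeasure_subadditive) measurable
    also have "emeasure (m \<Otimes>\<^sub>M NS) ?A \<le> ennreal (exp (2 * B * \<kappa>) * I0 * exp (- ?g * n))"
    proof -
      have "emeasure (m \<Otimes>\<^sub>M NS) ?A \<le> ennreal (exp (- (\<kappa> * (\<epsilon> / 2 * n - 2 * B)))) * (\<integral>\<^sup>+z. ennreal (exp (\<kappa> * \<phi> (fst z) (snd z 0))) \<partial>(m \<Otimes>\<^sub>M NS))"
        by (rule exponential_Markov) measurable
      also have "(\<integral>\<^sup>+z. ennreal (exp (\<kappa> * \<phi> (fst z) (snd z 0))) \<partial>(m \<Otimes>\<^sub>M NS))
        = (\<integral>\<^sup>+x. \<integral>\<^sup>+\<omega>. ennreal (exp (\<kappa> * \<phi> x (\<omega> 0))) \<partial>NS \<partial>m)"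
        by (subst seq.nn_integral_fst[symmetric]) auto
      also have "\<dots> = (\<integral>\<^sup>+x. \<integral>\<^sup>+t. ennreal (exp (\<kappa> * \<phi> x t)) \<partial>N \<partial>m)"
        by (intro nn_integral_cong, subst nn_integral_NS) (auto simp: seq.emeasure_space_1)
      also have "\<dots> \<le> (\<integral>\<^sup>+x. \<integral>\<^sup>+t. ennreal (exp (\<kappa> * \<bar>\<phi> x t\<bar>)) \<partial>N \<partial>m)"
        using \<kappa> by (intro nn_integral_mono ennreal_leI) auto
      also have "\<dots> = ennreal I0"
        by (subst I0(2)[symmetric], subst N.nn_integral_fst[symmetric]) auto
      also have "ennreal (exp (- (\<kappa> * (\<epsilon> / 2 * n - 2 * B)))) * ennreal I0 \<le> ennreal (exp (2 * B * \<kappa>) * I0 * exp (- ?g * n))"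
      proof -
        have "?g * n \<le> \<kappa> * \<epsilon> / 2 * n" by (intro mult_right_mono) auto
        then have "exp (- (\<kappa> * (\<epsilon> / 2 * n - 2 * B))) \<le> exp (2 * B * \<kappa> + - ?g * n)"
          by (simp add: algebra_simps)
        then have "exp (- (\<kappa> * (\<epsilon> / 2 * n - 2 * B))) * I0 \<le> exp (2 * B * \<kappa> + - ?g * n) * I0"
          using I0 by (intro mult_right_mono)
        then show ?thesis using I0 by (simp only: ennreal_mult[symmetric] exp_ge_zero exp_add) (simp add: ennreal_leI mult_ac)
      qed
      finally show ?thesis by (simp add: mult_left_mono)
    qed
    also have "emeasure (m \<Otimes>\<^sub>M NS) ?B \<le> ennreal (2 * measure m (space m) * exp (- ?g * n))"
    proof -
      have "emeasure (m \<Otimes>\<^sub>M NS) ?B = (\<integral>\<^sup>+x. emeasure NS (Pair x -` ?B) \<partial>m)"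
        by (rule seq.emeasure_pair_measure_alt) measurable
      also have "\<dots> \<le> (\<integral>\<^sup>+x. ennreal (2 * exp (- ?g * n)) \<partial>m)"
      proof (rule nn_integral_mono)
        fix x assume x: "x \<in> space m"
        have "Pair x -` ?B = {\<omega>\<in>space NS. (\<Sum>i<n. F (riter g i \<omega> x) (\<omega> i, \<omega> (i+1))) > 2 * (\<epsilon> / 8) * n}"
          using x by (auto simp: SF_def space_pair_measure)
        also have "emeasure NS \<dots> \<le> ennreal (2 * exp (- \<gamma> * n))" by (rule dev[OF x])
        also have "\<dots> \<le> ennreal (2 * exp (- ?g * n))"
          by (intro ennreal_leI mult_left_mono) (auto intro!: mult_right_mono)
        finally show "emeasure NS (Pair x -` ?B) \<le> ennreal (2 * exp (- ?g * n))" .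
      qed
      also have "\<dots> = ennreal (2 * measure m (space m) * exp (- ?g * n))"
        by (simp add: M.emeasure_eq_measure ennreal_mult[symmetric] mult_ac)
      finally show ?thesis .
    qed
    also have "ennreal (exp (2 * B * \<kappa>) * I0 * exp (- ?g * n)) + ennreal (2 * measure m (space m) * exp (- ?g * n)) = ennreal (?C * exp (- ?g * n))"
      using I0 by (subst ennreal_plus[symmetric]) (auto simp: distrib_right)
    finally show "emeasure (m \<Otimes>\<^sub>M NS) {z\<in>space (m \<Otimes>\<^sub>M NS). (\<Sum>i\<le>n. \<phi> (?X i z) (snd z i)) > ((\<integral>z. ?\<phi> z \<partial>(\<mu> \<Otimes>\<^sub>M N)) + \<epsilon>) * n}
       \<le> ennreal (?C * exp (- ?g * n))" by (simp only: c_def add_mono)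
  qed
qed

section \<open>First-coordinate marginals and null sets along orbits\<close>

lemma nn_integral_first:
  fixes f :: "'x \<Rightarrow> 'e \<Rightarrow> ennreal"
  assumes [measurable]: "(\<lambda>z. f (fst z) (snd z)) \<in> borel_measurable (m \<Otimes>\<^sub>M N)"
  shows "(\<integral>\<^sup>+z. f (fst z) (snd z 0) \<partial>(m \<Otimes>\<^sub>M NS)) = (\<integral>\<^sup>+z. f (fst z) (snd z) \<partial>(m \<Otimes>\<^sub>M N))"
proof -
  note [measurable (raw)] = measurable_pair_compose[OF assms]
  have "(\<integral>\<^sup>+z. f (fst z) (snd z 0) \<partial>(m \<Otimes>\<^sub>M NS)) = (\<integral>\<^sup>+x. \<integral>\<^sup>+\<omega>. f x (\<omega> 0) \<partial>NS \<partial>m)"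
    by (subst seq.nn_integral_fst[symmetric]) auto
  also have "\<dots> = (\<integral>\<^sup>+x. \<integral>\<^sup>+t. f x t \<partial>N \<partial>m)"
    by (intro nn_integral_cong, subst nn_integral_NS) (auto simp: seq.emeasure_space_1)
  also have "\<dots> = (\<integral>\<^sup>+z. f (fst z) (snd z) \<partial>(m \<Otimes>\<^sub>M N))"
    by (subst N.nn_integral_fst[symmetric]) auto
  finally show ?thesis .
qed

text \<open>Allows (H4), a condition on noise sequences that involves only
  \<open>\<omega> 0\<close>, to be read on pairs of a point and one noise value.\<close>

lemma emeasure_first:
  assumes [measurable]: "{z \<in> space (m \<Otimes>\<^sub>M N). Q (fst z) (snd z)} \<in> sets (m \<Otimes>\<^sub>M N)"
  shows "{z \<in> space (m \<Otimes>\<^sub>M NS). Q (fst z) (snd z 0)} \<in> sets (m \<Otimes>\<^sub>M NS)"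
    "emeasure (m \<Otimes>\<^sub>M NS) {z \<in> space (m \<Otimes>\<^sub>M NS). Q (fst z) (snd z 0)} = emeasure (m \<Otimes>\<^sub>M N) {z \<in> space (m \<Otimes>\<^sub>M N). Q (fst z) (snd z)}"
proof -
  let ?E = "{z \<in> space (m \<Otimes>\<^sub>M N). Q (fst z) (snd z)}" and ?F = "{z \<in> space (m \<Otimes>\<^sub>M NS). Q (fst z) (snd z 0)}"
  have F: "?F = (\<lambda>z. (fst z, snd z 0)) -` ?E \<inter> space (m \<Otimes>\<^sub>M NS)"
    by (auto simp: space_pair_measure NS_in)
  have "(\<lambda>z. (fst z, snd z 0)) \<in> m \<Otimes>\<^sub>M NS \<rightarrow>\<^sub>M m \<Otimes>\<^sub>M N" by measurable
  then show Fm: "?F \<in> sets (m \<Otimes>\<^sub>M NS)" unfolding F by (rule measurable_sets) (rule assms)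
  have "emeasure (m \<Otimes>\<^sub>M NS) ?F = (\<integral>\<^sup>+z. indicator ?F z \<partial>(m \<Otimes>\<^sub>M NS))" using Fm by simp
  also have "\<dots> = (\<integral>\<^sup>+z. indicator ?E (fst z, snd z 0) \<partial>(m \<Otimes>\<^sub>M NS))"
    by (intro nn_integral_cong) (auto simp: indicator_def space_pair_measure NS_in)
  also have "\<dots> = (\<integral>\<^sup>+z. indicator ?E (fst z, snd z) \<partial>(m \<Otimes>\<^sub>M N))"
    by (rule nn_integral_first[of "\<lambda>x t. indicator ?E (x, t)"]) (simp add: assms)
  also have "\<dots> = emeasure (m \<Otimes>\<^sub>M N) ?E" using assms by simp
  finally show "emeasure (m \<Otimes>\<^sub>M NS) ?F = emeasure (m \<Otimes>\<^sub>M N) ?E" .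
qed

text \<open>By induction on the time: after one step from any x the law is dominated by D times
  \<open>m\<close>, so an event that is null for the process started from \<open>m\<close> is null,
  one step later, from every x.\<close>

lemma orbit_null:
  assumes E: "E \<in> null_sets (m \<Otimes>\<^sub>M N)"
  shows "{z \<in> space (m \<Otimes>\<^sub>M NS). (riter g i (snd z) (fst z), snd z i) \<in> E} \<in> null_sets (m \<Otimes>\<^sub>M NS)"
proof -
  have Em[measurable]: "E \<in> sets (m \<Otimes>\<^sub>M N)" and E0: "emeasure (m \<Otimes>\<^sub>M N) E = 0" using E by auto
  let ?A = "\<lambda>i. {z \<in> space (m \<Otimes>\<^sub>M NS). (riter g i (snd z) (fst z), snd z i) \<in> E}"
  have Am[measurable]: "?A i \<in> sets (m \<Otimes>\<^sub>M NS)" for i by measurable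
  let ?f = "\<lambda>i x \<omega>. indicator E (riter g i \<omega> x, \<omega> i) :: ennreal"
  have A_eq: "emeasure (m \<Otimes>\<^sub>M NS) (?A i) = (\<integral>\<^sup>+x. \<integral>\<^sup>+\<omega>. ?f i x \<omega> \<partial>NS \<partial>m)" for i
  proof -
    have "emeasure (m \<Otimes>\<^sub>M NS) (?A i) = (\<integral>\<^sup>+z. indicator (?A i) z \<partial>(m \<Otimes>\<^sub>M NS))" by simp
    also have "\<dots> = (\<integral>\<^sup>+z. ?f i (fst z) (snd z) \<partial>(m \<Otimes>\<^sub>M NS))"
      by (intro nn_integral_cong) (auto simp: indicator_def)
    also have "\<dots> = (\<integral>\<^sup>+x. \<integral>\<^sup>+\<omega>. ?f i x \<omega> \<partial>NS \<partial>m)"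
      by (subst seq.nn_integral_fst[symmetric]) auto
    finally show ?thesis .
  qed
  have "emeasure (m \<Otimes>\<^sub>M NS) (?A i) = 0" for i
  proof (induction i)
    case 0
    have "emeasure (m \<Otimes>\<^sub>M NS) (?A 0) = (\<integral>\<^sup>+z. indicator E (fst z, snd z 0) \<partial>(m \<Otimes>\<^sub>M NS))"
    proof -
      have "emeasure (m \<Otimes>\<^sub>M NS) (?A 0) = (\<integral>\<^sup>+z. indicator (?A 0) z \<partial>(m \<Otimes>\<^sub>M NS))" by simp
      also have "\<dots> = (\<integral>\<^sup>+z. indicator E (fst z, snd z 0) \<partial>(m \<Otimes>\<^sub>M NS))"
        by (intro nn_integral_cong) (auto simp: indicator_def)
      finally show ?thesis .
    qed
    also have "\<dots> = (\<integral>\<^sup>+z. indicator E (fst z, snd z) \<partial>(m \<Otimes>\<^sub>M N))"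
      by (rule nn_integral_first[of "\<lambda>x t. indicator E (x, t)"]) simp
    also have "\<dots> = 0" using E0 by simp
    finally show ?case .
  next
    case (Suc i)
    have "(\<integral>\<^sup>+\<omega>. ?f (Suc i) x \<omega> \<partial>NS) \<le> ennreal D * emeasure (m \<Otimes>\<^sub>M NS) (?A i)" if x[measurable]: "x \<in> space m" for x
    proof -
      have "(\<integral>\<^sup>+\<omega>. ?f (Suc i) x \<omega> \<partial>NS) = (\<integral>\<^sup>+s. \<integral>\<^sup>+\<omega>. ?f (Suc i) x (case_nat s \<omega>) \<partial>NS \<partial>N)"
        by (rule nn_integral_NS) (simp del: riter.simps)
      also have "\<dots> = (\<integral>\<^sup>+s. \<integral>\<^sup>+\<omega>. ?f i (g x s) \<omega> \<partial>NS \<partial>N)"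
        by (simp add: riter_case_nat del: riter.simps)
      also have "\<dots> \<le> ennreal D * (\<integral>\<^sup>+y. \<integral>\<^sup>+\<omega>. ?f i y \<omega> \<partial>NS \<partial>m)"
        by (rule step_nn_integral_le[OF x, of "\<lambda>y. \<integral>\<^sup>+\<omega>. ?f i y \<omega> \<partial>NS"]) measurable
      finally show ?thesis by (simp only: A_eq)
    qed
    then have "(\<integral>\<^sup>+\<omega>. ?f (Suc i) x \<omega> \<partial>NS) = 0" if "x \<in> space m" for x using Suc that by simp
    then have "(\<integral>\<^sup>+x. \<integral>\<^sup>+\<omega>. ?f (Suc i) x \<omega> \<partial>NS \<partial>m) = (\<integral>\<^sup>+x. 0 \<partial>m)" by (intro nn_integral_cong) auto
    then show ?case unfolding A_eq by simp
  qed
  then show ?thesis by (intro null_setsI Am)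
qed

end

section \<open>Compact metric spaces and strong Feller kernels\<close>

text \<open>The type of points is only a metric space; compactness supplies what second countability
  is needed for. The centres of finite covers by balls of radius 1/(n+1) form a countable dense set,
  and the balls themselves a basis.\<close>

lemma compact_countable_basis:
  assumes "compact (UNIV :: 'm::metric_space set)"
  shows "\<exists>D :: 'm set. countable D \<and> (\<forall>x. \<forall>e>0. \<exists>d\<in>D. dist x d < e)"
    and "\<exists>B :: 'm set set. countable B \<and> topological_basis B"
proof -
  have "\<forall>n. \<exists>k. finite k \<and> k \<subseteq> (UNIV :: 'm set) \<and> UNIV \<subseteq> (\<Union>x\<in>k. ball x (1 / Suc n))"
    using seq_compact_imp_totally_bounded[of "UNIV :: 'm set"] assms by (auto simp: compact_eq_seq_compact_metric)
  then obtain k where k: "\<And>n. finite (k n)" "\<And>n. (UNIV :: 'm set) \<subseteq> (\<Union>x\<in>k n. ball x (1 / Suc n))"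
    by metis
  define D where "D = (\<Union>n. k n)"
  have D: "countable D" using k by (auto simp: D_def countable_finite)
  have dense: "\<exists>d\<in>D. dist x d < e" if e: "e > 0" for x e
  proof -
    obtain n where n: "1 / real (Suc n) < e" using nat_approx_posE[OF e] by auto
    have "x \<in> (\<Union>y\<in>k n. ball y (1 / Suc n))" using k(2)[of n] by blast
    then obtain d where "d \<in> k n" "dist d x < 1 / Suc n" by auto
    then show ?thesis using n by (auto simp: D_def dist_commute intro!: bexI[of _ d])
  qed
  then show "\<exists>D :: 'm set. countable D \<and> (\<forall>x. \<forall>e>0. \<exists>d\<in>D. dist x d < e)" using D by blast
  let ?B = "(\<lambda>(d, n). ball d (1 / Suc n)) ` (D \<times> (UNIV :: nat set))"
  have "topological_basis ?B"
  proof (rule topological_basisI)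
    fix O' :: "'m set" and x assume "open O'" "x \<in> O'"
    then obtain e where e: "e > 0" "ball x e \<subseteq> O'" by (auto simp: open_contains_ball)
    obtain n where n: "1 / real (Suc n) < e / 2" using nat_approx_posE[of "e / 2"] e by auto
    obtain d where d: "d \<in> D" "dist x d < 1 / Suc n" using dense[of "1 / Suc n" x] by auto
    have "ball d (1 / Suc n) \<subseteq> ball x e"
    proof
      fix y assume "y \<in> ball d (1 / Suc n)"
      then have "dist d y < e / 2" using n by simp
      moreover have "dist x d < e / 2" using d n by linarith
      ultimately show "y \<in> ball x e" using dist_triangle[of x y d] by simp
    qed
    then show "\<exists>B'\<in>?B. x \<in> B' \<and> B' \<subseteq> O'"
      using d e by (intro bexI[of _ "ball d (1 / Suc n)"]) (auto simp: dist_commute)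
  qed auto
  moreover have "countable ?B" using D by (intro countable_image countable_SIGMA) auto
  ultimately show "\<exists>B :: 'm set set. countable B \<and> topological_basis B" by blast
qed

text \<open>An open set of the product topology is a countable union of basic rectangles, hence lies
  in the product sigma-algebra. This makes jointly continuous maps jointly measurable.\<close>

lemma open_prod_sets:
  fixes W :: "('m::metric_space \<times> 'b::second_countable_topology) set"
  assumes "compact (UNIV :: 'm set)" and "open W"
  shows "W \<in> sets (borel \<Otimes>\<^sub>M borel)"
proof -
  obtain A :: "'m set set" where A: "countable A" "topological_basis A"
    using compact_countable_basis(2)[OF assms(1)] by blast
  obtain B :: "'b set set" where B: "countable B" "topological_basis B"
    using ex_countable_basis by blast
  let ?I = "{(a, b) \<in> A \<times> B. a \<times> b \<subseteq> W}"
  have W: "W = (\<Union>(a, b)\<in>?I. a \<times> b)"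
  proof (intro subset_antisym subsetI)
    fix z assume "z \<in> W"
    then obtain U V where UV: "open U" "open V" "z \<in> U \<times> V" "U \<times> V \<subseteq> W"
      using \<open>open W\<close> by (auto elim: open_prod_elim)
    from UV(3) have fs: "fst z \<in> U" "snd z \<in> V" by auto
    obtain a where "a \<in> A" "fst z \<in> a" "a \<subseteq> U"
      by (rule topological_basisE[OF A(2) UV(1) fs(1)])
    moreover obtain b where "b \<in> B" "snd z \<in> b" "b \<subseteq> V"
      by (rule topological_basisE[OF B(2) UV(2) fs(2)])
    ultimately show "z \<in> (\<Union>(a, b)\<in>?I. a \<times> b)" using UV(4)
      by (intro UN_I[of "(a, b)"]) (auto simp: mem_Times_iff)
  qed auto
  have cI: "countable ?I"
    by (rule countable_subset[of _ "A \<times> B"]) (use A B in auto)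
  have ab: "a \<times> b \<in> sets (borel \<Otimes>\<^sub>M borel)" if "a \<in> A" "b \<in> B" for a b
    using topological_basis_open[OF A(2) that(1)] topological_basis_open[OF B(2) that(2)]
    by (intro pair_measureI) auto
  show ?thesis by (subst W, rule sets.countable_UN'[OF cI]) (auto intro: ab)
qed

lemma continuous_on_uniform_approx:
  fixes F :: "'a::metric_space \<Rightarrow> real"
  assumes "\<And>e. e > 0 \<Longrightarrow> \<exists>f. continuous_on S f \<and> (\<forall>x\<in>S. \<bar>F x - f x\<bar> \<le> e)"
  shows "continuous_on S F"
proof -
  have "\<exists>f. \<forall>n. continuous_on S (f n) \<and> (\<forall>x\<in>S. \<bar>F x - f n x\<bar> \<le> 1 / Suc n)"
    by (intro choice allI assms) simp
  then obtain f where f: "\<And>n. continuous_on S (f n)" "\<And>n x. x \<in> S \<Longrightarrow> \<bar>F x - f n x\<bar> \<le> 1 / Suc n" by blast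
  have "uniform_limit S f F sequentially"
  proof (rule uniform_limitI)
    fix e :: real assume "e > 0"
    then obtain n where n: "1 / real (Suc n) < e" using nat_approx_posE by auto
    have "dist (f k x) (F x) < e" if "k \<ge> n" "x \<in> S" for k x
    proof -
      have "1 / real (Suc k) \<le> 1 / Suc n" using that by (simp add: field_simps)
      then show ?thesis using f(2)[OF that(2), of k] n by (simp add: dist_real_def abs_minus_commute)
    qed
    then show "\<forall>\<^sub>F k in sequentially. \<forall>x\<in>S. dist (f k x) (F x) < e"
      by (auto simp: eventually_sequentially)
  qed
  then show ?thesis by (intro uniform_limit_theorem[where f = f]) (auto simp: f(1))
qed

text \<open>An approximation error that is small in \<open>m\<close> is small for all
  \<open>P x\<close> simultaneously, so continuity in x survives the limits. Open sets are reached
  from continuous cutoffs, and a Dynkin induction extends the claim to all Borel sets.\<close>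

lemma uniformly_dominated_strong_Feller:
  fixes P :: "'a::metric_space \<Rightarrow> 'b::metric_space measure" and m :: "'b measure"
  assumes "finite_measure m" and m[measurable_cong, simp]: "sets m = sets borel"
    and P: "\<And>x. prob_space (P x)" and Ps[measurable_cong, simp]: "\<And>x. sets (P x) = sets borel"
    and dens: "\<And>x A. A \<in> sets borel \<Longrightarrow> measure (P x) A \<le> D * measure m A"
    and feller: "\<And>f :: 'b \<Rightarrow> real. continuous_on UNIV f \<Longrightarrow> (\<And>y. 0 \<le> f y \<and> f y \<le> 1) \<Longrightarrow> continuous_on UNIV (\<lambda>x. \<integral>y. f y \<partial>P x)"
    and "A \<in> sets borel"
  shows "continuous_on UNIV (\<lambda>x. measure (P x) A)"
proof -
  interpret m: finite_measure m by fact
  interpret P: prob_space "P x" for x by (rule P)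
  have [simp]: "space m = UNIV" "space (P x) = UNIV" for x
    using sets_eq_imp_space_eq[OF m] sets_eq_imp_space_eq[OF Ps] by auto
  have small: "\<exists>n. D * measure m (U n) \<le> e"
    if "decseq U" "\<And>n. U n \<in> sets borel" "(\<Inter>n. U n) = {}" "e > 0" for U :: "nat \<Rightarrow> 'b set" and e
  proof -
    have "(\<lambda>n. measure m (U n)) \<longlonglongrightarrow> measure m (\<Inter>n. U n)"
      by (rule m.finite_Lim_measure_decseq) (use that in auto)
    then have "(\<lambda>n. D * measure m (U n)) \<longlonglongrightarrow> 0" using that by (intro tendsto_mult_right_zero) simp
    then have "\<forall>\<^sub>F n in sequentially. D * measure m (U n) < e" using \<open>e > 0\<close> by (rule order_tendstoD)
    then show ?thesis by (auto simp: eventually_sequentially intro: less_imp_le)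
  qed
  have "A \<in> sigma_sets UNIV {S. open S}" using \<open>A \<in> sets borel\<close> by (simp add: borel_def)
  then show ?thesis
  proof (rule sigma_sets_induct_disjoint[rotated 2])
    show "Int_stable {S :: 'b set. open S}" by (auto simp: Int_stable_def)
    show "{S :: 'b set. open S} \<subseteq> Pow UNIV" by simp
    fix U :: "'b set" assume "U \<in> {S. open S}"
    then have U[measurable]: "open U" "U \<in> sets borel" by auto
    show "continuous_on UNIV (\<lambda>x. measure (P x) U)"
    \<comment> \<open>\<open>infdist\<close> to the empty set is 0, so the cutoff below works only
      for a nonempty complement.\<close>
    proof (cases "U = UNIV")
      case True
      then show ?thesis using P.prob_space by simp
    next
      case False
      let ?d = "\<lambda>y. infdist y (- U)"
      have [measurable]: "?d \<in> borel_measurable borel"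
        by (intro borel_measurable_continuous_onI continuous_intros)
      define F where "F n = {y. 1 / Suc n \<le> ?d y}" for n
      have Fm[measurable]: "F n \<in> sets borel" for n unfolding F_def by measurable
      have FU: "F n \<subseteq> U" for n
      proof
        fix y assume y: "y \<in> F n"
        show "y \<in> U"
        proof (rule ccontr)
          assume "y \<notin> U" then have "?d y = 0" by simp
          then show False using y by (simp add: F_def)
        qed
      qed
      have "\<exists>n. y \<in> F n" if "y \<in> U" for y
      proof -
        have "0 < ?d y" using False U that by (subst infdist_pos_not_in_closed) auto
        then show ?thesis using nat_approx_posE[of "?d y"] by (auto simp: F_def intro: less_imp_le)
      qed
      then have I: "(\<Inter>n. U - F n) = {}" by auto
      have dec: "decseq (\<lambda>n. U - F n)"
      proof (rule decseq_SucI)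
        fix n
        have "1 / real (Suc (Suc n)) \<le> 1 / Suc n" by (simp add: field_simps)
        then show "U - F (Suc n) \<subseteq> U - F n" by (auto simp: F_def)
      qed
      show ?thesis
      proof (rule continuous_on_uniform_approx)
        fix e :: real assume "e > 0"
        obtain n where n: "D * measure m (U - F n) \<le> e" using small[OF dec _ I \<open>e > 0\<close>] by auto
        \<comment> \<open>A continuous cutoff that vanishes off U and equals 1 on
          \<open>F n\<close>; it differs from the indicator of U only on
          \<open>U - F n\<close>.\<close>
        define f where "f y = min 1 (Suc n * ?d y)" for y
        have fm[measurable]: "f \<in> borel_measurable borel" unfolding f_def by measurable
        have f01: "0 \<le> f y \<and> f y \<le> 1" for y by (simp add: f_def infdist_nonneg)
        have f1: "f y = 1" if "y \<in> F n" for y using that by (simp add: f_def F_def field_simps)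
        have f0: "f y = 0" if "y \<notin> U" for y using that by (simp add: f_def)
        have "\<bar>measure (P x) U - (\<integral>y. f y \<partial>P x)\<bar> \<le> e" for x
        proof -
          have i: "integrable (P x) f" "integrable (P x) (indicator U :: 'b \<Rightarrow> real)" "integrable (P x) (indicator (U - F n) :: 'b \<Rightarrow> real)"
            using f01 by (auto intro!: P.integrable_const_bound[of _ 1])
          have "measure (P x) U - (\<integral>y. f y \<partial>P x) = (\<integral>y. indicator U y - f y \<partial>P x)" using i by simp
          also have "\<bar>\<dots>\<bar> \<le> (\<integral>y. \<bar>indicator U y - f y\<bar> \<partial>P x)" by simp
          also have "\<dots> \<le> (\<integral>y. indicator (U - F n) y \<partial>P x)"
          proof (rule integral_mono)
            fix y show "\<bar>indicator U y - f y\<bar> \<le> indicator (U - F n) y"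
              using f01[of y] f1[of y] f0[of y] by (auto simp: indicator_def)
          qed (use i in auto)
          also have "\<dots> = measure (P x) (U - F n)" by simp
          also have "\<dots> \<le> e" using dens[of "U - F n" x] n by simp
          finally show ?thesis .
        qed
        moreover have "continuous_on UNIV (\<lambda>x. \<integral>y. f y \<partial>P x)"
          by (rule feller[OF _ f01]) (auto simp: f_def intro!: continuous_intros)
        ultimately show "\<exists>f. continuous_on UNIV f \<and> (\<forall>x\<in>UNIV. \<bar>measure (P x) U - f x\<bar> \<le> e)" by blast
      qed
    qed
  next
    show "continuous_on UNIV (\<lambda>x. measure (P x) {})" by simp
  next
    fix A :: "'b set" assume "A \<in> sigma_sets UNIV {S. open S}" and c: "continuous_on UNIV (\<lambda>x. measure (P x) A)"
    then have "A \<in> sets borel" by (simp add: borel_def)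
    then have "measure (P x) (UNIV - A) = 1 - measure (P x) A" for x
      using P.prob_compl[of A x] by simp
    then show "continuous_on UNIV (\<lambda>x. measure (P x) (UNIV - A))" using c by (simp add: continuous_intros)
  next
    fix A :: "nat \<Rightarrow> 'b set"
    assume d: "disjoint_family A" and "range A \<subseteq> sigma_sets UNIV {S. open S}" and c: "\<And>i. continuous_on UNIV (\<lambda>x. measure (P x) (A i))"
    then have A[measurable]: "A i \<in> sets borel" for i by (auto simp: borel_def)
    show "continuous_on UNIV (\<lambda>x. measure (P x) (\<Union>i. A i))"
    proof (rule continuous_on_uniform_approx)
      fix e :: real assume "e > 0"
      \<comment> \<open>The tails of the union shrink to the empty set; domination makes their
        probability small uniformly in x.\<close>
      let ?U = "\<lambda>n. (\<Union>i. A i) - (\<Union>i<n. A i)"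
      have Um: "?U n \<in> sets borel" for n by measurable
      have "\<exists>n. D * measure m (?U n) \<le> e"
        by (rule small[OF _ Um _ \<open>e > 0\<close>]) (auto simp: decseq_def)
      then obtain n where n: "D * measure m (?U n) \<le> e" by blast
      have "\<bar>measure (P x) (\<Union>i. A i) - (\<Sum>i<n. measure (P x) (A i))\<bar> \<le> e" for x
      proof -
        have "(\<Sum>i<n. measure (P x) (A i)) = measure (P x) (\<Union>i<n. A i)"
          using d by (intro P.finite_measure_finite_Union[symmetric]) (auto simp: disjoint_family_on_def)
        moreover have "measure (P x) (?U n) = measure (P x) (\<Union>i. A i) - measure (P x) (\<Union>i<n. A i)"
          by (rule P.finite_measure_Diff) auto
        ultimately show ?thesis using dens[OF Um, of x n] n measure_nonneg[of "P x" "?U n"] by linarith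
      qed
      moreover have "continuous_on UNIV (\<lambda>x. \<Sum>i<n. measure (P x) (A i))"
        by (intro continuous_intros c)
      ultimately show "\<exists>f. continuous_on UNIV f \<and> (\<forall>x\<in>UNIV. \<bar>measure (P x) (\<Union>i. A i) - f x\<bar> \<le> e)" by blast
    qed
  qed
qed

section \<open>The support of a measure\<close>

lemma msupport_closed: "closed (msupport \<mu>)"
proof -
  have "open (- msupport \<mu>)"
  proof (subst open_subopen, intro ballI)
    fix x assume "x \<in> - msupport \<mu>"
    then obtain U where "open U" "x \<in> U" "\<not> emeasure \<mu> U > 0" by (auto simp: msupport_def)
    then show "\<exists>T. open T \<and> x \<in> T \<and> T \<subseteq> - msupport \<mu>" by (intro exI[of _ U]) (auto simp: msupport_def)
  qed
  then show ?thesis by (simp add: closed_def)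
qed

text \<open>The complement is a union of open null sets, and a countable basis reduces this union to
  a countable one.\<close>

lemma msupport_null:
  assumes "compact (UNIV :: 'm::metric_space set)" and s: "sets \<mu> = sets (borel :: 'm measure)"
  shows "- msupport \<mu> \<in> null_sets \<mu>"
proof -
  obtain B :: "'m set set" where B: "countable B" "topological_basis B"
    using compact_countable_basis(2)[OF assms(1)] by blast
  let ?B = "{b\<in>B. emeasure \<mu> b = 0}"
  have "(\<Union>b\<in>?B. b) \<in> null_sets \<mu>"
    by (rule null_sets_UN') (use B s topological_basis_open[OF B(2)] in \<open>auto intro: countable_subset[of _ B]\<close>)
  moreover have "- msupport \<mu> \<subseteq> (\<Union>b\<in>?B. b)"
  proof
    fix x assume "x \<in> - msupport \<mu>"
    then obtain U where U: "open U" "x \<in> U" "emeasure \<mu> U = 0" by (auto simp: msupport_def not_gr_zero)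
    obtain b where b: "b \<in> B" "x \<in> b" "b \<subseteq> U" using topological_basisE[OF B(2) U(1,2)] by auto
    have "emeasure \<mu> b \<le> emeasure \<mu> U" using b U s by (intro emeasure_mono) auto
    then show "x \<in> (\<Union>b\<in>?B. b)" using b U by auto
  qed
  moreover have "- msupport \<mu> \<in> sets \<mu>" using msupport_closed[of \<mu>] s by (simp add: borel_closed)
  ultimately show ?thesis by (blast intro: null_sets_subset)
qed

section \<open>Change of variables for arbitrary finite index types\<close>

text \<open>The library states the change of variables theorem for index types of class \<open>wellorder\<close> only;
  a well-ordered copy of the index type transports it to all finite ones.\<close>

typedef 'k wo_index = "UNIV :: 'k::finite set"
  morphisms of_wo to_wo by auto

lemma bij_of_wo: "bij of_wo" and bij_to_wo: "bij to_wo"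
  by (auto intro!: bij_betw_byWitness[of _ to_wo] bij_betw_byWitness[of _ of_wo] simp: of_wo_inverse to_wo_inverse)

instance wo_index :: (finite) finite
proof
  have "finite (range (to_wo :: 'a \<Rightarrow> 'a wo_index))" by simp
  moreover have "range (to_wo :: 'a \<Rightarrow> 'a wo_index) = UNIV" by (rule bij_is_surj[OF bij_to_wo])
  ultimately show "finite (UNIV :: 'a wo_index set)" by simp
qed

instantiation wo_index :: (finite) wellorder
begin

definition "less_eq_wo_index (a :: 'a wo_index) (b :: 'a wo_index) \<longleftrightarrow> to_nat (of_wo a) \<le> to_nat (of_wo b)"
definition "less_wo_index (a :: 'a wo_index) (b :: 'a wo_index) \<longleftrightarrow> to_nat (of_wo a) < to_nat (of_wo b)"

instance
proof
  fix P :: "'a wo_index \<Rightarrow> bool" and a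
  assume *: "\<And>x. (\<And>y. y < x \<Longrightarrow> P y) \<Longrightarrow> P x"
  show "P a"
    by (induction a rule: measure_induct_rule[of "\<lambda>a. to_nat (of_wo a)"]) (rule *, simp add: less_wo_index_def)
qed (auto simp: less_eq_wo_index_def less_wo_index_def of_wo_inject)

end

definition reindex :: "real^'k::finite \<Rightarrow> real^'k wo_index" where "reindex x = (\<chi> i. x $ of_wo i)"
definition unreindex :: "real^'k::finite wo_index \<Rightarrow> real^'k" where "unreindex x = (\<chi> i. x $ to_wo i)"

lemma reindex_unreindex[simp]: "reindex (unreindex x) = x" "unreindex (reindex y) = y"
  by (simp_all add: reindex_def unreindex_def vec_eq_iff of_wo_inverse to_wo_inverse)

lemma linear_reindex: "linear reindex" "linear unreindex"
  by (auto simp: linear_iff reindex_def unreindex_def vec_eq_iff)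

lemma bounded_linear_reindex: "bounded_linear reindex" "bounded_linear unreindex"
  using linear_reindex by (simp_all add: linear_conv_bounded_linear)

lemma reindex_measurable[measurable]: "reindex \<in> borel_measurable borel" "unreindex \<in> borel_measurable borel"
  using bounded_linear_reindex by (auto intro!: borel_measurable_continuous_onI linear_continuous_on)

text \<open>Renaming the coordinates carries boxes to boxes of the same volume, and volumes of boxes
  determine Lebesgue measure.\<close>

lemma distr_reindex: "distr lborel borel (reindex :: real^'k::finite \<Rightarrow> _) = lborel"
proof (rule lborel_eqI[symmetric])
  fix l u :: "real^'k wo_index"
  assume le: "\<And>b. b \<in> Basis \<Longrightarrow> l \<bullet> b \<le> u \<bullet> b"
  have le': "l $ i \<le> u $ i" for i using le[of "axis i 1"] by (simp add: inner_axis axis_in_Basis_iff)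
  have pre: "reindex -` box l u = box (unreindex l) (unreindex u)"
    by (auto simp: mem_box_cart reindex_def unreindex_def) (metis of_wo_inverse to_wo_inverse UNIV_I)+
  have "emeasure (distr lborel borel reindex) (box l u) = emeasure lborel (box (unreindex l) (unreindex u))"
    by (simp add: emeasure_distr pre)
  also have "\<dots> = ennreal (measure lborel (cbox (unreindex l) (unreindex u)))"
    by (auto simp: emeasure_lborel_box_eq content_cbox_cases inner_diff_left intro!: arg_cong[where f=ennreal] prod.cong)
  also have "measure lborel (cbox (unreindex l) (unreindex u)) = (\<Prod>i\<in>UNIV. unreindex u $ i - unreindex l $ i)"
    by (rule content_cbox_cart) (auto simp: interval_ne_empty_cart unreindex_def le')
  also have "\<dots> = (\<Prod>i\<in>UNIV. u $ i - l $ i)"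
    by (rule prod.reindex_bij_betw[OF bij_to_wo, of "\<lambda>i. u $ i - l $ i", symmetric, THEN trans, symmetric]) (simp add: unreindex_def)
  also have "\<dots> = measure lborel (cbox l u)"
    by (rule content_cbox_cart[symmetric]) (auto simp: interval_ne_empty_cart le')
  also have "\<dots> = (\<Prod>b\<in>Basis. (u - l) \<bullet> b)"
    using le by (auto simp: content_cbox_cases inner_diff_left intro!: prod.cong)
  finally show "emeasure (distr lborel borel reindex) (box l u) = ennreal (\<Prod>b\<in>Basis. (u - l) \<bullet> b)" .
qed simp

text \<open>In the Leibniz formula, conjugation with \<open>to_wo\<close> is a bijection between the
  permutations of the two index types that preserves signs.\<close>

lemma det_reindex:
  fixes A :: "real^'k::finite^'k"
  shows "det (\<chi> i j. A $ of_wo i $ of_wo j) = det A"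
proof -
  let ?m = "map_permutation UNIV (to_wo :: 'k \<Rightarrow> 'k wo_index)"
  have m: "?m p i = to_wo (p (of_wo i))" for p i
  proof -
    have "inv_into UNIV to_wo i = of_wo i"
      by (metis UNIV_I bij_to_wo bij_inv_eq_iff of_wo_inverse)
    moreover have "range (to_wo :: 'k \<Rightarrow> _) = UNIV" by (rule bij_is_surj[OF bij_to_wo])
    ultimately show ?thesis by (simp add: map_permutation_def restrict_id_def)
  qed
  have inj: "inj (to_wo :: 'k \<Rightarrow> _)" by (rule bij_is_inj[OF bij_to_wo])
  have "det A = (\<Sum>p\<in>{p. p permutes UNIV}. of_int (sign p) * (\<Prod>i\<in>UNIV. A $ i $ p i))"
    by (simp add: det_def)
  also have "\<dots> = (\<Sum>p\<in>{p. p permutes UNIV}. of_int (sign (?m p)) * (\<Prod>i\<in>UNIV. A $ of_wo i $ of_wo (?m p i)))"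
  proof (intro sum.cong refl)
    fix p :: "'k \<Rightarrow> 'k" assume p: "p \<in> {p. p permutes UNIV}"
    have "(\<Prod>i\<in>UNIV. A $ i $ p i) = (\<Prod>i\<in>UNIV. A $ of_wo i $ p (of_wo i))"
      by (rule prod.reindex_bij_betw[OF bij_of_wo, of "\<lambda>i. A $ i $ p i", symmetric])
    then show "of_int (sign p) * (\<Prod>i\<in>UNIV. A $ i $ p i) = of_int (sign (?m p)) * (\<Prod>i\<in>UNIV. A $ of_wo i $ of_wo (?m p i))"
      using p inj by (simp add: sign_map_permutation m to_wo_inverse)
  qed
  also have "\<dots> = (\<Sum>p\<in>{p. p permutes UNIV}. of_int (sign p) * (\<Prod>i\<in>UNIV. A $ of_wo i $ of_wo (p i)))"
  proof (rule sum.reindex_bij_betw)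
    show "bij_betw ?m {p. p permutes UNIV} {p. p permutes UNIV}"
    proof (rule bij_betw_byWitness[of _ "\<lambda>q. of_wo \<circ> q \<circ> to_wo"])
      show "\<forall>p\<in>{p. p permutes UNIV}. of_wo \<circ> ?m p \<circ> to_wo = p"
        by (auto simp: m fun_eq_iff to_wo_inverse)
      show "\<forall>q\<in>{p. p permutes UNIV}. ?m (of_wo \<circ> q \<circ> to_wo) = q"
        by (auto simp: m fun_eq_iff of_wo_inverse)
      show "?m ` {p. p permutes UNIV} \<subseteq> {p. p permutes UNIV}"
        by (auto intro!: map_permutation_permutes[where A=UNIV] bij_to_wo)
      show "(\<lambda>q. of_wo \<circ> q \<circ> to_wo) ` {p. p permutes UNIV} \<subseteq> {p. p permutes UNIV}"
        by (auto intro!: bij_imp_permutes bij_comp bij_of_wo bij_to_wo dest: permutes_bij)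
    qed
  qed
  finally show ?thesis by (simp add: det_def)
qed

text \<open>The right-hand side equals the integral over T of the Jacobian times
  \<open>f (h t)\<close>, whose integrand is at least c. Only this inequality is used: it says that
  a map with Jacobian bounded below cannot concentrate mass.\<close>

lemma change_of_variables_ineq_wo:
  fixes h :: "real^'n::{finite,wellorder} \<Rightarrow> real^'n::_" and f :: "real^'n::_ \<Rightarrow> real"
  assumes T: "T \<in> sets borel" "emeasure lborel T < \<infinity>" and hT: "h ` T \<in> sets borel"
    and der: "\<And>t. t \<in> T \<Longrightarrow> (h has_derivative h' t) (at t within T)"
    and inj: "inj_on h T"
    and f[measurable]: "f \<in> borel_measurable borel" and f0: "\<And>u. 0 \<le> f u"
    and c: "0 \<le> c" "\<And>t. t \<in> T \<Longrightarrow> c \<le> \<bar>det (matrix (h' t))\<bar> * f (h t)"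
  shows "ennreal c * emeasure lborel T \<le> (\<integral>\<^sup>+u\<in>h ` T. ennreal (f u) \<partial>lborel)"
\<comment> \<open>An infinite right-hand side is trivial; a finite one gives the absolute
  integrability of f on the image.\<close>
proof (cases "(\<integral>\<^sup>+u\<in>h ` T. ennreal (f u) \<partial>lborel) = \<infinity>")
  case False
  have iff: "integrable lborel (\<lambda>u. indicator (h ` T) u *\<^sub>R f u)"
    by (rule integrableI_nonneg) (use False hT f0 in \<open>auto simp: less_top ennreal_mult'' ennreal_indicator mult.commute\<close>)
  then have i: "set_integrable lborel (h ` T) f" by (simp add: set_integrable_def)
  have eq: "(\<integral>\<^sup>+u\<in>h ` T. ennreal (f u) \<partial>lborel) = ennreal (integral (h ` T) f)"
  proof -
    have "(\<integral>\<^sup>+u\<in>h ` T. ennreal (f u) \<partial>lborel) = (\<integral>\<^sup>+u. ennreal (indicator (h ` T) u *\<^sub>R f u) \<partial>lborel)"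
      by (intro nn_integral_cong) (auto simp: indicator_def)
    also have "\<dots> = ennreal (\<integral>u. indicator (h ` T) u *\<^sub>R f u \<partial>lborel)"
      by (rule nn_integral_eq_integral[OF iff]) (auto simp: f0)
    also have "(\<integral>u. indicator (h ` T) u *\<^sub>R f u \<partial>lborel) = integral (h ` T) f"
      using set_borel_integral_eq_integral(2)[OF i] by (simp add: set_lebesgue_integral_def)
    finally show ?thesis .
  qed
  have ai: "f absolutely_integrable_on (h ` T)"
    by (rule nonnegative_absolutely_integrable_1[OF set_borel_integral_eq_integral(1)[OF i]]) (rule f0)
  have TL: "T \<in> sets lebesgue" using T by simp
  \<comment> \<open>The theorem on vector-valued integrands is applied to \<open>vec (f u)\<close>
    in \<open>real^1\<close> and read back as a statement on reals.\<close>
  have "(\<lambda>t. \<bar>det (matrix (h' t))\<bar> *\<^sub>R (vec (f (h t)) :: real^1)) absolutely_integrable_on T \<and>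
     integral T (\<lambda>t. \<bar>det (matrix (h' t))\<bar> *\<^sub>R (vec (f (h t)) :: real^1)) = vec (integral (h ` T) f)"
    using has_absolute_integral_change_of_variables[OF TL der inj, of "\<lambda>u. vec (f u) :: real^1" "vec (integral (h ` T) f)"] ai
    by (simp add: absolutely_integrable_on_1_iff integral_on_1_eq)
  then have 1: "(\<lambda>t. \<bar>det (matrix (h' t))\<bar> * f (h t)) absolutely_integrable_on T"
    and 2: "integral T (\<lambda>t. \<bar>det (matrix (h' t))\<bar> * f (h t)) = integral (h ` T) f"
    by (auto simp: absolutely_integrable_on_1_iff integral_on_1_eq vec_eq_iff)
  have Tm: "T \<in> lmeasurable" using T by (auto simp: fmeasurable_def)
  have "c * measure lebesgue T = integral T (\<lambda>_. c)"
    using Tm by (simp add: lmeasure_integral integral_mult_right[symmetric] flip: integral_mult_right)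
  also have "\<dots> \<le> integral T (\<lambda>t. \<bar>det (matrix (h' t))\<bar> * f (h t))"
    by (rule integral_le) (use Tm 1 c in \<open>auto simp: absolutely_integrable_on_def integrable_on_const\<close>)
  finally have "c * measure lebesgue T \<le> integral (h ` T) f" using 2 by simp
  moreover have "emeasure lborel T = ennreal (measure lebesgue T)"
    using T by (simp add: measure_def)
  ultimately show ?thesis using c(1) by (simp add: eq ennreal_mult[symmetric] ennreal_leI)
qed simp

lemma change_of_variables_ineq:
  fixes h :: "real^'k::finite \<Rightarrow> real^'k" and f :: "real^'k \<Rightarrow> real"
  assumes T[measurable]: "T \<in> sets borel" and fin: "emeasure lborel T < \<infinity>" and hT[measurable]: "h ` T \<in> sets borel"
    and der: "\<And>t. t \<in> T \<Longrightarrow> (h has_derivative h' t) (at t within T)"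
    and inj: "inj_on h T"
    and f[measurable]: "f \<in> borel_measurable borel" and f0: "\<And>u. 0 \<le> f u"
    and c: "0 \<le> c" "\<And>t. t \<in> T \<Longrightarrow> c \<le> \<bar>det (matrix (h' t))\<bar> * f (h t)"
  shows "ennreal c * emeasure lborel T \<le> (\<integral>\<^sup>+u\<in>h ` T. ennreal (f u) \<partial>lborel)"
proof -
  have img: "reindex ` X = unreindex -` X" for X :: "(real^'k) set"
    by (auto simp: image_iff) (metis reindex_unreindex(1))
  have img_m[measurable]: "reindex ` X \<in> sets borel" if [measurable]: "X \<in> sets borel" for X :: "(real^'k) set"
    unfolding img using measurable_sets[OF reindex_measurable(2), of X] by simp
  have em: "emeasure lborel (reindex ` X) = emeasure lborel X" if [measurable]: "X \<in> sets borel" for X :: "(real^'k) set"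
  proof -
    have "emeasure lborel (reindex ` X) = emeasure (distr lborel borel (reindex :: real^'k \<Rightarrow> _)) (reindex ` X)"
      by (simp add: distr_reindex)
    also have "\<dots> = emeasure lborel (reindex -` reindex ` X)" by (subst emeasure_distr) auto
    also have "reindex -` reindex ` X = X" unfolding img by auto
    finally show ?thesis .
  qed
  define hh where "hh = reindex \<circ> h \<circ> unreindex"
  have hhT: "hh ` (reindex ` T) = reindex ` (h ` T)" by (auto simp: hh_def image_image)
  have "ennreal c * emeasure lborel (reindex ` T) \<le> (\<integral>\<^sup>+u\<in>hh ` (reindex ` T). ennreal (f (unreindex u)) \<partial>lborel)"
  proof (rule change_of_variables_ineq_wo[where h' = "\<lambda>t. reindex \<circ> h' (unreindex t) \<circ> unreindex"])
    show "reindex ` T \<in> sets borel" "hh ` (reindex ` T) \<in> sets borel" "emeasure lborel (reindex ` T) < \<infinity>"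
      unfolding hhT em[OF T] using fin by simp_all
    show "inj_on hh (reindex ` T)"
      using inj by (auto simp: inj_on_def hh_def dest!: arg_cong[where f=unreindex])
    show "(\<lambda>u. f (unreindex u)) \<in> borel_measurable borel" by measurable
    show "0 \<le> f (unreindex u)" for u by (rule f0)
    fix t assume "t \<in> reindex ` T"
    then obtain s where s: "s \<in> T" "t = reindex s" by auto
    have "unreindex ` (reindex ` T) = T" by (auto simp: image_image)
    then have "(h has_derivative h' s) (at (unreindex t) within unreindex ` (reindex ` T))" using der s by simp
    then have "(h \<circ> unreindex has_derivative h' s \<circ> unreindex) (at t within reindex ` T)"
      by (rule diff_chain_within[rotated]) (rule bounded_linear_imp_has_derivative[OF bounded_linear_reindex(2)])
    then have "(reindex \<circ> (h \<circ> unreindex) has_derivative reindex \<circ> (h' s \<circ> unreindex)) (at t within reindex ` T)"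
      by (rule diff_chain_within) (rule bounded_linear_imp_has_derivative[OF bounded_linear_reindex(1)])
    then show "(hh has_derivative reindex \<circ> h' (unreindex t) \<circ> unreindex) (at t within reindex ` T)"
      by (simp add: hh_def s o_assoc)
    have "matrix (reindex \<circ> h' s \<circ> unreindex) = (\<chi> i j. matrix (h' s) $ of_wo i $ of_wo j)"
    proof -
      have ax: "unreindex (axis j 1) = axis (of_wo j) 1" for j :: "'k wo_index"
        by (auto simp: unreindex_def axis_def vec_eq_iff of_wo_inverse to_wo_inverse)
      show ?thesis by (subst vec_eq_iff) (simp add: matrix_def reindex_def ax)
    qed
    then show "c \<le> \<bar>det (matrix (reindex \<circ> h' (unreindex t) \<circ> unreindex))\<bar> * f (unreindex (hh t))"
      using c(2)[OF s(1)] by (simp add: s hh_def det_reindex)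
  qed (rule c)
  also have "(\<integral>\<^sup>+u\<in>hh ` (reindex ` T). ennreal (f (unreindex u)) \<partial>lborel)
     = (\<integral>\<^sup>+u. ennreal (f (unreindex u)) * indicator (reindex ` (h ` T)) u \<partial>distr lborel borel (reindex :: real^'k \<Rightarrow> _))"
    unfolding hhT distr_reindex ..
  also have "\<dots> = (\<integral>\<^sup>+u\<in>h ` T. ennreal (f u) \<partial>lborel)"
    by (subst nn_integral_distr) (auto simp: img indicator_def intro!: nn_integral_cong)
  finally show ?thesis by (simp add: em)
qed

section \<open>Noise and charts\<close>

lemma cube_props:
  fixes \<sigma> :: real
  shows "compact (cube \<sigma> :: (real^'k::finite) set)" "closed (cube \<sigma> :: (real^'k) set)"
    "cube \<sigma> \<in> sets (borel :: (real^'k) measure)" "interior (cube \<sigma> :: (real^'k) set) = box (\<chi> i. - \<sigma>) (\<chi> i. \<sigma>)"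
    "emeasure lborel (cube \<sigma> :: (real^'k) set) < \<infinity>"
  unfolding cube_def by (auto simp: emeasure_lborel_cbox_finite[unfolded infinity_ennreal_def])

lemma box_in_cube: "box (\<chi> i. - \<sigma>) (\<chi> i. \<sigma>) \<subseteq> (cube \<sigma> :: (real^'k::finite) set)"
  by (auto simp: cube_def mem_box_cart less_imp_le)

lemma space_noise[simp]: "space (noise \<sigma>) = cube \<sigma>"
  by (simp add: noise_def space_restrict_space)

lemma sets_noise: "sets (noise \<sigma> :: (real^'k::finite) measure) = sets (restrict_space borel (cube \<sigma>))"
  by (simp add: noise_def sets_restrict_space)

lemma sets_noise_iff: "A \<in> sets (noise \<sigma> :: (real^'k::finite) measure) \<longleftrightarrow> A \<subseteq> cube \<sigma> \<and> A \<in> sets borel"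
  unfolding sets_noise using cube_props(3)[of \<sigma>, where 'k='k] by (subst sets_restrict_space_iff) auto

lemma cube_box_pos:
  assumes "\<sigma> > 0"
  shows "0 < emeasure lborel (cube \<sigma> :: (real^'k::finite) set)"
    "emeasure lborel (cube \<sigma> - box (\<chi> i. - \<sigma>) (\<chi> i. \<sigma>) :: (real^'k::finite) set) = 0"
    "closure (box (\<chi> i. - \<sigma>) (\<chi> i. \<sigma>) :: (real^'k) set) = cube \<sigma>"
proof -
  have ne: "box (\<chi> i. - \<sigma>) (\<chi> i. \<sigma>) \<noteq> ({} :: (real^'k) set)"
    using assms by (auto simp: interval_ne_empty_cart)
  have "emeasure lborel (box (\<chi> i. - \<sigma>) (\<chi> i. \<sigma>) :: (real^'k) set) \<noteq> 0"
    using ne open_not_negligible[OF open_box, of "\<chi> i. - \<sigma>" "\<chi> i. \<sigma> :: real^'k"]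
    by (auto simp: negligible_iff_null_sets null_sets_def)
  moreover have "emeasure lborel (box (\<chi> i. - \<sigma>) (\<chi> i. \<sigma>) :: (real^'k) set) \<le> emeasure lborel (cube \<sigma> :: (real^'k) set)"
    by (intro emeasure_mono box_in_cube) (simp add: cube_props)
  ultimately show "0 < emeasure lborel (cube \<sigma> :: (real^'k::finite) set)"
    by (metis le_zero_eq not_gr_zero)
  show "emeasure lborel (cube \<sigma> - box (\<chi> i. - \<sigma>) (\<chi> i. \<sigma>) :: (real^'k::finite) set) = 0"
    using negligible_frontier_interval[of "\<chi> i. - \<sigma>" "\<chi> i. \<sigma> :: real^'k"]
    by (auto simp: negligible_iff_null_sets null_sets_def cube_def)
  show "closure (box (\<chi> i. - \<sigma>) (\<chi> i. \<sigma>) :: (real^'k) set) = cube \<sigma>"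
    unfolding cube_def by (rule closure_box[OF ne])
qed

lemma emeasure_noise:
  fixes A :: "(real^'k::finite) set"
  assumes "A \<in> sets (noise \<sigma>)"
  shows "emeasure (noise \<sigma>) A = emeasure lborel A / emeasure lborel (cube \<sigma> :: (real^'k) set)"
proof -
  have A: "A \<subseteq> cube \<sigma>" "A \<in> sets borel" using assms by (auto simp: sets_noise_iff)
  have s: "sets (restrict_space lborel (cube \<sigma> :: (real^'k) set)) = sets (noise \<sigma>)"
    by (simp add: sets_noise sets_restrict_space)
  have c: "(cube \<sigma> :: (real^'k) set) \<in> sets (noise \<sigma>)" by (simp add: sets_noise_iff cube_props)
  have r: "emeasure (restrict_space lborel (cube \<sigma>)) B = emeasure lborel B" if "B \<subseteq> cube \<sigma>" for B :: "(real^'k) set"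
    by (rule emeasure_restrict_space) (use that cube_props(3)[of \<sigma>, where 'k='k] in auto)
  show ?thesis
    unfolding noise_def using A c assms s by (subst emeasure_uniform_measure) (auto simp: r Int_absorb1)
qed

lemma prob_space_noise:
  assumes "\<sigma> > 0" shows "prob_space (noise \<sigma> :: (real^'k::finite) measure)"
proof
  have "(cube \<sigma> :: (real^'k) set) \<in> sets (noise \<sigma>)" by (simp add: sets_noise_iff cube_props)
  then have "emeasure (noise \<sigma>) (cube \<sigma> :: (real^'k) set) = 1"
    using cube_box_pos(1)[OF assms, where 'k='k] cube_props(5)[of \<sigma>, where 'k='k]
    by (subst emeasure_noise) (auto simp: ennreal_divide_self)
  then show "emeasure (noise \<sigma> :: (real^'k) measure) (space (noise \<sigma>)) = 1" by simp
qed

lemma rel_open_noise: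
  fixes S :: "(real^'k::finite) set"
  assumes "S \<subseteq> cube \<sigma>" "\<And>t. t \<in> S \<Longrightarrow> \<exists>\<delta>>0. \<forall>s\<in>cube \<sigma>. dist s t < \<delta> \<longrightarrow> s \<in> S"
  shows "S \<in> sets (noise \<sigma>)"
proof -
  have "openin (top_of_set (cube \<sigma>)) S" using assms by (auto simp: openin_euclidean_subtopology_iff)
  then obtain U where "open U" "S = cube \<sigma> \<inter> U" by (auto simp: openin_open)
  then show ?thesis by (auto simp: sets_noise_iff cube_props)
qed

text \<open>Holds also at boundary points of the cube, because its interior is dense in it: every
  neighbourhood of t meets the interior in a nonempty open set.\<close>

lemma noise_open_pos:
  fixes U :: "(real^'k::finite) set"
  assumes "\<sigma> > 0" "open U" "t \<in> U" "t \<in> cube \<sigma>"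
  shows "0 < emeasure (noise \<sigma>) (U \<inter> cube \<sigma>)"
proof -
  let ?B = "box (\<chi> i. - \<sigma>) (\<chi> i. \<sigma>) :: (real^'k) set"
  have "t \<in> closure ?B" using cube_box_pos(3)[OF assms(1), where 'k='k] assms(4) by simp
  then have ne: "U \<inter> ?B \<noteq> {}" using assms open_Int_closure_eq_empty[of U ?B] by blast
  have op: "open (U \<inter> ?B)" using assms by auto
  have "emeasure lborel (U \<inter> ?B) \<noteq> 0"
    using open_not_negligible[OF op ne] op by (auto simp: negligible_iff_null_sets null_sets_def)
  moreover have "emeasure lborel (U \<inter> ?B) \<le> emeasure lborel (U \<inter> cube \<sigma>)"
    using box_in_cube[of \<sigma>, where 'k='k] assms by (intro emeasure_mono) (auto simp: cube_props)
  ultimately have "emeasure lborel (U \<inter> cube \<sigma>) \<noteq> 0" by (metis le_zero_eq)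
  moreover have "U \<inter> cube \<sigma> \<in> sets (noise \<sigma>)" using assms by (auto simp: sets_noise_iff cube_props)
  ultimately show ?thesis using cube_props(5)[of \<sigma>, where 'k='k]
    by (subst emeasure_noise) (auto simp: ennreal_divide_eq_0_iff zero_less_iff_neq_zero)
qed

section \<open>Change of charts, tangent norms and the volume\<close>

locale compact_riem =
  fixes M :: "('m::metric_space, 'k::finite) riem" and m :: "'m measure"
  assumes rm: "riemannian_manifold M" and comp: "compact (UNIV :: 'm set)" and vol: "volume_measure M m"
begin

lemma sets_m[measurable_cong]: "sets m = sets borel" using vol by (simp add: volume_measure_def)

lemma space_m[simp]: "space m = UNIV" using sets_eq_imp_space_eq[OF sets_m] by simp

lemma chart_at: "chart_at M x \<in> atlas M" "x \<in> dom_of (chart_at M x)"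
proof -
  have "x \<in> (\<Union>c\<in>atlas M. dom_of c)"
    using rm by (simp add: riemannian_manifold_def smooth_atlas_def)
  then have "\<exists>c. c \<in> atlas M \<and> x \<in> dom_of c" by blast
  from someI_ex[OF this] show "chart_at M x \<in> atlas M" "x \<in> dom_of (chart_at M x)"
    by (auto simp: chart_at_def)
qed

lemma chart:
  assumes "c \<in> atlas M"
  shows "open (dom_of c)" "open (coord c ` dom_of c)" "continuous_on (dom_of c) (coord c)"
    "continuous_on (coord c ` dom_of c) (param c)"
    "x \<in> dom_of c \<Longrightarrow> param c (coord c x) = x"
    "u \<in> coord c ` dom_of c \<Longrightarrow> param c u \<in> dom_of c \<and> coord c (param c u) = u"
  using rm assms by (auto simp: riemannian_manifold_def smooth_atlas_def homeomorphism_def)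

lemma finite_atlas: "\<exists>F. finite F \<and> F \<subseteq> atlas M \<and> (\<Union>c\<in>F. dom_of c) = UNIV"
proof -
  have "UNIV \<subseteq> (\<Union>c\<in>atlas M. dom_of c)" using chart_at by blast
  then obtain F where "F \<subseteq> atlas M" "finite F" "UNIV \<subseteq> (\<Union>c\<in>F. dom_of c)"
    using compactE_image[OF comp, of "atlas M" dom_of] chart(1) by metis
  then show ?thesis by (intro exI[of _ F]) auto
qed

lemma gram_continuous:
  assumes "c \<in> atlas M" shows "continuous_on (coord c ` dom_of c) (gram M c \<circ> param c)"
proof -
  have "Ck_on 0 (coord c ` dom_of c) (gram M c \<circ> param c)"
    using rm assms unfolding riemannian_manifold_def smooth_metric_def smooth_on_def by blast
  then show ?thesis by (simp only: Ck_on.simps)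
qed

lemma gram_pos:
  assumes "c \<in> atlas M" "x \<in> dom_of c" "v \<noteq> 0" shows "v \<bullet> (gram M c x *v v) > 0"
  using rm assms unfolding riemannian_manifold_def smooth_metric_def by blast

definition trans_jac :: "('m, 'k) chart \<Rightarrow> ('m, 'k) chart \<Rightarrow> 'm \<Rightarrow> real^'k \<Rightarrow> real^'k" where
  "trans_jac c c' x = frechet_derivative (coord c' \<circ> param c) (at (coord c x))"

lemma trans_jac:
  assumes "c \<in> atlas M" "c' \<in> atlas M" "x \<in> dom_of c \<inter> dom_of c'"
  shows "((coord c' \<circ> param c) has_derivative trans_jac c c' x) (at (coord c x))"
    "gram M c x = transpose (matrix (trans_jac c c' x)) ** gram M c' x ** matrix (trans_jac c c' x)"
proof -
  have "Ck_on (Suc 0) (coord c ` (dom_of c \<inter> dom_of c')) (coord c' \<circ> param c)"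
    using rm assms unfolding riemannian_manifold_def smooth_atlas_def smooth_on_def by blast
  then have "(coord c' \<circ> param c) differentiable (at (coord c x))" using assms by auto
  then show "((coord c' \<circ> param c) has_derivative trans_jac c c' x) (at (coord c x))"
    unfolding trans_jac_def by (simp add: frechet_derivative_works)
  show "gram M c x = transpose (matrix (trans_jac c c' x)) ** gram M c' x ** matrix (trans_jac c c' x)"
    using rm assms unfolding riemannian_manifold_def smooth_metric_def trans_jac_def Let_def by blast
qed

text \<open>Continuity of F at t keeps nearby values in the domain of c, where
  \<open>param c\<close> inverts \<open>coord c\<close>; the claim is then the chain rule.\<close>

lemma chart_change:
  fixes F :: "'a::real_normed_vector \<Rightarrow> 'm"
  assumes "isCont F t" and c: "c \<in> atlas M" "c' \<in> atlas M" and y: "F t \<in> dom_of c \<inter> dom_of c'"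
    and d: "((coord c \<circ> F) has_derivative L) (at t)"
  shows "((coord c' \<circ> F) has_derivative trans_jac c c' (F t) \<circ> L) (at t)"
proof -
  have "((coord c' \<circ> param c) \<circ> (coord c \<circ> F) has_derivative trans_jac c c' (F t) \<circ> L) (at t)"
    by (rule diff_chain_at[OF d]) (use trans_jac(1)[OF c y] in simp)
  moreover have "\<forall>\<^sub>F s in at t. F s \<in> dom_of c"
    using assms(1) chart(1)[OF c(1)] y by (auto simp: isCont_def dest: topological_tendstoD)
  then have "\<forall>\<^sub>F s in at t. ((coord c' \<circ> param c) \<circ> (coord c \<circ> F)) s = (coord c' \<circ> F) s"
    by eventually_elim (simp add: chart(5)[OF c(1)])
  ultimately show ?thesis
    by (rule has_derivative_transform_eventually) (use y in \<open>simp_all add: chart(5)[OF c(1)]\<close>)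
qed

text \<open>The transformation law of Gram matrices makes the length of a tangent vector independent
  of the chart. It frees later computations from the arbitrarily chosen
  \<open>chart_at\<close>.\<close>

lemma tnorm_change:
  assumes "c \<in> atlas M" "y \<in> dom_of c"
  shows "tnorm M y (trans_jac c (chart_at M y) y w) = sqrt (w \<bullet> (gram M c y *v w))"
proof -
  let ?J = "matrix (trans_jac c (chart_at M y) y)"
  have y: "y \<in> dom_of c \<inter> dom_of (chart_at M y)" using assms chart_at by auto
  note tj = trans_jac[OF assms(1) chart_at(1)[of y] y]
  have lin: "linear (trans_jac c (chart_at M y) y)" using has_derivative_linear[OF tj(1)] .
  have "trans_jac c (chart_at M y) y w = ?J *v w" using lin by (simp add: matrix_vector_mul)
  moreover have "gram M c y *v w = transpose ?J *v (gram_at M y *v (?J *v w))"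
    unfolding tj(2) gram_at_def by (simp add: matrix_vector_mul_assoc matrix_mul_assoc)
  moreover have "w \<bullet> (transpose ?J *v u) = (?J *v w) \<bullet> u" for u
    by (metis dot_lmul_matrix inner_commute transpose_matrix_vector)
  ultimately show ?thesis by (simp add: tnorm_def)
qed

lemma tnorm_pos: "v \<noteq> 0 \<Longrightarrow> 0 < tnorm M x v"
  using gram_pos[OF chart_at(1) chart_at(2)[of x]] by (simp add: tnorm_def gram_at_def)

lemma coord_image_borel:
  assumes c: "c \<in> atlas M" and A: "A \<in> sets borel" "A \<subseteq> dom_of c"
  shows "coord c ` A \<in> sets borel"
proof -
  have "coord c ` A = {u \<in> coord c ` dom_of c. param c u \<in> A}"
    using A(2) chart(5,6)[OF c] by (auto simp: image_iff subset_iff)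
  also have "\<dots> \<in> sets borel"
  proof -
    have "param c \<in> restrict_space borel (coord c ` dom_of c) \<rightarrow>\<^sub>M borel"
      by (rule borel_measurable_continuous_on_restrict[OF chart(4)[OF c]])
    from measurable_sets[OF this A(1)] have "param c -` A \<inter> (coord c ` dom_of c) \<in> sets (restrict_space borel (coord c ` dom_of c))"
      by (simp add: space_restrict_space)
    then have "param c -` A \<inter> (coord c ` dom_of c) \<in> sets borel"
      using chart(2)[OF c] by (subst (asm) sets_restrict_space_iff) auto
    moreover have "{u \<in> coord c ` dom_of c. param c u \<in> A} = param c -` A \<inter> (coord c ` dom_of c)" by auto
    ultimately show ?thesis by simp
  qed
  finally show ?thesis .
qed

text \<open>\<open>max 0\<close> and the value 0 off the chart make this a nonnegative Borel
  function on the whole coordinate space. Passing to \<open>ennreal\<close> discards negative values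
  as well, so the volume formula keeps its meaning.\<close>

definition vol_density :: "('m, 'k) chart \<Rightarrow> real^'k \<Rightarrow> real" where
  "vol_density c u = (if u \<in> coord c ` dom_of c then max 0 (sqrt (det (gram M c (param c u)))) else 0)"

lemma vol_density_continuous:
  assumes c: "c \<in> atlas M" shows "continuous_on (coord c ` dom_of c) (vol_density c)"
proof -
  have g: "continuous_on (coord c ` dom_of c) (\<lambda>u. gram M c (param c u))"
    using gram_continuous[OF c] by (simp only: o_def)
  have "continuous_on (coord c ` dom_of c) (\<lambda>u. max 0 (sqrt (det (gram M c (param c u)))))"
    unfolding det_def by (intro continuous_intros g continuous_on_component)
  then show ?thesis by (rule continuous_on_eq) (simp add: vol_density_def)
qed

lemma vol_density_measurable:
  assumes c: "c \<in> atlas M" shows "vol_density c \<in> borel_measurable borel"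
proof -
  have "(\<lambda>u. if u \<in> coord c ` dom_of c then vol_density c u else 0) \<in> borel_measurable borel"
    by (rule borel_measurable_continuous_on_if[OF _ vol_density_continuous[OF c]])
      (use chart(2)[OF c] in auto)
  moreover have "(\<lambda>u. if u \<in> coord c ` dom_of c then vol_density c u else 0) = vol_density c"
    by (auto simp: vol_density_def)
  ultimately show ?thesis by simp
qed

lemma emeasure_vol:
  assumes c: "c \<in> atlas M" and A: "A \<in> sets borel" "A \<subseteq> dom_of c"
  shows "emeasure m A = (\<integral>\<^sup>+u\<in>coord c ` A. ennreal (vol_density c u) \<partial>lborel)"
proof -
  have "emeasure m A = (\<integral>\<^sup>+u\<in>coord c ` A. ennreal (sqrt (det (gram M c (param c u)))) \<partial>lborel)"
    using vol c A by (auto simp: volume_measure_def)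
  also have "\<dots> = (\<integral>\<^sup>+u\<in>coord c ` A. ennreal (vol_density c u) \<partial>lborel)"
    using A by (intro nn_integral_cong) (auto simp: vol_density_def indicator_def max_def ennreal_neg)
  finally show ?thesis .
qed

text \<open>Every point has a neighbourhood that a chart carries into a closed ball on which the
  density is bounded; finitely many of these cover the manifold.\<close>

lemma finite_volume: "finite_measure m"
proof
  have "\<exists>W. open W \<and> x \<in> W \<and> emeasure m W < \<infinity>" for x
  proof -
    let ?c = "chart_at M x"
    note c = chart_at[of x]
    let ?p = "coord ?c x"
    obtain e where e: "e > 0" "cball ?p e \<subseteq> coord ?c ` dom_of ?c"
      using chart(2)[OF c(1)] c(2) by (auto simp: open_contains_cball)
    have "compact (vol_density ?c ` cball ?p e)"
      by (intro compact_continuous_image continuous_on_subset[OF vol_density_continuous[OF c(1)] e(2)]) simp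
    then obtain B where B: "\<And>u. u \<in> cball ?p e \<Longrightarrow> vol_density ?c u \<le> B"
      using compact_imp_bounded[of "vol_density ?c ` cball ?p e"] unfolding bounded_iff by (force simp: abs_le_iff)
    let ?W = "dom_of ?c \<inter> coord ?c -` ball ?p e"
    have oW: "open ?W"
      by (rule continuous_open_preimage[OF chart(3)[OF c(1)] chart(1)[OF c(1)] open_ball])
    have "emeasure m ?W = (\<integral>\<^sup>+u\<in>coord ?c ` ?W. ennreal (vol_density ?c u) \<partial>lborel)"
      by (rule emeasure_vol[OF c(1)]) (use oW in auto)
    also have "\<dots> \<le> (\<integral>\<^sup>+u. ennreal B * indicator (cball ?p e) u \<partial>lborel)"
      by (intro nn_integral_mono) (auto simp: indicator_def intro!: ennreal_leI B)
    also have "\<dots> = ennreal B * emeasure lborel (cball ?p e)" by (simp add: nn_integral_cmult_indicator)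
    also have "\<dots> < \<infinity>" by (simp add: ennreal_mult_less_top emeasure_lborel_cball_finite[unfolded infinity_ennreal_def])
    finally show ?thesis using oW c(2) e(1) by (intro exI[of _ ?W]) auto
  qed
  then obtain W where W: "\<And>x. open (W x)" "\<And>x. x \<in> W x" "\<And>x. emeasure m (W x) < \<infinity>" by metis
  have "UNIV \<subseteq> (\<Union>x\<in>UNIV. W x)" using W(2) by blast
  then obtain F where F: "finite F" "UNIV \<subseteq> (\<Union>x\<in>F. W x)"
    using compactE_image[OF comp, of UNIV W] W(1) by metis
  have "emeasure m UNIV \<le> emeasure m (\<Union>x\<in>F. W x)" using W(1) F by (intro emeasure_mono) (auto simp: sets_m)
  also have "\<dots> \<le> (\<Sum>x\<in>F. emeasure m (W x))"
    by (rule emeasure_subadditive_finite) (use F W in \<open>auto simp: sets_m\<close>)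
  also have "\<dots> < \<infinity>" using W(3) F(1) by (simp add: less_top[symmetric])
  finally show "emeasure m (space m) \<noteq> \<infinity>" by simp
qed

end

section \<open>The transition kernel\<close>

locale random_riem = compact_riem M m
  for M :: "('m::metric_space, 'k::finite) riem" and m :: "'m measure" +
  fixes g :: "'m \<Rightarrow> real^'k \<Rightarrow> 'm" and \<sigma> \<beta> :: real
  assumes sigma: "\<sigma> > 0" and beta: "\<beta> > 0" and H1: "H1 M g \<sigma> \<beta>"
begin

lemma g_cont: "continuous_on (UNIV \<times> cube \<sigma>) (\<lambda>(x, t). g x t)"
  using H1 by (simp add: H1_def)

lemma g_cont_t: "continuous_on (cube \<sigma>) (g x)"
proof -
  have "continuous_on (cube \<sigma>) ((\<lambda>(x, t). g x t) \<circ> Pair x)"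
    by (rule continuous_on_compose[OF _ continuous_on_subset[OF g_cont]]) (auto intro!: continuous_intros)
  then show ?thesis by (simp add: o_def)
qed

lemma g_cont_x: "t \<in> cube \<sigma> \<Longrightarrow> continuous_on UNIV (\<lambda>x. g x t)"
proof -
  assume "t \<in> cube \<sigma>"
  then have "continuous_on UNIV ((\<lambda>(x, t). g x t) \<circ> (\<lambda>x. (x, t)))"
    by (intro continuous_on_compose continuous_on_subset[OF g_cont]) (auto intro!: continuous_intros)
  then show ?thesis by (simp add: o_def)
qed

text \<open>By joint continuity the preimage of an open set is relatively open in the product, and
  \<open>open_prod_sets\<close> places open sets of the product in the product
  sigma-algebra.\<close>

lemma g_measurable_pair:
  assumes L: "sets L = sets (borel :: 'm measure)"
  shows "(\<lambda>(x, t). g x t) \<in> L \<Otimes>\<^sub>M noise \<sigma> \<rightarrow>\<^sub>M borel"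
proof (rule borel_measurableI)
  fix U :: "'m set" assume "open U"
  have [simp]: "space L = UNIV" using sets_eq_imp_space_eq[OF L] by simp
  obtain W where W: "open W" "W \<inter> (UNIV \<times> cube \<sigma>) = (\<lambda>(x, t). g x t) -` U \<inter> (UNIV \<times> cube \<sigma>)"
    using g_cont[unfolded continuous_on_open_invariant] \<open>open U\<close> by blast
  have "(\<lambda>z. (fst z, snd z)) \<in> L \<Otimes>\<^sub>M noise \<sigma> \<rightarrow>\<^sub>M borel \<Otimes>\<^sub>M borel"
  proof (intro measurable_Pair)
    show "fst \<in> L \<Otimes>\<^sub>M noise \<sigma> \<rightarrow>\<^sub>M borel"
      by (rule measurable_compose[OF measurable_fst measurable_ident_sets[OF L]])
    have "(\<lambda>t. t) \<in> noise \<sigma> \<rightarrow>\<^sub>M borel"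
      by (auto intro!: measurableI simp: sets_noise_iff cube_props)
    then show "snd \<in> L \<Otimes>\<^sub>M noise \<sigma> \<rightarrow>\<^sub>M borel" by (rule measurable_compose[OF measurable_snd])
  qed
  from measurable_sets[OF this open_prod_sets[OF comp W(1)]]
  have "W \<inter> (UNIV \<times> cube \<sigma>) \<in> sets (L \<Otimes>\<^sub>M noise \<sigma>)"
    by (simp add: space_pair_measure vimage_def Int_def)
  then show "(\<lambda>(x, t). g x t) -` U \<inter> space (L \<Otimes>\<^sub>M noise \<sigma>) \<in> sets (L \<Otimes>\<^sub>M noise \<sigma>)"
    using W(2) by (simp add: space_pair_measure)
qed

lemma g_measurable_t: "g x \<in> noise \<sigma> \<rightarrow>\<^sub>M borel"
  unfolding measurable_cong_sets[OF sets_noise refl]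
  by (rule borel_measurable_continuous_on_restrict[OF g_cont_t])

lemma preimage_noise: "A \<in> sets borel \<Longrightarrow> {t \<in> cube \<sigma>. g x t \<in> A} \<in> sets (noise \<sigma>)"
  using measurable_sets[OF g_measurable_t[of x], of A] by (simp add: vimage_def Int_def conj_commute)

abbreviation "ibox \<equiv> box (\<chi> i. - \<sigma>) (\<chi> i. \<sigma>) :: (real^'k) set"

lemma isCont_g_t: "t \<in> ibox \<Longrightarrow> isCont (g x) t"
  using continuous_on_subset[OF g_cont_t[of x] box_in_cube] by (subst (asm) continuous_on_eq_continuous_at) auto

text \<open>The Gram matrix picks up the Jacobian of the chart change on both sides, so the square
  root of its determinant absorbs the factor by which the two coordinate determinants differ. The
  inequality comes from \<open>max 0\<close> in \<open>vol_density\<close>.\<close>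

lemma abs_det_param_chart:
  assumes c: "c \<in> atlas M" and t: "t \<in> ibox" "g x t \<in> dom_of c"
    and d: "((coord c \<circ> g x) has_derivative L) (at t)"
  shows "abs_det_param M (cube \<sigma>) (g x) t \<le> \<bar>det (matrix L)\<bar> * vol_density c (coord c (g x t))"
proof -
  let ?y = "g x t"
  let ?c = "chart_at M ?y"
  have y: "?y \<in> dom_of c \<inter> dom_of ?c" using t chart_at by auto
  note tj = trans_jac[OF c chart_at(1) y]
  let ?J = "matrix (trans_jac c ?c ?y)"
  have at: "at t within cube \<sigma> = at t"
    by (rule at_within_interior) (use t in \<open>simp add: cube_props\<close>)
  have D: "((coord ?c \<circ> g x) has_derivative trans_jac c ?c ?y \<circ> L) (at t)"
    by (rule chart_change[OF isCont_g_t[OF t(1)] c chart_at(1) y d])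
  have "frechet_derivative (coord ?c \<circ> g x) (at t within cube \<sigma>) = trans_jac c ?c ?y \<circ> L"
    unfolding at using frechet_derivative_at[OF D] by simp
  moreover have "matrix (trans_jac c ?c ?y \<circ> L) = ?J ** matrix L"
    by (intro matrix_compose has_derivative_linear[OF d] has_derivative_linear[OF tj(1)])
  moreover have "sqrt (det (gram M c ?y)) = \<bar>det ?J\<bar> * sqrt (det (gram_at M ?y))"
    unfolding tj(2) gram_at_def by (simp add: det_mul real_sqrt_mult mult_ac flip: power2_eq_square)
  ultimately have "abs_det_param M (cube \<sigma>) (g x) t = \<bar>det (matrix L)\<bar> * sqrt (det (gram M c ?y))"
    by (simp add: abs_det_param_def det_mul abs_mult mult_ac)
  also have "\<dots> \<le> \<bar>det (matrix L)\<bar> * vol_density c (coord c ?y)"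
    using t(2) by (intro mult_left_mono) (auto simp: vol_density_def chart(5)[OF c])
  finally show ?thesis .
qed

text \<open>Change of variables for \<open>coord c \<circ> g x\<close> on the interior of the cube,
  where derivatives are two-sided: the map is injective and its Jacobian with respect to the volume
  is at least c2.\<close>

lemma chart_density:
  assumes c: "c \<in> atlas M" and A: "A \<in> sets borel" "A \<subseteq> dom_of c"
    and c2: "0 \<le> c2" "\<And>t. t \<in> cube \<sigma> \<Longrightarrow> c2 \<le> abs_det_param M (cube \<sigma>) (g x) t"
  shows "ennreal c2 * emeasure lborel {t \<in> ibox. g x t \<in> A} \<le> emeasure m A"
proof -
  let ?T = "{t \<in> ibox. g x t \<in> A}"
  let ?h = "coord c \<circ> g x"
  have inj: "inj_on (g x) (cube \<sigma>)" and dif: "C1_on {t\<in>cube \<sigma>. g x t \<in> dom_of c} ?h"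
  proof -
    have "diffeo_onto_image M (cube \<sigma>) (g x)" using H1 by (simp add: H1_def)
    then show "inj_on (g x) (cube \<sigma>)" "C1_on {t\<in>cube \<sigma>. g x t \<in> dom_of c} ?h"
      using c unfolding diffeo_onto_image_def by blast+
  qed
  have ib: "ibox \<subseteq> cube \<sigma>" by (rule box_in_cube)
  have Tm: "?T \<in> sets borel"
  proof -
    have "?T = {t \<in> cube \<sigma>. g x t \<in> A} \<inter> ibox" using ib by auto
    then show ?thesis using preimage_noise[OF A(1), of x] by (simp add: sets_noise_iff)
  qed
  have fin: "emeasure lborel ?T < \<infinity>"
    using emeasure_mono[of ?T "cube \<sigma>" lborel] ib cube_props(5)[of \<sigma>, where 'k='k] cube_props(3)[of \<sigma>, where 'k='k]
    by (auto intro: le_less_trans)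
  obtain f' where f': "\<And>t. t \<in> cube \<sigma> \<Longrightarrow> g x t \<in> dom_of c \<Longrightarrow>
      (?h has_derivative blinfun_apply (f' t)) (at t within {t\<in>cube \<sigma>. g x t \<in> dom_of c})"
    using dif by (auto simp: C1_on_def)
  have der: "(?h has_derivative blinfun_apply (f' t)) (at t)" if t: "t \<in> ?T" for t
  proof -
    have "open (ibox \<inter> g x -` dom_of c)"
      by (rule continuous_open_preimage[OF continuous_on_subset[OF g_cont_t ib] open_box chart(1)[OF c]])
    then have "t \<in> interior {t\<in>cube \<sigma>. g x t \<in> dom_of c}"
      by (rule interiorI) (use t A ib in auto)
    then have at: "at t within {t\<in>cube \<sigma>. g x t \<in> dom_of c} = at t" by (rule at_within_interior)
    have "t \<in> cube \<sigma>" "g x t \<in> dom_of c" using t A ib by auto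
    then show ?thesis using f' unfolding at[symmetric] by blast
  qed
  \<comment> \<open>Injectivity expresses the image of the open box as a difference of two compact
    images, which makes it a Borel set.\<close>
  have hT: "?h ` ?T = coord c ` (A \<inter> (g x ` cube \<sigma> - g x ` (cube \<sigma> - ibox)))"
  proof -
    have "g x ` ?T = A \<inter> (g x ` cube \<sigma> - g x ` (cube \<sigma> - ibox))"
    proof (intro subset_antisym subsetI)
      fix y assume "y \<in> g x ` ?T"
      then obtain t where t: "t \<in> ibox" "g x t \<in> A" "y = g x t" by blast
      have "y \<notin> g x ` (cube \<sigma> - ibox)"
      proof
        assume "y \<in> g x ` (cube \<sigma> - ibox)"
        then obtain s where "s \<in> cube \<sigma>" "s \<notin> ibox" "g x s = g x t" using t(3) by blast
        then show False using inj_onD[OF inj, of s t] t(1) ib by blast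
      qed
      then show "y \<in> A \<inter> (g x ` cube \<sigma> - g x ` (cube \<sigma> - ibox))" using t ib by blast
    qed blast
    then show ?thesis by (simp only: image_comp[symmetric])
  qed
  have c1: "compact (g x ` cube \<sigma>)" by (rule compact_continuous_image[OF g_cont_t cube_props(1)])
  have c2': "compact (g x ` (cube \<sigma> - ibox))"
    by (rule compact_continuous_image[OF continuous_on_subset[OF g_cont_t]])
      (auto intro!: compact_diff cube_props)
  have "A \<inter> (g x ` cube \<sigma> - g x ` (cube \<sigma> - ibox)) \<in> sets borel"
    using A(1) borel_compact[OF c1] borel_compact[OF c2'] by (intro sets.Int sets.Diff)
  then have hTm: "?h ` ?T \<in> sets borel"
    unfolding hT using A by (intro coord_image_borel[OF c]) auto
  have hinj: "inj_on ?h ?T"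
  proof (rule inj_onI)
    fix s t assume st: "s \<in> ?T" "t \<in> ?T" "?h s = ?h t"
    then have "param c (coord c (g x s)) = param c (coord c (g x t))" by simp
    moreover have "g x s \<in> dom_of c" "g x t \<in> dom_of c" using st A by auto
    ultimately have "g x s = g x t" by (simp only: chart(5)[OF c])
    then show "s = t" using inj_onD[OF inj] st ib by blast
  qed
  have "ennreal c2 * emeasure lborel ?T \<le> (\<integral>\<^sup>+u\<in>?h ` ?T. ennreal (vol_density c u) \<partial>lborel)"
  proof (rule change_of_variables_ineq[OF Tm fin hTm _ hinj vol_density_measurable[OF c] _ c2(1)])
    show "(?h has_derivative blinfun_apply (f' t)) (at t within ?T)" if "t \<in> ?T" for t
      using der[OF that] by (rule has_derivative_at_withinI)
    show "0 \<le> vol_density c u" for u by (simp add: vol_density_def)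
    show "c2 \<le> \<bar>det (matrix (blinfun_apply (f' t)))\<bar> * vol_density c (?h t)" if t: "t \<in> ?T" for t
      using order_trans[OF c2(2)[of t] abs_det_param_chart[OF c _ _ der[OF t]]] t A ib by auto
  qed
  also have "\<dots> \<le> (\<integral>\<^sup>+u\<in>coord c ` A. ennreal (vol_density c u) \<partial>lborel)"
    by (intro nn_integral_mono) (auto simp: indicator_def)
  also have "\<dots> = emeasure m A" by (rule emeasure_vol[OF c A, symmetric])
  finally show ?thesis .
qed

text \<open>The bounds of \<open>chart_density\<close> are summed over a finite atlas; the boundary
  of the cube is a null set. This gives \<open>card F\<close> times 1/(c2 * v), where v is the
  Lebesgue measure of the cube that normalises the noise.\<close>

lemma noise_density:
  "\<exists>D\<ge>0. \<forall>x. \<forall>A\<in>sets borel. emeasure (noise \<sigma>) {t \<in> cube \<sigma>. g x t \<in> A} \<le> ennreal D * emeasure m A"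
proof -
  obtain c2 where c2: "c2 > 0" "\<And>x t. t \<in> cube \<sigma> \<Longrightarrow> c2 \<le> abs_det_param M (cube \<sigma>) (g x) t"
  proof -
    have "\<exists>c\<^sub>1>0. \<exists>c\<^sub>2>0. \<forall>x. \<forall>t\<in>cube \<sigma>.
        c\<^sub>1 \<ge> abs_det_param M (cube \<sigma>) (g x) t \<and> abs_det_param M (cube \<sigma>) (g x) t \<ge> c\<^sub>2"
      using H1 by (simp add: H1_def)
    then show thesis using that by blast
  qed
  obtain F where F: "finite F" "F \<subseteq> atlas M" "(\<Union>c\<in>F. dom_of c) = UNIV" using finite_atlas by blast
  obtain v where v: "0 < v" "emeasure lborel (cube \<sigma> :: (real^'k) set) = ennreal v"
    using cube_box_pos(1)[OF sigma, where 'k='k] cube_props(5)[of \<sigma>, where 'k='k]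
    by (cases "emeasure lborel (cube \<sigma> :: (real^'k) set)") auto
  define D where "D = card F * (1 / (c2 * v))"
  have D: "0 \<le> D" using c2 v by (simp add: D_def)
  have one: "emeasure (noise \<sigma>) {t \<in> cube \<sigma>. g x t \<in> A} \<le> ennreal (1 / (c2 * v)) * emeasure m A"
    if c: "c \<in> atlas M" and A: "A \<in> sets borel" "A \<subseteq> dom_of c" for c A x
  proof -
    let ?S = "{t \<in> cube \<sigma>. g x t \<in> A}" and ?T = "{t \<in> ibox. g x t \<in> A}"
    have Sm: "?S \<in> sets borel" using preimage_noise[OF A(1), of x] by (simp add: sets_noise_iff)
    have Tm: "?T \<in> sets borel"
    proof -
      have "?T = ?S \<inter> ibox" using box_in_cube[of \<sigma>, where 'k='k] by auto
      then show ?thesis using Sm by simp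
    qed
    have "emeasure lborel ?S \<le> emeasure lborel (?T \<union> (cube \<sigma> - ibox))"
      using Tm cube_props(3)[of \<sigma>, where 'k='k] by (intro emeasure_mono) auto
    also have "\<dots> \<le> emeasure lborel ?T + emeasure lborel (cube \<sigma> - ibox)"
      using Tm cube_props(3)[of \<sigma>, where 'k='k] by (intro emeasure_subadditive) auto
    finally have ST: "emeasure lborel ?S \<le> emeasure lborel ?T" using cube_box_pos(2)[OF sigma, where 'k='k] by simp
    have "emeasure (noise \<sigma>) ?S = emeasure lborel ?S / ennreal v"
      using emeasure_noise[OF preimage_noise[OF A(1)]] v by simp
    also have "\<dots> \<le> emeasure lborel ?T / ennreal v" using ST by (rule divide_right_mono_ennreal)
    also have "\<dots> = ennreal (1 / (c2 * v)) * (ennreal c2 * emeasure lborel ?T)"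
    proof -
      have "ennreal (1 / (c2 * v)) * ennreal c2 = ennreal (inverse v)"
        using c2 v by (simp add: ennreal_mult[symmetric] field_simps)
      then have "ennreal (1 / (c2 * v)) * (ennreal c2 * e) = ennreal (inverse v) * e" for e
        by (simp add: mult.assoc[symmetric])
      then show ?thesis using v unfolding divide_ennreal_def v(2) inverse_ennreal[OF v(1)]
        by (subst mult.commute) (rule sym)
    qed
    also have "\<dots> \<le> ennreal (1 / (c2 * v)) * emeasure m A"
      using chart_density[OF c A, of c2 x] c2 by (intro mult_left_mono) auto
    finally show ?thesis .
  qed
  have "emeasure (noise \<sigma>) {t \<in> cube \<sigma>. g x t \<in> A} \<le> ennreal D * emeasure m A" if A: "A \<in> sets borel" for x A
  proof -
    let ?A = "\<lambda>c. A \<inter> dom_of c"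
    have Am: "?A c \<in> sets borel" if "c \<in> F" for c
    proof -
      have "open (dom_of c)" using chart(1) that F by blast
      then show ?thesis using A by simp
    qed
    have "emeasure (noise \<sigma>) {t \<in> cube \<sigma>. g x t \<in> A} \<le> emeasure (noise \<sigma>) (\<Union>c\<in>F. {t \<in> cube \<sigma>. g x t \<in> ?A c})"
      using F preimage_noise[OF Am] by (intro emeasure_mono sets.finite_UN) auto
    also have "\<dots> \<le> (\<Sum>c\<in>F. emeasure (noise \<sigma>) {t \<in> cube \<sigma>. g x t \<in> ?A c})"
      using F preimage_noise[OF Am] by (intro emeasure_subadditive_finite) auto
    also have "\<dots> \<le> (\<Sum>c\<in>F. ennreal (1 / (c2 * v)) * emeasure m A)"
    proof (rule sum_mono)
      fix c assume c: "c \<in> F"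
      have "emeasure (noise \<sigma>) {t \<in> cube \<sigma>. g x t \<in> ?A c} \<le> ennreal (1 / (c2 * v)) * emeasure m (?A c)"
        by (rule one[of c]) (use c F Am in auto)
      also have "\<dots> \<le> ennreal (1 / (c2 * v)) * emeasure m A"
        using A by (intro mult_left_mono emeasure_mono) (auto simp: sets_m)
      finally show "emeasure (noise \<sigma>) {t \<in> cube \<sigma>. g x t \<in> ?A c} \<le> ennreal (1 / (c2 * v)) * emeasure m A" .
    qed
    also have "\<dots> = ennreal D * emeasure m A"
      using c2 v by (subst D_def, subst ennreal_mult) (auto simp: mult.assoc ennreal_of_nat_eq_real_of_nat)
    finally show ?thesis .
  qed
  then show ?thesis using D by blast
qed

end

section \<open>The chain restricted to the support of the stationary measure\<close>

locale ergodic_riem = random_riem M m g \<sigma> \<beta>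
  for M :: "('m::metric_space, 'k::finite) riem" and m :: "'m measure"
    and g :: "'m \<Rightarrow> real^'k \<Rightarrow> 'm" and \<sigma> \<beta> :: real +
  fixes \<mu> :: "'m measure"
  assumes ergodic: "ergodic_stationary g \<sigma> \<mu>"
begin

sublocale N: prob_space "noise \<sigma> :: (real^'k) measure" by (rule prob_space_noise[OF sigma])

lemma mu: "prob_space \<mu>" "sets \<mu> = sets borel" "space \<mu> = UNIV"
  using ergodic sets_eq_imp_space_eq[of \<mu> borel] by (auto simp: ergodic_stationary_def stationary_def)

abbreviation "K \<equiv> msupport \<mu>"

lemma K_borel[measurable]: "K \<in> sets borel" using msupport_closed by (rule borel_closed)

lemma K_full: "- K \<in> null_sets \<mu>" by (rule msupport_null[OF comp mu(2)])

lemma emeasure_transition: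
  assumes "A \<in> sets borel"
  shows "emeasure (transition g \<sigma> x) A = emeasure (noise \<sigma>) {t \<in> cube \<sigma>. g x t \<in> A}"
  unfolding transition_def using assms g_measurable_t
  by (subst emeasure_distr) (auto intro!: arg_cong[where f = "emeasure (noise \<sigma>)"])

text \<open>Continuity of \<open>g\<close> in x gives weak continuity of the kernel by dominated
  convergence over the noise; the uniform density then upgrades it to all Borel sets.\<close>

lemma transition_continuous:
  assumes A: "A \<in> sets borel" shows "continuous_on UNIV (\<lambda>x. measure (transition g \<sigma> x) A)"
proof -
  obtain D where D: "D \<ge> 0" "\<And>x A. A\<in>sets borel \<Longrightarrow> emeasure (noise \<sigma>) {t \<in> cube \<sigma>. g x t \<in> A} \<le> ennreal D * emeasure m A"
    using noise_density by blast
  interpret m: finite_measure m by (rule finite_volume)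
  show ?thesis
  proof (rule uniformly_dominated_strong_Feller[OF finite_volume sets_m, where D = D])
    show P: "prob_space (transition g \<sigma> x)" for x
      unfolding transition_def by (rule N.prob_space_distr[OF g_measurable_t])
    show "sets (transition g \<sigma> x) = sets borel" for x by (simp add: transition_def)
    show "measure (transition g \<sigma> x) A \<le> D * measure m A" if "A \<in> sets borel" for x A
    proof -
      interpret P: prob_space "transition g \<sigma> x" by (rule P)
      have "ennreal (measure (transition g \<sigma> x) A) \<le> ennreal (D * measure m A)"
        using D(2)[OF that, of x] D(1) emeasure_transition[OF that, of x]
        by (simp add: P.emeasure_eq_measure m.emeasure_eq_measure ennreal_mult[symmetric])
      then show ?thesis using D(1) by (simp add: ennreal_le_iff)
    qed
    fix f :: "'m \<Rightarrow> real" assume f: "continuous_on UNIV f" and f01: "\<And>y. 0 \<le> f y \<and> f y \<le> 1"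
    have fm[measurable]: "f \<in> borel_measurable borel" by (rule borel_measurable_continuous_onI[OF f])
    have eq: "(\<integral>y. f y \<partial>transition g \<sigma> x) = (\<integral>t. f (g x t) \<partial>noise \<sigma>)" for x
      unfolding transition_def by (rule integral_distr[OF g_measurable_t fm])
    have gm[measurable]: "g x \<in> noise \<sigma> \<rightarrow>\<^sub>M borel" for x by (rule g_measurable_t)
    have fc: "continuous_on UNIV (\<lambda>x. f (g x t))" if "t \<in> cube \<sigma>" for t
      using continuous_on_compose[OF g_cont_x[OF that] continuous_on_subset[OF f]] by (simp add: o_def)
    show "continuous_on UNIV (\<lambda>x. \<integral>y. f y \<partial>transition g \<sigma> x)"
      unfolding eq continuous_on_sequentially
    proof (intro allI ballI impI)
      fix x :: "nat \<Rightarrow> 'm" and a assume x: "(\<forall>n. x n \<in> UNIV) \<and> x \<longlonglongrightarrow> a"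
      show "((\<lambda>x. \<integral>t. f (g x t) \<partial>noise \<sigma>) \<circ> x) \<longlonglongrightarrow> (\<integral>t. f (g a t) \<partial>noise \<sigma>)"
        unfolding o_def
      proof (rule integral_dominated_convergence[where w = "\<lambda>_. 1"])
        show "AE t in noise \<sigma>. (\<lambda>n. f (g (x n) t)) \<longlonglongrightarrow> f (g a t)"
        proof (rule AE_I2)
          fix t :: "real^'k" assume "t \<in> space (noise \<sigma>)"
          then have "t \<in> cube \<sigma>" by simp
          from fc[OF this] show "(\<lambda>n. f (g (x n) t)) \<longlonglongrightarrow> f (g a t)"
            using x by (simp add: continuous_on_sequentially o_def)
        qed
      qed (use f01 in auto)
    qed
  qed (rule A)
qed

text \<open>The probability of hitting A is a continuous function of x, and by stationarity it
  vanishes \<mu>-almost everywhere. A continuous function that vanishes almost everywhere vanishes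
  on the support.\<close>

lemma noise_step_null:
  assumes A: "A \<in> null_sets \<mu>" and x: "x \<in> K"
  shows "emeasure (noise \<sigma>) {t \<in> cube \<sigma>. g x t \<in> A} = 0"
proof -
  have Ab: "A \<in> sets borel" using A mu by auto
  interpret P: prob_space "transition g \<sigma> y" for y
    unfolding transition_def by (rule N.prob_space_distr[OF g_measurable_t])
  let ?p = "\<lambda>x. measure (transition g \<sigma> x) A"
  have c: "continuous_on UNIV ?p" by (rule transition_continuous[OF Ab])
  have pm: "(\<lambda>x. emeasure (transition g \<sigma> x) A) \<in> borel_measurable \<mu>"
  proof -
    have "(\<lambda>x. ennreal (?p x)) \<in> borel_measurable borel"
      using borel_measurable_continuous_onI[OF c] by measurable
    then show ?thesis by (simp add: P.emeasure_eq_measure measurable_cong_sets[OF mu(2) refl])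
  qed
  have "(\<integral>\<^sup>+ x. emeasure (transition g \<sigma> x) A \<partial>\<mu>) = 0"
    using ergodic A Ab unfolding ergodic_stationary_def stationary_def by auto
  then have ae: "AE x in \<mu>. ?p x = 0"
    using nn_integral_0_iff_AE[OF pm] by (simp add: P.emeasure_eq_measure)
  have "?p x = 0"
  proof (rule ccontr)
    assume "?p x \<noteq> 0"
    then have xp: "x \<in> ?p -` (- {0})" by simp
    have op: "open (?p -` (- {0}))" using c by (intro open_vimage) auto
    have "\<forall>U. open U \<and> x \<in> U \<longrightarrow> 0 < emeasure \<mu> U" using x unfolding msupport_def mem_Collect_eq by assumption
    from this[rule_format, OF conjI[OF op xp]]
    have "0 < emeasure \<mu> (?p -` (- {0}))" .
    moreover have "?p -` (- {0}) \<in> null_sets \<mu>"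
      using ae op mu by (subst (asm) AE_iff_null) (auto simp: vimage_def Collect_neg_eq[symmetric])
    ultimately show False by auto
  qed
  then show ?thesis using emeasure_transition[OF Ab, of x] by (simp add: P.emeasure_eq_measure)
qed

text \<open>If one noise value led out of the closed set \<open>K\<close>, so would all nearby ones,
  which have positive probability; but the complement of \<open>K\<close> is \<mu>-null and is hit
  with probability 0.\<close>

lemma K_invariant:
  assumes x: "x \<in> K" and t: "t \<in> cube \<sigma>" shows "g x t \<in> K"
proof (rule ccontr)
  assume *: "g x t \<notin> K"
  have "open (- K)" using msupport_closed[of \<mu>] by auto
  then obtain U where U: "open U" "U \<inter> cube \<sigma> = g x -` (- K) \<inter> cube \<sigma>"
    using g_cont_t[of x, unfolded continuous_on_open_invariant] by blast
  have "0 < emeasure (noise \<sigma>) (U \<inter> cube \<sigma>)"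
    by (rule noise_open_pos[OF sigma U(1) _ t]) (use U * t in blast)
  also have "U \<inter> cube \<sigma> = {t \<in> cube \<sigma>. g x t \<in> - K}" using U by auto
  finally show False using noise_step_null[OF K_full x] by simp
qed

lemma space_mstar[simp]: "space (mstar m \<mu>) = K"
  by (simp add: mstar_def space_restrict_space)

lemma sets_mstar: "A \<in> sets (mstar m \<mu>) \<longleftrightarrow> A \<subseteq> K \<and> A \<in> sets borel"
  unfolding mstar_def by (subst sets_restrict_space_iff) (auto simp: sets_m)

lemma emeasure_mstar: "A \<in> sets (mstar m \<mu>) \<Longrightarrow> emeasure (mstar m \<mu>) A = emeasure m A"
  unfolding mstar_def by (rule emeasure_restrict_space) (use sets_mstar[of A] in \<open>auto simp: sets_m mstar_def\<close>)

lemma finite_mstar: "finite_measure (mstar m \<mu>)"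
  unfolding mstar_def by (rule finite_measure_restrict_space[OF finite_volume]) (simp add: sets_m)

definition "mu' = restrict_space \<mu> K"

lemma sets_mu': "sets mu' = sets (mstar m \<mu>)"
  by (simp add: mu'_def mstar_def sets_restrict_space sets_m mu)

lemma emeasure_mu': "A \<in> sets (mstar m \<mu>) \<Longrightarrow> emeasure mu' A = emeasure \<mu> A"
  unfolding mu'_def by (rule emeasure_restrict_space) (use sets_mstar[of A] in \<open>auto simp: mu\<close>)

lemma g_measurable_K: "(\<lambda>(x, t). g x t) \<in> mstar m \<mu> \<Otimes>\<^sub>M noise \<sigma> \<rightarrow>\<^sub>M mstar m \<mu>"
proof -
  have "(\<lambda>z. z) \<in> mstar m \<mu> \<rightarrow>\<^sub>M m" unfolding mstar_def by (rule measurable_restrict_space1) simp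
  then have "(\<lambda>z. (fst z, snd z)) \<in> mstar m \<mu> \<Otimes>\<^sub>M noise \<sigma> \<rightarrow>\<^sub>M m \<Otimes>\<^sub>M noise \<sigma>"
    by (intro measurable_Pair measurable_snd measurable_compose[OF measurable_fst])
  from measurable_compose[OF this g_measurable_pair[OF sets_m]]
  have "(\<lambda>(x, t). g x t) \<in> mstar m \<mu> \<Otimes>\<^sub>M noise \<sigma> \<rightarrow>\<^sub>M borel" by (simp add: case_prod_beta)
  then have "(\<lambda>(x, t). g x t) \<in> mstar m \<mu> \<Otimes>\<^sub>M noise \<sigma> \<rightarrow>\<^sub>M m" by (simp add: measurable_cong_sets[OF refl sets_m])
  then show ?thesis
    unfolding mstar_def by (rule measurable_restrict_space2[rotated])
      (auto simp: space_pair_measure space_restrict_space intro!: K_invariant)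
qed

text \<open>Since \<open>K\<close> has full \<mu>-measure, stationarity and ergodicity pass to
  \<open>mu'\<close>; density and hitting of null sets were proved pointwise above.\<close>

lemma exists_random_map: "\<exists>D. random_map (mstar m \<mu>) (noise \<sigma>) g D mu'"
proof -
  obtain D where D: "D \<ge> 0" "\<And>x A. A\<in>sets borel \<Longrightarrow> emeasure (noise \<sigma>) {t \<in> cube \<sigma>. g x t \<in> A} \<le> ennreal D * emeasure m A"
    using noise_density by blast
  interpret mu: prob_space \<mu> by (rule mu)
  have KC: "AE x in \<mu>. x \<in> K"
    by (rule AE_I'[OF K_full]) (auto simp: mu)
  have mK: "emeasure \<mu> K = 1"
    using mu.emeasure_eq_1_AE[OF _ KC] mu by simp
  have "random_map (mstar m \<mu>) (noise \<sigma>) g D mu'"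
  proof (intro random_map.intro random_map_axioms.intro finite_mstar N.prob_space_axioms g_measurable_K D(1) sets_mu')
    show "prob_space mu'"
      by (rule prob_spaceI) (use mK emeasure_mu'[of K] sets_mstar[of K] in \<open>auto simp: mu'_def space_restrict_space mu\<close>)
    show "emeasure (noise \<sigma>) {t \<in> space (noise \<sigma>). g x t \<in> A} \<le> ennreal D * emeasure (mstar m \<mu>) A"
      if "x \<in> space (mstar m \<mu>)" "A \<in> sets (mstar m \<mu>)" for x A
      using D(2)[of A x] that emeasure_mstar[OF that(2)] by (simp add: sets_mstar)
    show "emeasure mu' A = (\<integral>\<^sup>+ x. emeasure (noise \<sigma>) {t \<in> space (noise \<sigma>). g x t \<in> A} \<partial>mu')"
      if A: "A \<in> sets (mstar m \<mu>)" for A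
    proof -
      have Ab: "A \<in> sets borel" using A by (simp add: sets_mstar)
      have "emeasure mu' A = (\<integral>\<^sup>+ x. emeasure (transition g \<sigma> x) A \<partial>\<mu>)"
        using ergodic Ab emeasure_mu'[OF A] by (simp add: ergodic_stationary_def stationary_def)
      also have "\<dots> = (\<integral>\<^sup>+ x\<in>K. emeasure (transition g \<sigma> x) A \<partial>\<mu>)"
        by (rule nn_integral_cong_AE) (use KC in eventually_elim, simp)
      also have "\<dots> = (\<integral>\<^sup>+ x. emeasure (transition g \<sigma> x) A \<partial>mu')"
        unfolding mu'_def by (rule nn_integral_restrict_space[symmetric]) (simp add: mu)
      also have "\<dots> = (\<integral>\<^sup>+ x. emeasure (noise \<sigma>) {t \<in> space (noise \<sigma>). g x t \<in> A} \<partial>mu')"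
        by (simp add: emeasure_transition[OF Ab])
      finally show ?thesis .
    qed
    show "emeasure mu' A = 0 \<or> emeasure mu' A = 1"
      if A: "A \<in> sets (mstar m \<mu>)" and ae: "AE x in mu'. emeasure (noise \<sigma>) {t \<in> space (noise \<sigma>). g x t \<in> A} = indicator A x" for A
    proof -
      have Ab: "A \<in> sets borel" using A by (simp add: sets_mstar)
      have "AE x in \<mu>. x \<in> K \<longrightarrow> emeasure (transition g \<sigma> x) A = indicator A x"
        using ae unfolding mu'_def by (subst (asm) AE_restrict_space_iff) (auto simp: mu emeasure_transition[OF Ab])
      with KC have "AE x in \<mu>. emeasure (transition g \<sigma> x) A = indicator A x" by eventually_elim simp
      then show ?thesis using ergodic Ab emeasure_mu'[OF A] by (auto simp: ergodic_stationary_def)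
    qed
    show "emeasure (noise \<sigma>) {t \<in> space (noise \<sigma>). g x t \<in> A} = 0" if "A \<in> null_sets mu'" "x \<in> space (mstar m \<mu>)" for A x
    proof -
      have "A \<in> sets (mstar m \<mu>)" using that sets_mu' by auto
      then have "A \<in> null_sets \<mu>" using that emeasure_mu'[of A] by (auto simp: null_sets_def sets_mstar mu)
      then show ?thesis using noise_step_null[of A x] that by simp
    qed
  qed
  then show ?thesis by blast
qed

end

section \<open>Measurability near the critical set\<close>

text \<open>Each x is replaced by the first point of a dense sequence at distance less than 1/(n+1).
  The approximant takes countably many values in x, so it is jointly measurable by measurability in
  t alone, and continuity at the points of Q gives convergence. Off Q the default value 0 is
  prescribed.\<close>

lemma Caratheodory_measurable:
  fixes F :: "'m::metric_space \<Rightarrow> 'e \<Rightarrow> real"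
  assumes comp: "compact (UNIV :: 'm set)" and L: "sets L = sets (borel :: 'm measure)"
    and Q_m: "{z \<in> space (L \<Otimes>\<^sub>M N). Q (fst z) (snd z)} \<in> sets (L \<Otimes>\<^sub>M N)"
    and slice: "\<And>x. (\<lambda>t. if Q x t then F x t else 0) \<in> borel_measurable N"
    and cont: "\<And>x t. t \<in> space N \<Longrightarrow> Q x t \<Longrightarrow> isCont (\<lambda>y. if Q y t then F y t else 0) x"
  shows "(\<lambda>z. if Q (fst z) (snd z) then F (fst z) (snd z) else 0) \<in> borel_measurable (L \<Otimes>\<^sub>M N)"
proof -
  let ?G = "\<lambda>x t. if Q x t then F x t else 0"
  have [measurable_cong]: "sets L = sets borel" by (rule L)
  obtain D :: "'m set" where D: "countable D" "\<And>x e. e > 0 \<Longrightarrow> \<exists>d\<in>D. dist x d < e"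
    using compact_countable_basis(1)[OF comp] by blast
  have "D \<noteq> {}" using D(2)[of 1] by auto
  then obtain d :: "nat \<Rightarrow> 'm" where d: "D = range d" using D(1) by (metis range_from_nat_into)
  define idx where "idx n x = (LEAST i. dist x (d i) < 1 / Suc n)" for n x
  have idx: "dist x (d (idx n x)) < 1 / Suc n" for n x
  proof -
    have "\<exists>i. dist x (d i) < 1 / Suc n" using D(2)[of "1 / Suc n" x] d by auto
    then show ?thesis unfolding idx_def by (rule LeastI_ex)
  qed
  have idxm[measurable]: "idx n \<in> L \<rightarrow>\<^sub>M count_space UNIV" for n
  proof -
    have "(\<lambda>x. dist x (d i)) \<in> borel_measurable L" for i
      unfolding measurable_cong_sets[OF L refl] by (intro borel_measurable_continuous_onI continuous_intros)
    note [measurable] = this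
    show ?thesis unfolding idx_def by measurable
  qed
  have Gm[measurable]: "(\<lambda>z. ?G (d (idx n (fst z))) (snd z)) \<in> borel_measurable (L \<Otimes>\<^sub>M N)" for n
    by (rule measurable_compose_countable[where g = "\<lambda>z. idx n (fst z)" and f = "\<lambda>i z. ?G (d i) (snd z)"])
      (auto intro!: measurable_compose[OF measurable_snd slice])
  have "(\<lambda>z. if Q (fst z) (snd z) then lim (\<lambda>n. ?G (d (idx n (fst z))) (snd z)) else 0) \<in> borel_measurable (L \<Otimes>\<^sub>M N)"
    by (rule measurable_If[OF borel_measurable_lim_metric[OF Gm] _ Q_m]) simp
  also have "?this \<longleftrightarrow> ?thesis"
  proof (rule measurable_cong)
    fix z assume z: "z \<in> space (L \<Otimes>\<^sub>M N)"
    show "(if Q (fst z) (snd z) then lim (\<lambda>n. ?G (d (idx n (fst z))) (snd z)) else 0) = ?G (fst z) (snd z)"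
    proof (cases "Q (fst z) (snd z)")
      case True
      have "(\<lambda>n. d (idx n (fst z))) \<longlonglongrightarrow> fst z"
      proof (rule metric_LIMSEQ_I)
        fix r :: real assume "0 < r"
        then obtain n where n: "1 / real (Suc n) < r" using nat_approx_posE by auto
        have "dist (d (idx k (fst z))) (fst z) < r" if "k \<ge> n" for k
        proof -
          have "1 / real (Suc k) \<le> 1 / Suc n" using that by (simp add: field_simps)
          then show ?thesis using idx[of "fst z" k] n by (simp add: dist_commute)
        qed
        then show "\<exists>no. \<forall>k\<ge>no. dist (d (idx k (fst z))) (fst z) < r" by blast
      qed
      moreover have "isCont (\<lambda>y. ?G y (snd z)) (fst z)"
        by (rule cont) (use z True in \<open>auto simp: space_pair_measure\<close>)
      ultimately have "(\<lambda>n. ?G (d (idx n (fst z))) (snd z)) \<longlonglongrightarrow> ?G (fst z) (snd z)"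
        by (rule isCont_tendsto_compose[rotated])
      then show ?thesis using True by (simp add: limI)
    qed simp
  qed
  finally show ?thesis .
qed

text \<open>Writes a derivative as a limit along a sequence, so that it depends measurably on
  parameters.\<close>

lemma directional_derivative_seq:
  fixes F :: "'a::real_normed_vector \<Rightarrow> 'b::real_normed_vector"
  assumes "(F has_derivative L) (at p)"
  shows "(\<lambda>n. real (Suc n) *\<^sub>R (F (p + (1 / real (Suc n)) *\<^sub>R v) - F p)) \<longlonglongrightarrow> L v"
proof (cases "v = 0")
  case True
  then show ?thesis using has_derivative_bounded_linear[OF assms] by (simp add: linear_simps)
next
  case False
  let ?h = "\<lambda>n. (1 / real (Suc n)) *\<^sub>R v"
  have bl: "bounded_linear L" and lim: "(\<lambda>h. norm (F (p + h) - F p - L h) / norm h) \<midarrow>0\<rightarrow> 0"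
    using assms by (auto simp: has_derivative_at)
  have "(\<lambda>n. 1 / real (Suc n)) \<longlonglongrightarrow> 0" by (rule LIMSEQ_Suc[OF lim_1_over_n])
  then have h0: "?h \<longlonglongrightarrow> 0" using tendsto_scaleR[of _ 0 sequentially "\<lambda>_. v" v] by simp
  have "(\<lambda>n. norm (F (p + ?h n) - F p - L (?h n)) / norm (?h n)) \<longlonglongrightarrow> 0"
    by (rule filterlim_compose[OF lim]) (use h0 False in \<open>auto simp: filterlim_at\<close>)
  then have "(\<lambda>n. norm v * (norm (F (p + ?h n) - F p - L (?h n)) / norm (?h n))) \<longlonglongrightarrow> 0"
    by (rule tendsto_mult_right_zero)
  moreover have "norm v * (norm (F (p + ?h n) - F p - L (?h n)) / norm (?h n))
      = norm (real (Suc n) *\<^sub>R (F (p + ?h n) - F p) - L v)" for n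
  proof -
    have e: "real (Suc n) *\<^sub>R (F (p + ?h n) - F p) - L v = real (Suc n) *\<^sub>R (F (p + ?h n) - F p - L (?h n))"
      using bl by (simp add: linear_simps scaleR_diff_right del: of_nat_Suc)
    have "norm (?h n) = norm v / real (Suc n)" by (simp del: of_nat_Suc)
    then show ?thesis using False unfolding e by (simp del: of_nat_Suc)
  qed
  ultimately have "(\<lambda>n. norm (real (Suc n) *\<^sub>R (F (p + ?h n) - F p) - L v)) \<longlonglongrightarrow> 0" by simp
  then show ?thesis by (rule LIM_zero_cancel[OF tendsto_norm_zero_cancel])
qed

section \<open>Distance to the critical set\<close>

locale singular_riem = ergodic_riem M m g \<sigma> \<beta> \<mu>
  for M :: "('m::metric_space, 'k::finite) riem" and m :: "'m measure"
    and g :: "'m \<Rightarrow> real^'k \<Rightarrow> 'm" and \<sigma> \<beta> :: real and \<mu> :: "'m measure" +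
  assumes H2: "H2 M m g \<sigma> \<beta>"
begin

abbreviation "crit \<equiv> critical_set M g"
abbreviation "cd x t \<equiv> cdist x (crit t)"

lemma crit_closed: "t \<in> cube \<sigma> \<Longrightarrow> closed (crit t)" "t \<in> cube \<sigma> \<Longrightarrow> crit t \<in> null_sets m"
  using H2 by (auto simp: H2_def)

lemma crit_usc: "t \<in> cube \<sigma> \<Longrightarrow> \<epsilon> > 0 \<Longrightarrow>
    \<exists>\<delta>>0. \<forall>s\<in>cube \<sigma>. dist s t < \<delta> \<longrightarrow> crit s \<subseteq> {x. \<exists>y\<in>crit t. dist x y < \<epsilon>}"
  using H2 unfolding H2_def by blast

lemma cd_nonneg: "0 \<le> cd x t" by (simp add: cdist_def infdist_nonneg)

lemma cd_pos_iff: "t \<in> cube \<sigma> \<Longrightarrow> 0 < cd x t \<longleftrightarrow> x \<notin> crit t"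
  using infdist_pos_not_in_closed[OF crit_closed(1)] by (auto simp: cdist_def)

lemma cd_continuous: "continuous_on UNIV (\<lambda>x. cd x t)"
  unfolding cdist_def by (cases "crit t = {}") (auto intro!: continuous_intros)

text \<open>Upper semi-continuity of the critical sets makes the distance lower semi-continuous
  where they are nonempty. The value 1 for an empty set breaks this, so the parameters with empty
  critical set, a relatively open set \<open>?E\<close>, are treated apart. \<open>?U\<close> alone
  need not be open, since nearby critical sets may be empty, but its union with \<open>?E\<close>
  is.\<close>

lemma cd_slice: "(\<lambda>t. cd x t) \<in> borel_measurable (noise \<sigma>)"
proof (rule borel_measurable_iff_greater[THEN iffD2], intro allI)
  fix a
  let ?E = "{t \<in> cube \<sigma>. crit t = {}}"
  have E: "?E \<in> sets (noise \<sigma>)"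
  proof (rule rel_open_noise)
    fix t assume "t \<in> ?E"
    then show "\<exists>\<delta>>0. \<forall>s\<in>cube \<sigma>. dist s t < \<delta> \<longrightarrow> s \<in> ?E"
      using crit_usc[of t 1] by auto
  qed auto
  let ?U = "{t \<in> cube \<sigma>. crit t \<noteq> {} \<and> a < infdist x (crit t)}"
  have UE: "?U \<union> ?E \<in> sets (noise \<sigma>)"
  proof (rule rel_open_noise)
    fix t assume t: "t \<in> ?U \<union> ?E"
    show "\<exists>\<delta>>0. \<forall>s\<in>cube \<sigma>. dist s t < \<delta> \<longrightarrow> s \<in> ?U \<union> ?E"
    proof (cases "t \<in> ?E")
      case True
      then show ?thesis using crit_usc[of t 1] by auto
    next
      case False
      then have t': "t \<in> cube \<sigma>" "a < infdist x (crit t)" using t by auto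
      define e where "e = (infdist x (crit t) - a) / 2"
      have e: "e > 0" "a < infdist x (crit t) - e" using t' by (auto simp: e_def field_simps)
      obtain \<delta> where \<delta>: "\<delta> > 0" "\<And>s. s \<in> cube \<sigma> \<Longrightarrow> dist s t < \<delta> \<Longrightarrow> crit s \<subseteq> {x. \<exists>y\<in>crit t. dist x y < e}"
        using crit_usc[OF t'(1) e(1)] by blast
      have "s \<in> ?U" if s: "s \<in> cube \<sigma>" "dist s t < \<delta>" "crit s \<noteq> {}" for s
      proof -
        have "infdist x (crit t) - e \<le> infdist x (crit s)"
          unfolding infdist_notempty[OF s(3)]
        proof (rule cINF_greatest[OF s(3)])
          fix z assume "z \<in> crit s"
          then obtain y where y: "y \<in> crit t" "dist z y < e" using \<delta>(2)[OF s(1,2)] by blast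
          have "infdist x (crit t) \<le> dist x y" by (rule infdist_le[OF y(1)])
          then show "infdist x (crit t) - e \<le> dist x z" using dist_triangle[of x y z] y(2) by linarith
        qed
        then show ?thesis using s e by simp
      qed
      then show ?thesis using \<delta>(1) by blast
    qed
  qed auto
  have "{t \<in> space (noise \<sigma>). a < cd x t} = ((?U \<union> ?E) - ?E) \<union> (if a < 1 then ?E else {})"
    by (auto simp: cdist_def)
  also have "\<dots> \<in> sets (noise \<sigma>)" using UE E by auto
  finally show "{t \<in> space (noise \<sigma>). a < cd x t} \<in> sets (noise \<sigma>)" .
qed

lemma cd_measurable:
  assumes L: "sets L = sets (borel :: 'm measure)"
  shows "(\<lambda>z. cd (fst z) (snd z)) \<in> borel_measurable (L \<Otimes>\<^sub>M noise \<sigma>)"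
  using Caratheodory_measurable[OF comp L, where N = "noise \<sigma>" and Q = "\<lambda>_ _. True" and F = cd] cd_slice cd_continuous
  by (simp add: continuous_on_eq_continuous_at)

section \<open>Measurability of the derivative in the noise variable\<close>

definition deriv_norm :: "'m \<Rightarrow> real^'k \<Rightarrow> real^'k \<Rightarrow> real" where
  "deriv_norm x v t = tnorm M (g x t) (mderiv M (\<lambda>y. g y t) x v)"

lemma off_crit:
  assumes "x \<notin> crit t"
  shows "isCont (\<lambda>y. g y t) x" "bij (mderiv M (\<lambda>y. g y t) x)"
    "((coord (chart_at M (g x t)) \<circ> ((\<lambda>y. g y t) \<circ> param (chart_at M x))) has_derivative mderiv M (\<lambda>y. g y t) x)
      (at (coord (chart_at M x) x))"
    "linear (mderiv M (\<lambda>y. g y t) x)"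
proof -
  show "isCont (\<lambda>y. g y t) x" "bij (mderiv M (\<lambda>y. g y t) x)" using assms by (auto simp: critical_set_def mdifferentiable_def)
  have "local_rep M (\<lambda>y. g y t) x differentiable (at (coord (chart_at M x) x))"
    using assms by (auto simp: critical_set_def mdifferentiable_def)
  then show d: "((coord (chart_at M (g x t)) \<circ> ((\<lambda>y. g y t) \<circ> param (chart_at M x))) has_derivative mderiv M (\<lambda>y. g y t) x)
      (at (coord (chart_at M x) x))"
    unfolding mderiv_def frechet_derivative_works by (simp add: local_rep_def comp_assoc)
  show "linear (mderiv M (\<lambda>y. g y t) x)" by (rule has_derivative_linear[OF d])
qed

text \<open>The preferred chart at \<open>g x t\<close> may vary wildly with t. Computing in a fixed
  target chart, and writing the derivative as a limit of difference quotients, gives a formula that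
  is visibly measurable in t.\<close>

lemma deriv_norm_chart:
  assumes x: "x \<notin> crit t" and c: "c \<in> atlas M" "g x t \<in> dom_of c"
  defines "p \<equiv> coord (chart_at M x) x"
  defines "ch \<equiv> \<lambda>y. if y \<in> dom_of c then coord c y else 0"
  shows "deriv_norm x v t = (let W = lim (\<lambda>n. real (Suc n) *\<^sub>R (ch (g (param (chart_at M x) (p + (1 / real (Suc n)) *\<^sub>R v)) t) - ch (g x t)))
     in sqrt (W \<bullet> (gram M c (g x t) *v W)))"
proof -
  let ?cx = "chart_at M x" and ?c0 = "chart_at M (g x t)"
  let ?\<Phi> = "(\<lambda>y. g y t) \<circ> param ?cx"
  note cx = chart_at[of x] and c0 = chart_at[of "g x t"]
  have pV: "p \<in> coord ?cx ` dom_of ?cx" using cx(2) by (auto simp: p_def)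
  have pp: "param ?cx p = x" using chart(5)[OF cx(1) cx(2)] by (simp add: p_def)
  have \<Phi>p: "?\<Phi> p = g x t" by (simp add: pp)
  have "isCont (param ?cx) p"
    using chart(4)[OF cx(1)] continuous_on_eq_continuous_at[OF chart(2)[OF cx(1)]] pV by blast
  then have cont: "isCont ?\<Phi> p" unfolding o_def by (rule isCont_o2) (use off_crit(1)[OF x] pp in simp)
  have d0: "((coord ?c0 \<circ> ?\<Phi>) has_derivative mderiv M (\<lambda>y. g y t) x) (at p)"
    using off_crit(3)[OF x] by (simp add: p_def)
  define L where "L = trans_jac ?c0 c (?\<Phi> p) \<circ> mderiv M (\<lambda>y. g y t) x"
  have dL: "((coord c \<circ> ?\<Phi>) has_derivative L) (at p)"
    unfolding L_def by (rule chart_change[OF cont c0(1) c(1) _ d0]) (use c0 c \<Phi>p in auto)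
  have "((coord ?c0 \<circ> ?\<Phi>) has_derivative trans_jac c ?c0 (?\<Phi> p) \<circ> L) (at p)"
    by (rule chart_change[OF cont c(1) c0(1) _ dL]) (use c0 c \<Phi>p in auto)
  then have "mderiv M (\<lambda>y. g y t) x = trans_jac c ?c0 (g x t) \<circ> L"
    using has_derivative_unique[OF d0] \<Phi>p by simp
  then have deriv_norm: "deriv_norm x v t = sqrt (L v \<bullet> (gram M c (g x t) *v L v))"
    using tnorm_change[OF c, of "L v"] by (simp add: deriv_norm_def)
  let ?q = "\<lambda>n. p + (1 / real (Suc n)) *\<^sub>R v"
  have "(\<lambda>n. 1 / real (Suc n)) \<longlonglongrightarrow> 0" by (rule LIMSEQ_Suc[OF lim_1_over_n])
  then have "?q \<longlonglongrightarrow> p + 0 *\<^sub>R v" by (intro tendsto_intros)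
  then have "?q \<longlonglongrightarrow> p" by simp
  then have "(\<lambda>n. ?\<Phi> (?q n)) \<longlonglongrightarrow> ?\<Phi> p" by (rule isCont_tendsto_compose[OF cont])
  \<comment> \<open>The difference quotients eventually stay in the chart, so the default value 0 of
    \<open>ch\<close> does not affect the limit.\<close>
  then have ev: "\<forall>\<^sub>F n in sequentially. ?\<Phi> (?q n) \<in> dom_of c"
    using chart(1)[OF c(1)] c(2) \<Phi>p by (intro topological_tendstoD) auto
  have "(\<lambda>n. real (Suc n) *\<^sub>R (ch (g (param ?cx (?q n)) t) - ch (g x t))) \<longlonglongrightarrow> L v"
  proof (rule Lim_transform_eventually[OF directional_derivative_seq[OF dL]])
    show "\<forall>\<^sub>F n in sequentially. real (Suc n) *\<^sub>R ((coord c \<circ> ?\<Phi>) (?q n) - (coord c \<circ> ?\<Phi>) p)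
       = real (Suc n) *\<^sub>R (ch (g (param ?cx (?q n)) t) - ch (g x t))"
      using ev by eventually_elim (use c \<Phi>p in \<open>simp add: ch_def\<close>)
  qed
  then have "lim (\<lambda>n. real (Suc n) *\<^sub>R (ch (g (param ?cx (?q n)) t) - ch (g x t))) = L v" by (rule limI)
  then show ?thesis by (simp add: deriv_norm Let_def)
qed

text \<open>The noise values are divided according to which of finitely many charts contains
  \<open>g x t\<close>; on each piece \<open>deriv_norm_chart\<close> applies.\<close>

lemma deriv_norm_measurable:
  "(\<lambda>t. deriv_norm x v t) \<in> borel_measurable (restrict_space (noise \<sigma>) {t. x \<notin> crit t})"
proof -
  let ?R = "restrict_space (noise \<sigma>) {t. x \<notin> crit t}"
  obtain F where F: "finite F" "F \<subseteq> atlas M" "(\<Union>c\<in>F. dom_of c) = UNIV" using finite_atlas by blast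
  let ?C = "(\<lambda>c. {t. g x t \<in> dom_of c}) ` F"
  have gm[measurable]: "g y \<in> ?R \<rightarrow>\<^sub>M borel" for y by (intro measurable_restrict_space1 g_measurable_t)
  show ?thesis
  proof (rule measurable_piecewise_restrict[of ?C])
    show "countable ?C" using F by (simp add: countable_finite)
    show "space ?R \<subseteq> \<Union>?C" using F(3) by auto
    fix \<Omega> assume "\<Omega> \<in> ?C"
    then obtain c where c: "c \<in> F" "\<Omega> = {t. g x t \<in> dom_of c}" by auto
    then have ca: "c \<in> atlas M" using F by auto
    have op: "open (dom_of c)" by (rule chart(1)[OF ca])
    show "\<Omega> \<inter> space ?R \<in> sets ?R"
      using measurable_sets[OF gm[of x], of "dom_of c"] op c by (simp add: vimage_def Int_def)
    define ch where "ch y = (if y \<in> dom_of c then coord c y else 0)" for y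
    define G where "G y = (if y \<in> dom_of c then gram M c y else 0)" for y
    have [measurable]: "ch \<in> borel_measurable borel"
      unfolding ch_def by (rule borel_measurable_continuous_on_if) (use op chart(3)[OF ca] in auto)
    have "continuous_on (dom_of c) ((gram M c \<circ> param c) \<circ> coord c)"
      by (intro continuous_on_compose chart(3)[OF ca] gram_continuous[OF ca])
    then have "continuous_on (dom_of c) (gram M c)"
      by (rule continuous_on_eq) (simp add: chart(5)[OF ca])
    then have [measurable]: "G \<in> borel_measurable borel"
      unfolding G_def by (intro borel_measurable_continuous_on_if) (use op in auto)
    let ?p = "coord (chart_at M x) x"
    define W where "W t = lim (\<lambda>n. real (Suc n) *\<^sub>R (ch (g (param (chart_at M x) (?p + (1 / real (Suc n)) *\<^sub>R v)) t) - ch (g x t)))" for t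
    have Wm[measurable]: "W \<in> borel_measurable ?R" unfolding W_def by measurable
    have "continuous_on UNIV (\<lambda>z :: (real^'k^'k) \<times> (real^'k). snd z \<bullet> (fst z *v snd z))"
      unfolding matrix_vector_mult_def inner_vec_def by (simp, intro continuous_intros)
    then have qm: "(\<lambda>z :: (real^'k^'k) \<times> (real^'k). snd z \<bullet> (fst z *v snd z)) \<in> borel_measurable borel"
      by (rule borel_measurable_continuous_onI)
    have "(\<lambda>t. (G (g x t), W t)) \<in> ?R \<rightarrow>\<^sub>M borel"
      unfolding borel_prod[symmetric] by measurable
    from measurable_compose[OF this qm] have "(\<lambda>t. sqrt (W t \<bullet> (G (g x t) *v W t))) \<in> borel_measurable ?R"
      by simp
    then have "(\<lambda>t. sqrt (W t \<bullet> (G (g x t) *v W t))) \<in> borel_measurable (restrict_space ?R \<Omega>)"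
      by (rule measurable_restrict_space1)
    also have "?this \<longleftrightarrow> (\<lambda>t. deriv_norm x v t) \<in> borel_measurable (restrict_space ?R \<Omega>)"
    proof (rule measurable_cong)
      fix t assume "t \<in> space (restrict_space ?R \<Omega>)"
      then have "x \<notin> crit t" "g x t \<in> dom_of c" using c by (auto simp: space_restrict_space)
      then show "sqrt (W t \<bullet> (G (g x t) *v W t)) = deriv_norm x v t"
        using deriv_norm_chart[OF _ ca, of x t v] by (simp add: W_def ch_def G_def Let_def del: of_nat_Suc)
    qed
    finally show "(\<lambda>t. deriv_norm x v t) \<in> borel_measurable (restrict_space ?R \<Omega>)" .
  qed
qed

section \<open>The norm of the inverse derivative and its logarithm\<close>

abbreviation "inv_norm x t \<equiv> inv_deriv_norm M (\<lambda>y. g y t) x"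

lemma derivative_bounds:
  obtains B \<alpha> where "B > 1" "\<alpha> > 0"
    "\<And>x t v. t \<in> cube \<sigma> \<Longrightarrow> x \<notin> crit t \<Longrightarrow> v \<noteq> 0 \<Longrightarrow> 1 / B * cd x t powr \<alpha> \<le> deriv_norm x v t / tnorm M x v"
    "\<And>x t v. t \<in> cube \<sigma> \<Longrightarrow> x \<notin> crit t \<Longrightarrow> v \<noteq> 0 \<Longrightarrow> deriv_norm x v t / tnorm M x v \<le> B * cd x t powr (- \<alpha>)"
    "\<And>x y t. t \<in> cube \<sigma> \<Longrightarrow> x \<notin> crit t \<Longrightarrow> y \<notin> crit t \<Longrightarrow> dist x y \<le> cd x t / 2 \<Longrightarrow>
      \<bar>ln (inv_norm x t) - ln (inv_norm y t)\<bar> \<le> B / cd x t powr \<alpha> * dist x y powr \<beta>"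
proof -
  note H = conjunct1[OF conjunct2[OF H2[unfolded H2_def Let_def]]]
  then obtain B \<alpha> where B: "B > 1" "\<alpha> > 0" and *: "\<And>t. t \<in> cube \<sigma> \<Longrightarrow>
      (\<forall>x. x \<notin> crit t \<longrightarrow> (\<forall>v. v \<noteq> 0 \<longrightarrow>
             1 / B * cd x t powr \<alpha> \<le> deriv_norm x v t / tnorm M x v \<and>
             deriv_norm x v t / tnorm M x v \<le> B * cd x t powr (- \<alpha>))) \<and>
          (\<forall>x y. x \<notin> crit t \<longrightarrow> y \<notin> crit t \<longrightarrow> dist x y \<le> cd x t / 2 \<longrightarrow>
             \<bar>ln (inv_norm x t) - ln (inv_norm y t)\<bar> \<le> B / cd x t powr \<alpha> * dist x y powr \<beta> \<and>
             \<bar>ln (abs_det_deriv M (\<lambda>y. g y t) x) - ln (abs_det_deriv M (\<lambda>y. g y t) y)\<bar>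
               \<le> B / cd x t powr \<alpha> * dist x y powr \<beta>)"
    unfolding deriv_norm_def by blast
  show thesis
  proof (rule that[OF B])
    fix x t and v :: "real^'k" assume "t \<in> cube \<sigma>" "x \<notin> crit t" "v \<noteq> 0"
    then show "1 / B * cd x t powr \<alpha> \<le> deriv_norm x v t / tnorm M x v" "deriv_norm x v t / tnorm M x v \<le> B * cd x t powr (- \<alpha>)"
      using conjunct1[OF *] by blast+
  next
    fix x y t assume "t \<in> cube \<sigma>" "x \<notin> crit t" "y \<notin> crit t" "dist x y \<le> cd x t / 2"
    then show "\<bar>ln (inv_norm x t) - ln (inv_norm y t)\<bar> \<le> B / cd x t powr \<alpha> * dist x y powr \<beta>"
      using conjunct2[OF *] by blast
  qed
qed

lemma deriv_norm_pos:
  assumes "x \<notin> crit t" "v \<noteq> 0" shows "0 < deriv_norm x v t"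
proof -
  have "mderiv M (\<lambda>y. g y t) x v \<noteq> mderiv M (\<lambda>y. g y t) x 0"
    using bij_is_inj[OF off_crit(2)[OF assms(1)]] assms(2) by (auto dest: injD)
  then have "mderiv M (\<lambda>y. g y t) x v \<noteq> 0" using linear_0[OF off_crit(4)[OF assms(1)]] by simp
  then show ?thesis unfolding deriv_norm_def by (rule tnorm_pos)
qed

text \<open>The substitution of the derivative of v for the target vector removes the inverse map
  from the supremum, and the bounds of (H2) apply to the quotients directly.\<close>

lemma inv_norm_eq:
  assumes x: "x \<notin> crit t"
  shows "inv_norm x t = (SUP v\<in>-{0}. tnorm M x v / deriv_norm x v t)"
proof -
  let ?L = "mderiv M (\<lambda>y. g y t) x"
  have b: "bij ?L" and l: "linear ?L" using off_crit[OF x] by auto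
  have inv0: "?L 0 = 0" by (rule linear_0[OF l])
  have img: "?L ` (-{0}) = -{0}"
    using bij_image_Compl_eq[OF b, of "{0}"] inv0 by simp
  have "inv_norm x t = (SUP w\<in>?L ` (-{0}). tnorm M x (inv ?L w) / tnorm M (g x t) w)"
    unfolding img by (simp add: inv_deriv_norm_def opnorm_def)
  also have "\<dots> = (SUP v\<in>-{0}. tnorm M x v / deriv_norm x v t)"
    by (simp add: image_image deriv_norm_def inv_f_f[OF bij_is_inj[OF b]])
  finally show ?thesis .
qed

lemma nz_ne: "-{0 :: real^'k} \<noteq> {}"
  by (metis ComplI axis_eq_0_iff empty_iff singletonD zero_neq_one)

lemma inv_norm_bounds:
  "\<exists>B>1. \<exists>\<alpha>>0. \<forall>t\<in>cube \<sigma>. \<forall>x. x \<notin> crit t \<longrightarrow>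
    bdd_above ((\<lambda>v. tnorm M x v / deriv_norm x v t) ` (-{0})) \<and>
    inv_norm x t \<le> B * cd x t powr (- \<alpha>) \<and> 1 / B * cd x t powr \<alpha> \<le> inv_norm x t"
proof -
  obtain B \<alpha> where B: "B > 1" "\<alpha> > 0"
    and lo: "\<And>x t v. t \<in> cube \<sigma> \<Longrightarrow> x \<notin> crit t \<Longrightarrow> v \<noteq> 0 \<Longrightarrow> 1 / B * cd x t powr \<alpha> \<le> deriv_norm x v t / tnorm M x v"
    and hi: "\<And>x t v. t \<in> cube \<sigma> \<Longrightarrow> x \<notin> crit t \<Longrightarrow> v \<noteq> 0 \<Longrightarrow> deriv_norm x v t / tnorm M x v \<le> B * cd x t powr (- \<alpha>)"
    using derivative_bounds by metis
  have up: "tnorm M x v / deriv_norm x v t \<le> B * cd x t powr (- \<alpha>)"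
    and dn: "1 / B * cd x t powr \<alpha> \<le> tnorm M x v / deriv_norm x v t"
    if t: "t \<in> cube \<sigma>" "x \<notin> crit t" and v: "v \<noteq> 0" for x t v
  proof -
    have "0 < cd x t" using cd_pos_iff[OF t(1)] t(2) by blast
    then have pos: "0 < deriv_norm x v t" "0 < tnorm M x v" "0 < cd x t" "0 < cd x t powr \<alpha>"
      using deriv_norm_pos[OF t(2) v] tnorm_pos[OF v] by auto
    show "tnorm M x v / deriv_norm x v t \<le> B * cd x t powr (- \<alpha>)"
      using lo[OF t v] pos B by (simp add: powr_minus field_simps)
    show "1 / B * cd x t powr \<alpha> \<le> tnorm M x v / deriv_norm x v t"
      using hi[OF t v] pos B by (simp add: powr_minus field_simps)
  qed
  have bdd: "bdd_above ((\<lambda>v. tnorm M x v / deriv_norm x v t) ` (-{0}))" if "t \<in> cube \<sigma>" "x \<notin> crit t" for x t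
    using up[OF that] by (intro bdd_aboveI2[of _ _ "B * cd x t powr (- \<alpha>)"]) auto
  have "\<forall>t\<in>cube \<sigma>. \<forall>x. x \<notin> crit t \<longrightarrow>
    bdd_above ((\<lambda>v. tnorm M x v / deriv_norm x v t) ` (-{0})) \<and>
    inv_norm x t \<le> B * cd x t powr (- \<alpha>) \<and> 1 / B * cd x t powr \<alpha> \<le> inv_norm x t"
  proof (intro conjI ballI allI impI bdd)
    fix t x assume t: "t \<in> cube \<sigma>" "x \<notin> crit t"
    show "inv_norm x t \<le> B * cd x t powr (- \<alpha>)"
      unfolding inv_norm_eq[OF t(2)] by (rule cSUP_least[OF nz_ne]) (use up[OF t] in auto)
    obtain v :: "real^'k" where v: "v \<in> -{0}" using nz_ne by blast
    show "1 / B * cd x t powr \<alpha> \<le> inv_norm x t"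
      unfolding inv_norm_eq[OF t(2)] by (rule order_trans[OF dn[OF t] cSUP_upper[OF v bdd[OF t]]]) (use v in auto)
  qed
  with B show ?thesis by blast
qed

text \<open>Reduces an uncountable supremum to a countable union: with the denominator cleared, the
  condition on v is open by continuity of the norms, so it is met in a dense set as soon as it is
  met at all.\<close>

lemma inv_norm_gt_iff:
  fixes D :: "(real^'k) set"
  assumes D: "\<And>X. open X \<Longrightarrow> X \<noteq> {} \<Longrightarrow> \<exists>d\<in>D. d \<in> X"
    and t: "t \<in> cube \<sigma>" "x \<notin> crit t"
  shows "a < inv_norm x t \<longleftrightarrow> (\<exists>v\<in>D - {0}. a * deriv_norm x v t < tnorm M x v)"
proof -
  let ?f = "\<lambda>v. tnorm M x v / deriv_norm x v t"
  let ?L = "mderiv M (\<lambda>y. g y t) x"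
  have bdd: "bdd_above (?f ` (-{0}))" using inv_norm_bounds t by (elim exE conjE) simp
  have iff: "a < ?f v \<longleftrightarrow> a * deriv_norm x v t < tnorm M x v" if "v \<noteq> 0" for v
    using deriv_norm_pos[OF t(2) that] by (simp add: field_simps)
  have tc: "continuous_on UNIV (tnorm M y)" for y
    unfolding tnorm_def by (intro continuous_intros)
  have "continuous_on UNIV ?L" using off_crit(4)[OF t(2)] by (simp add: linear_continuous_on linear_conv_bounded_linear)
  then have nc: "continuous_on UNIV (\<lambda>v. deriv_norm x v t)"
    unfolding deriv_norm_def using continuous_on_compose2[OF tc] by blast
  show ?thesis
  proof
    assume "a < inv_norm x t"
    then obtain v where v: "v \<noteq> 0" "a < ?f v"
      unfolding inv_norm_eq[OF t(2)] less_cSUP_iff[OF nz_ne bdd] by auto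
    let ?X = "{v. a * deriv_norm x v t < tnorm M x v} \<inter> -{0}"
    have "open ?X" by (intro open_Int open_Collect_less continuous_intros nc tc)
    moreover have "?X \<noteq> {}" using v iff by auto
    ultimately obtain d where "d \<in> D" "d \<in> ?X" using D by blast
    then show "\<exists>v\<in>D - {0}. a * deriv_norm x v t < tnorm M x v" by auto
  next
    assume "\<exists>v\<in>D - {0}. a * deriv_norm x v t < tnorm M x v"
    then show "a < inv_norm x t" unfolding inv_norm_eq[OF t(2)] less_cSUP_iff[OF nz_ne bdd] using iff by auto
  qed
qed

lemma off_crit_sets: "{t \<in> cube \<sigma>. x \<notin> crit t} \<in> sets (noise \<sigma>)"
proof -
  have "{t \<in> cube \<sigma>. x \<notin> crit t} = {t \<in> space (noise \<sigma>). 0 < cd x t}" using cd_pos_iff by auto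
  also have "\<dots> \<in> sets (noise \<sigma>)" using cd_slice[of x] by measurable
  finally show ?thesis .
qed

lemma inv_norm_slice: "(\<lambda>t. inv_norm x t) \<in> borel_measurable (restrict_space (noise \<sigma>) {t. x \<notin> crit t})"
proof (rule borel_measurable_iff_greater[THEN iffD2], intro allI)
  fix a
  let ?R = "restrict_space (noise \<sigma>) {t. x \<notin> crit t}"
  obtain D :: "(real^'k) set" where D: "countable D" "\<And>X. open X \<Longrightarrow> X \<noteq> {} \<Longrightarrow> \<exists>d\<in>D. d \<in> X"
    using countable_dense_setE by blast
  have "{t \<in> space ?R. a < inv_norm x t} = (\<Union>v\<in>D - {0}. {t \<in> space ?R. a * deriv_norm x v t < tnorm M x v})"
    using inv_norm_gt_iff[OF D(2)] by (auto simp: space_restrict_space)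
  also have "\<dots> \<in> sets ?R"
    using D(1) deriv_norm_measurable[of x] by (intro sets.countable_UN') auto
  finally show "{t \<in> space ?R. a < inv_norm x t} \<in> sets ?R" .
qed

text \<open>The value 0 on the critical set makes \<open>phi\<close> Borel measurable; the logarithm it replaces is
  arbitrary there.\<close>

definition phi :: "'m \<Rightarrow> real^'k \<Rightarrow> real" where
  "phi x t = (if x \<notin> crit t then ln (inv_norm x t) else 0)"

text \<open>Measurability in t comes from the supremum over countably many directions; continuity in
  x off the closed critical set comes from the Hoelder estimate of (H2).\<close>

lemma phi_measurable:
  assumes L: "sets L = sets (borel :: 'm measure)"
  shows "(\<lambda>z. phi (fst z) (snd z)) \<in> borel_measurable (L \<Otimes>\<^sub>M noise \<sigma>)"
  unfolding phi_def
proof (rule Caratheodory_measurable[OF comp L, where Q = "\<lambda>x t. x \<notin> crit t" and F = "\<lambda>x t. ln (inv_norm x t)"])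
  have "{z \<in> space (L \<Otimes>\<^sub>M noise \<sigma>). fst z \<notin> crit (snd z)} = {z \<in> space (L \<Otimes>\<^sub>M noise \<sigma>). 0 < cd (fst z) (snd z)}"
    using cd_pos_iff by (auto simp: space_pair_measure)
  also have "\<dots> \<in> sets (L \<Otimes>\<^sub>M noise \<sigma>)" using cd_measurable[OF L] by measurable
  finally show "{z \<in> space (L \<Otimes>\<^sub>M noise \<sigma>). fst z \<notin> crit (snd z)} \<in> sets (L \<Otimes>\<^sub>M noise \<sigma>)" .
  fix x
  have "(\<lambda>t. ln (inv_norm x t)) \<in> borel_measurable (restrict_space (noise \<sigma>) {t. x \<notin> crit t})"
    using inv_norm_slice[of x] by measurable
  moreover have "{t. x \<notin> crit t} \<inter> space (noise \<sigma>) \<in> sets (noise \<sigma>)"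
    using off_crit_sets[of x] by (simp add: Int_def conj_commute)
  ultimately show "(\<lambda>t. if x \<notin> crit t then ln (inv_norm x t) else 0) \<in> borel_measurable (noise \<sigma>)"
    by (intro measurable_If_restrict_space_iff[THEN iffD2]) (auto simp: Int_def conj_commute)
next
  fix x t assume "t \<in> space (noise \<sigma>)" and x: "x \<notin> crit t"
  then have t: "t \<in> cube \<sigma>" by simp
  obtain B \<alpha> where B: "B > 1" "\<alpha> > 0"
    and hol: "\<And>x y t. t \<in> cube \<sigma> \<Longrightarrow> x \<notin> crit t \<Longrightarrow> y \<notin> crit t \<Longrightarrow> dist x y \<le> cd x t / 2 \<Longrightarrow>
      \<bar>ln (inv_norm x t) - ln (inv_norm y t)\<bar> \<le> B / cd x t powr \<alpha> * dist x y powr \<beta>"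
    using derivative_bounds by metis
  have cpos: "0 < cd x t" using cd_pos_iff[OF t] x by simp
  let ?K = "B / cd x t powr \<alpha>"
  \<comment> \<open>For y near x the Hoelder estimate applies with the distance from x to the
    critical set fixed, and its bound tends to 0 because \<beta> is positive.\<close>
  have cc: "isCont (\<lambda>y. ln (inv_norm y t)) x"
    unfolding isCont_def
  proof (rule LIM_zero_cancel, rule tendsto_rabs_zero_cancel, rule tendsto_sandwich[of "\<lambda>_. 0"])
    have "((\<lambda>y. dist x y powr \<beta>) \<longlongrightarrow> 0 powr \<beta>) (at x)"
    proof (rule tendsto_powr')
      have "((\<lambda>y. dist x y) \<longlongrightarrow> dist x x) (at x)" by (intro tendsto_intros)
      then show "((\<lambda>y. dist x y) \<longlongrightarrow> 0) (at x)" by simp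
    qed (use beta in auto)
    then show "((\<lambda>y. ?K * dist x y powr \<beta>) \<longlongrightarrow> 0) (at x)" using beta by (intro tendsto_mult_right_zero) simp
    have "\<forall>\<^sub>F y in at x. y \<in> - crit t"
      using crit_closed(1)[OF t] x by (intro eventually_at_in_open') auto
    moreover have "\<forall>\<^sub>F y in at x. dist y x < cd x t / 2" using cpos by (auto simp: eventually_at intro!: exI[of _ "cd x t / 2"])
    ultimately show "\<forall>\<^sub>F y in at x. \<bar>ln (inv_norm y t) - ln (inv_norm x t)\<bar> \<le> ?K * dist x y powr \<beta>"
      by eventually_elim (use hol[OF t x] in \<open>auto simp: dist_commute abs_minus_commute\<close>)
  qed auto
  have ev: "\<forall>\<^sub>F y in nhds x. (if y \<notin> crit t then ln (inv_norm y t) else 0) = ln (inv_norm y t)"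
  proof -
    have "\<forall>\<^sub>F y in nhds x. y \<in> - crit t" using crit_closed(1)[OF t] x by (intro eventually_nhds_in_open) auto
    then show ?thesis by eventually_elim simp
  qed
  show "isCont (\<lambda>y. if y \<notin> crit t then ln (inv_norm y t) else 0) x"
    unfolding isCont_cong[OF ev] by (rule cc)
qed

text \<open>The two-sided bounds of the inverse norm by powers of the distance become linear bounds
  in the logarithm. Distances above 1 are bounded by compactness and go into the constant.\<close>

lemma phi_bound: "\<exists>\<alpha>>0. \<exists>c. \<forall>x. \<forall>t\<in>cube \<sigma>. \<bar>phi x t\<bar> \<le> c + \<alpha> * (- ln (min 1 (cd x t)))"
proof -
  obtain B \<alpha> where B: "B > 1" "\<alpha> > 0"
    and ul: "\<forall>t\<in>cube \<sigma>. \<forall>x. x \<notin> crit t \<longrightarrow> bdd_above ((\<lambda>v. tnorm M x v / deriv_norm x v t) ` (-{0})) \<and>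
      inv_norm x t \<le> B * cd x t powr (- \<alpha>) \<and> 1 / B * cd x t powr \<alpha> \<le> inv_norm x t"
    using inv_norm_bounds by (elim exE conjE)
  have up: "inv_norm x t \<le> B * cd x t powr (- \<alpha>)" and lo: "1 / B * cd x t powr \<alpha> \<le> inv_norm x t"
    if "t \<in> cube \<sigma>" "x \<notin> crit t" for x t using ul that by simp_all
  obtain R where R: "\<And>x y :: 'm. dist x y \<le> R"
    using compact_imp_bounded[OF comp] by (auto simp: bounded_two_points)
  \<comment> \<open>The maximum with 1 covers empty critical sets, whose distance is 1 by
    convention.\<close>
  define E where "E = max 1 R"
  have cdE: "cd x t \<le> E" for x t
  proof (cases "crit t = {}")
    case False
    then obtain y where "y \<in> crit t" by blast
    then show ?thesis using infdist_le[of y "crit t" x] R[of x y] False by (auto simp: cdist_def E_def)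
  qed (auto simp: cdist_def E_def)
  define c where "c = ln B + \<alpha> * ln E"
  have c0: "0 \<le> ln B" "0 \<le> ln E" using B by (auto simp: E_def)
  have "\<bar>phi x t\<bar> \<le> c + \<alpha> * (- ln (min 1 (cd x t)))" if t: "t \<in> cube \<sigma>" for x t
  proof (cases "x \<in> crit t")
    case True
    then have "cd x t = 0" using cd_pos_iff[OF t, of x] cd_nonneg[of x t] by simp
    then show ?thesis using True c0 B by (simp add: phi_def c_def)
  next
    case False
    have cp: "0 < cd x t" using cd_pos_iff[OF t] False by simp
    have l0: "0 < 1 / B * cd x t powr \<alpha>" using B cp by simp
    have i0: "0 < inv_norm x t" using lo[OF t False] l0 by linarith
    have 1: "ln (inv_norm x t) \<le> ln B - \<alpha> * ln (cd x t)"
    proof -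
      have u0: "0 < B * cd x t powr (- \<alpha>)" using B cp by simp
      have "ln (inv_norm x t) \<le> ln (B * cd x t powr (- \<alpha>))"
        using up[OF t False] by (rule iffD2[OF ln_le_cancel_iff[OF i0 u0]])
      then show ?thesis using B cp by (simp add: ln_mult ln_powr)
    qed
    have 2: "- ln B + \<alpha> * ln (cd x t) \<le> ln (inv_norm x t)"
    proof -
      have "ln (1 / B * cd x t powr \<alpha>) \<le> ln (inv_norm x t)"
        using lo[OF t False] by (rule iffD2[OF ln_le_cancel_iff[OF l0 i0]])
      moreover have "ln (1 / B * cd x t powr \<alpha>) = - ln B + \<alpha> * ln (cd x t)"
        using B cp by (subst ln_mult) (auto simp: ln_div ln_powr)
      ultimately show ?thesis by simp
    qed
    have "\<bar>ln (cd x t)\<bar> \<le> ln E + - ln (min 1 (cd x t))"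
      using cp cdE[of x t] c0 by (auto simp: min_def abs_if not_le)
    then have "\<alpha> * \<bar>ln (cd x t)\<bar> \<le> \<alpha> * (ln E + - ln (min 1 (cd x t)))" using B by (intro mult_left_mono) auto
    moreover have "\<alpha> * ln (cd x t) \<le> \<alpha> * \<bar>ln (cd x t)\<bar>" "- (\<alpha> * ln (cd x t)) \<le> \<alpha> * \<bar>ln (cd x t)\<bar>"
      using B mult_left_mono[OF abs_ge_self, of \<alpha> "ln (cd x t)"] mult_left_mono[OF abs_ge_minus_self, of \<alpha> "ln (cd x t)"]
      by auto
    ultimately have "\<bar>ln (inv_norm x t)\<bar> \<le> ln B + \<alpha> * (ln E + - ln (min 1 (cd x t)))"
      using 1 2 by linarith
    then show ?thesis using False by (simp add: phi_def c_def algebra_simps)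
  qed
  then show ?thesis using B by blast
qed

end

section \<open>Exponential moments and conclusion\<close>

context singular_riem
begin

lemma mstar_inclusion: "(\<lambda>z. z) \<in> mstar m \<mu> \<rightarrow>\<^sub>M m"
  unfolding mstar_def by (rule measurable_restrict_space1) simp

lemma pair_inclusion: "(\<lambda>z. z) \<in> mstar m \<mu> \<Otimes>\<^sub>M L \<rightarrow>\<^sub>M m \<Otimes>\<^sub>M L"
proof -
  have "(\<lambda>z. (fst z, snd z)) \<in> mstar m \<mu> \<Otimes>\<^sub>M L \<rightarrow>\<^sub>M m \<Otimes>\<^sub>M L"
    by (intro measurable_Pair measurable_snd measurable_compose[OF measurable_fst mstar_inclusion])
  then show ?thesis by simp
qed

lemma cd_m: "(\<lambda>z. cd (fst z) (snd z)) \<in> borel_measurable (mstar m \<mu> \<Otimes>\<^sub>M noise \<sigma>)"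
  by (rule measurable_compose[OF pair_inclusion cd_measurable[OF sets_m]])

lemma phi_m: "(\<lambda>z. phi (fst z) (snd z)) \<in> borel_measurable (mstar m \<mu> \<Otimes>\<^sub>M noise \<sigma>)"
  by (rule measurable_compose[OF pair_inclusion phi_measurable[OF sets_m]])

lemma noise_seq_eq: "noise_seq \<sigma> = Pi\<^sub>M (UNIV :: nat set) (\<lambda>_. noise \<sigma>)"
  by (simp add: noise_seq_def)

text \<open>A single weight dominates the exponential moments of both observables. Its exponent
  stays below 1 for integrability under (H4), and above 1/2 so that the mean of the truncated
  logarithm gains more than a square root of r.\<close>

abbreviation "w z \<equiv> min 1 (cd (fst z) (snd z)) powr - (3/4)"

lemma moment:
  assumes H4: "H4 M m g \<sigma> \<mu>"
  shows "(\<integral>\<^sup>+z. ennreal (w z) \<partial>(mstar m \<mu> \<Otimes>\<^sub>M noise \<sigma>)) < \<infinity>"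
proof -
  obtain D where "random_map (mstar m \<mu>) (noise \<sigma>) g D mu'" using exists_random_map by blast
  then interpret R: random_map "mstar m \<mu>" "noise \<sigma>" g D mu' .
  let ?P = "mstar m \<mu> \<Otimes>\<^sub>M (noise \<sigma> :: (real^'k) measure)"
  note [measurable] = cd_m
  have sp: "space ?P = K \<times> (cube \<sigma> :: (real^'k) set)" by (simp add: space_pair_measure)
  let ?L = "\<lambda>\<delta>. {z \<in> space ?P. cd (fst z) (snd z) \<le> \<delta>}"
  define T where "T = measure (mstar m \<mu>) K"
  have T: "emeasure ?P (space ?P) = ennreal T"
  proof -
    have "emeasure ?P (K \<times> cube \<sigma>) = emeasure (mstar m \<mu>) K * emeasure (noise \<sigma>) (cube \<sigma> :: (real^'k) set)"
      by (rule N.emeasure_pair_measure_Times) (auto simp: sets_mstar sets_noise_iff cube_props)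
    then show ?thesis using N.emeasure_space_1 by (simp add: sp T_def R.M.emeasure_eq_measure)
  qed
  obtain C1 \<delta>0 where C1: "C1 > 0" "\<delta>0 > 0" and H: "\<And>\<delta>. 0 < \<delta> \<Longrightarrow> \<delta> < \<delta>0 \<Longrightarrow>
     emeasure (mstar m \<mu> \<Otimes>\<^sub>M noise_seq \<sigma>)
       {(x, \<omega>) \<in> space (mstar m \<mu> \<Otimes>\<^sub>M noise_seq \<sigma>). cd x (\<omega> 0) \<le> \<delta>} \<le> ennreal (C1 * \<delta>)"
    using H4 unfolding H4_def eventually_at_right_field by (auto simp: cdist_def)
  have small: "emeasure ?P (?L \<delta>) \<le> ennreal (C1 * \<delta>)" if "0 < \<delta>" "\<delta> < \<delta>0" for \<delta>
  proof -
    have "{(x, \<omega>) \<in> space (mstar m \<mu> \<Otimes>\<^sub>M noise_seq \<sigma>). cd x (\<omega> 0) \<le> \<delta>}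
       = {z \<in> space (mstar m \<mu> \<Otimes>\<^sub>M R.NS). cd (fst z) (snd z 0) \<le> \<delta>}"
      by (auto simp: noise_seq_eq)
    then show ?thesis
      using H[OF that] R.emeasure_first(2)[of "\<lambda>x t. cd x t \<le> \<delta>"] by (simp add: noise_seq_eq)
  qed
  \<comment> \<open>The linear bound of (H4) holds for small \<delta> only; beyond \<delta>0 the
    total mass T is at most \<open>T / \<delta>0 * \<delta>\<close>.\<close>
  define A where "A = C1 + T / \<delta>0"
  have T0: "0 \<le> T" by (simp add: T_def)
  have A: "0 \<le> A" using C1 T0 by (simp add: A_def)
  have lin: "emeasure ?P (?L \<delta>) \<le> ennreal (A * \<delta>)" if \<delta>: "0 < \<delta>" for \<delta>
  proof (cases "\<delta> < \<delta>0")
    case True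
    have "C1 * \<delta> \<le> A * \<delta>" using \<delta> T0 C1 by (intro mult_right_mono) (auto simp: A_def)
    then show ?thesis using small[OF \<delta> True] by (meson ennreal_leI order_trans)
  next
    case False
    have "emeasure ?P (?L \<delta>) \<le> ennreal T" unfolding T[symmetric] by (rule emeasure_mono) auto
    moreover have "T \<le> A * \<delta>"
    proof -
      have "T = T / \<delta>0 * \<delta>0" using C1 by simp
      also have "\<dots> \<le> T / \<delta>0 * \<delta>" using False T0 C1 by (intro mult_left_mono) auto
      also have "\<dots> \<le> A * \<delta>" using \<delta> C1 by (intro mult_right_mono) (auto simp: A_def)
      finally show ?thesis .
    qed
    ultimately show ?thesis by (meson ennreal_leI order_trans)
  qed
  let ?q = "3/4 :: real"
  have "(\<integral>\<^sup>+z. ennreal (w z) \<partial>?P) \<le> (\<integral>\<^sup>+z. 1 + (\<Sum>k. ennreal (exp (?q * (real k + 1))) * indicator (?L (exp (- real k))) z) \<partial>?P)"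
  proof (rule nn_integral_mono)
    fix z assume z: "z \<in> space ?P"
    have "ennreal (w z) \<le> 1 + (\<Sum>k. ennreal (exp (?q * (real k + 1))) * indicator {..exp (- real k)} (cd (fst z) (snd z)))"
      by (rule dyadic_powr_bound) (auto simp: cd_nonneg)
    also have "(\<lambda>k. indicator {..exp (- real k)} (cd (fst z) (snd z)) :: ennreal) = (\<lambda>k. indicator (?L (exp (- real k))) z)"
      using z by (auto simp: indicator_def)
    then have "(\<Sum>k. ennreal (exp (?q * (real k + 1))) * indicator {..exp (- real k)} (cd (fst z) (snd z)))
      = (\<Sum>k. ennreal (exp (?q * (real k + 1))) * indicator (?L (exp (- real k))) z)"
      by (simp only: fun_eq_iff)
    finally show "ennreal (w z) \<le> 1 + (\<Sum>k. ennreal (exp (?q * (real k + 1))) * indicator (?L (exp (- real k))) z)" .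
  qed
  also have "\<dots> = ennreal T + (\<Sum>k. \<integral>\<^sup>+z. ennreal (exp (?q * (real k + 1))) * indicator (?L (exp (- real k))) z \<partial>?P)"
    by (subst nn_integral_add) (auto simp: nn_integral_suminf T)
  \<comment> \<open>Level k has measure at most \<open>A * exp (- k)\<close> against the weight
    \<open>exp (3/4 * (k + 1))\<close>, which leaves a geometric series of ratio
    \<open>exp (- 1/4)\<close>.\<close>
  also have "(\<Sum>k. \<integral>\<^sup>+z. ennreal (exp (?q * (real k + 1))) * indicator (?L (exp (- real k))) z \<partial>?P)
     \<le> (\<Sum>k. ennreal (A * exp ?q * exp (- (1/4)) ^ k))"
  proof (intro suminf_le allI)
    fix k
    have "(\<integral>\<^sup>+z. ennreal (exp (?q * (real k + 1))) * indicator (?L (exp (- real k))) z \<partial>?P)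
      = ennreal (exp (?q * (real k + 1))) * emeasure ?P (?L (exp (- real k)))"
      by (rule nn_integral_cmult_indicator) measurable
    also have "\<dots> \<le> ennreal (exp (?q * (real k + 1))) * ennreal (A * exp (- real k))"
      by (intro mult_left_mono lin) auto
    also have "\<dots> = ennreal (exp (?q * (real k + 1)) * (A * exp (- real k)))"
      using A by (simp add: ennreal_mult)
    also have "exp (?q * (real k + 1)) * (A * exp (- real k)) = A * exp ?q * exp (- (1/4)) ^ k"
    proof -
      have "exp (?q * (real k + 1)) * exp (- real k) = exp ?q * exp (- (1/4)) ^ k"
        unfolding exp_of_nat_mult[symmetric] exp_add[symmetric] by (simp add: algebra_simps)
      then show ?thesis by (simp add: mult.left_commute mult.assoc)
    qed
    finally show "(\<integral>\<^sup>+z. ennreal (exp (?q * (real k + 1))) * indicator (?L (exp (- real k))) z \<partial>?P)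
       \<le> ennreal (A * exp ?q * exp (- (1/4)) ^ k)" .
  qed auto
  also have "(\<Sum>k. ennreal (A * exp ?q * exp (- (1/4)) ^ k)) = ennreal (\<Sum>k. A * exp ?q * exp (- (1/4)) ^ k)"
    by (rule suminf_ennreal2) (use A in \<open>auto intro!: summable_mult summable_geometric\<close>)
  finally have "(\<integral>\<^sup>+z. ennreal (w z) \<partial>?P) \<le> ennreal T + ennreal (\<Sum>k. A * exp ?q * exp (- (1/4)) ^ k)"
    by (simp add: add_left_mono)
  then show ?thesis by (auto simp: top_unique less_top[symmetric] le_less_trans)
qed

text \<open>For fixed noise the slice is part of a critical set, which is null for the volume by
  (H2); Fubini's theorem does the rest.\<close>

lemma crit_null: "{z \<in> space (mstar m \<mu> \<Otimes>\<^sub>M noise \<sigma>). fst z \<in> crit (snd z)} \<in> null_sets (mstar m \<mu> \<Otimes>\<^sub>M noise \<sigma>)"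
proof -
  let ?P = "mstar m \<mu> \<Otimes>\<^sub>M (noise \<sigma> :: (real^'k) measure)"
  let ?E = "{z \<in> space ?P. fst z \<in> crit (snd z)}"
  interpret mm: finite_measure "mstar m \<mu>" by (rule finite_mstar)
  interpret pair_sigma_finite "mstar m \<mu>" "noise \<sigma> :: (real^'k) measure" ..
  note [measurable] = cd_m
  have "?E = {z \<in> space ?P. \<not> 0 < cd (fst z) (snd z)}" using cd_pos_iff by (auto simp: space_pair_measure)
  then have Em: "?E \<in> sets ?P" by simp
  have "emeasure ?P ?E = (\<integral>\<^sup>+t. emeasure (mstar m \<mu>) ((\<lambda>x. (x, t)) -` ?E) \<partial>noise \<sigma>)"
    by (rule emeasure_pair_measure_alt2[OF Em])
  also have "\<dots> = (\<integral>\<^sup>+t. 0 \<partial>(noise \<sigma> :: (real^'k) measure))"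
  proof (rule nn_integral_cong)
    fix t :: "real^'k" assume "t \<in> space (noise \<sigma>)"
    then have t: "t \<in> cube \<sigma>" by simp
    have eq: "(\<lambda>x. (x, t)) -` ?E = K \<inter> crit t" using t by (auto simp: space_pair_measure)
    have "K \<inter> crit t \<in> sets (mstar m \<mu>)" using crit_closed(1)[OF t] by (simp add: sets_mstar borel_closed)
    then have "emeasure (mstar m \<mu>) (K \<inter> crit t) \<le> emeasure m (crit t)"
      using crit_closed[OF t] by (simp add: emeasure_mstar emeasure_mono)
    also have "\<dots> = 0" using crit_closed(2)[OF t] by auto
    finally show "emeasure (mstar m \<mu>) ((\<lambda>x. (x, t)) -` ?E) = 0" unfolding eq by simp
  qed
  finally show ?thesis using Em by (simp add: null_setsI)
qed

section \<open>The exponent as the mean of a one-step observable\<close>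

lemma distr_mu': "distr mu' \<mu> (\<lambda>x. x) = \<mu>"
proof (rule measure_eqI)
  interpret mu: prob_space \<mu> by (rule mu)
  have im: "(\<lambda>x. x) \<in> mu' \<rightarrow>\<^sub>M \<mu>" unfolding mu'_def by (rule measurable_restrict_space1) simp
  fix A assume "A \<in> sets (distr mu' \<mu> (\<lambda>x. x))"
  then have A: "A \<in> sets \<mu>" by simp
  have s: "space mu' = K" by (simp add: mu'_def space_restrict_space mu)
  have "emeasure (distr mu' \<mu> (\<lambda>x. x)) A = emeasure mu' (A \<inter> K)"
    using A im by (subst emeasure_distr) (auto simp: s)
  also have "\<dots> = emeasure \<mu> (A \<inter> K)" by (rule emeasure_mu') (use A mu in \<open>auto simp: sets_mstar\<close>)
  also have "\<dots> = emeasure \<mu> A"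
  proof (rule emeasure_eq_AE)
    have "AE x in \<mu>. x \<notin> - K" by (rule AE_not_in[OF K_full])
    then show "AE x in \<mu>. (x \<in> A \<inter> K) = (x \<in> A)" by eventually_elim auto
  qed (use A mu in auto)
  finally show "emeasure (distr mu' \<mu> (\<lambda>x. x)) A = emeasure \<mu> A" .
qed simp

text \<open>The integrand sees one noise value only, and differs from \<open>phi\<close> on the
  critical points only. These are \<mu>-null because \<open>mu'\<close> is dominated by the volume,
  so neither the completion nor the restriction to the support changes the integral.\<close>

lemma lyap_eq: "lyap M g \<sigma> \<mu> = - (\<integral>z. phi (fst z) (snd z) \<partial>(mu' \<Otimes>\<^sub>M noise \<sigma>))"
proof -
  obtain D where "random_map (mstar m \<mu>) (noise \<sigma>) g D mu'" using exists_random_map by blast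
  then interpret R: random_map "mstar m \<mu>" "noise \<sigma>" g D mu' .
  interpret mu: prob_space \<mu> by (rule mu)
  let ?Q = "\<mu> \<Otimes>\<^sub>M R.NS"
  interpret muNS: pair_sigma_finite \<mu> R.NS ..
  note pm[measurable] = phi_measurable[OF mu(2)] and cm[measurable] = cd_measurable[OF mu(2)]
  have m0: "(\<lambda>z. (fst z, snd z 0)) \<in> ?Q \<rightarrow>\<^sub>M \<mu> \<Otimes>\<^sub>M noise \<sigma>" by measurable
  let ?h = "\<lambda>z. phi (fst z) (snd z 0)"
  have hm: "?h \<in> borel_measurable ?Q" using measurable_compose[OF m0 pm] by simp
  let ?N = "{z \<in> space ?Q. fst z \<in> crit (snd z 0)}"
  have spQ: "space ?Q = UNIV \<times> space R.NS" by (simp add: space_pair_measure mu)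
  have N: "?N \<in> null_sets ?Q"
  proof -
    have [measurable]: "(\<lambda>z. cd (fst z) (snd z 0)) \<in> borel_measurable ?Q"
      using measurable_compose[OF m0 cm] by simp
    have "?N = {z \<in> space ?Q. \<not> 0 < cd (fst z) (snd z 0)}" using cd_pos_iff R.NS_in by (auto simp: spQ)
    also have "\<dots> \<in> sets ?Q" by measurable
    finally have Nm: "?N \<in> sets ?Q" .
    have "emeasure ?Q ?N = (\<integral>\<^sup>+\<omega>. emeasure \<mu> ((\<lambda>x. (x, \<omega>)) -` ?N) \<partial>R.NS)"
      by (rule muNS.emeasure_pair_measure_alt2[OF Nm])
    also have "\<dots> = (\<integral>\<^sup>+\<omega>. 0 \<partial>R.NS)"
    proof (rule nn_integral_cong)
      fix \<omega> assume w: "\<omega> \<in> space R.NS"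
      then have t: "\<omega> 0 \<in> cube \<sigma>" using R.NS_in[OF w, of 0] by simp
      have eq: "(\<lambda>x. (x, \<omega>)) -` ?N = crit (\<omega> 0)" using w by (auto simp: spQ)
      have cb: "crit (\<omega> 0) \<in> sets borel" using crit_closed(1)[OF t] by (rule borel_closed)
      then have Kc: "K \<inter> crit (\<omega> 0) \<in> sets (mstar m \<mu>)" by (simp add: sets_mstar)
      have "emeasure \<mu> (crit (\<omega> 0)) = emeasure \<mu> (K \<inter> crit (\<omega> 0))"
      proof (rule emeasure_eq_AE)
        have "AE x in \<mu>. x \<notin> - K" by (rule AE_not_in[OF K_full])
        then show "AE x in \<mu>. (x \<in> crit (\<omega> 0)) = (x \<in> K \<inter> crit (\<omega> 0))" by eventually_elim auto
      qed (use cb mu in auto)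
      also have "\<dots> = emeasure mu' (K \<inter> crit (\<omega> 0))" by (rule emeasure_mu'[OF Kc, symmetric])
      also have "\<dots> \<le> ennreal D * emeasure (mstar m \<mu>) (K \<inter> crit (\<omega> 0))" by (rule R.mu_le[OF Kc])
      also have "\<dots> \<le> ennreal D * emeasure m (crit (\<omega> 0))"
        using cb by (intro mult_left_mono) (auto simp: emeasure_mstar[OF Kc] sets_m intro!: emeasure_mono)
      also have "\<dots> = 0" using crit_closed(2)[OF t] by auto
      finally show "emeasure \<mu> ((\<lambda>x. (x, \<omega>)) -` ?N) = 0" unfolding eq by simp
    qed
    finally show ?thesis using Nm by (simp add: null_setsI)
  qed
  let ?f = "\<lambda>z. ln (inv_deriv_norm M (rmap g (snd z)) (fst z))"
  have fh: "?f z = ?h z" if "z \<in> space ?Q - ?N" for z using that by (simp add: phi_def rmap_def)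
  have fm: "?f \<in> borel_measurable (completion ?Q)"
    by (rule borel_measurable_completion_cong[OF hm N fh])
  have "AE z in completion ?Q. z \<notin> ?N" using N by (intro AE_completion AE_not_in)
  then have "AE z in completion ?Q. ?f z = ?h z"
    using AE_space by eventually_elim (rule fh, simp)
  then have "(\<integral>z. ?f z \<partial>completion ?Q) = (\<integral>z. ?h z \<partial>completion ?Q)"
    by (intro integral_cong_AE fm measurable_completion hm)
  also have "\<dots> = (\<integral>z. ?h z \<partial>?Q)" by (rule integral_completion[OF hm])
  also have "\<dots> = (\<integral>z. phi (fst z) (snd z) \<partial>(\<mu> \<Otimes>\<^sub>M noise \<sigma>))"
  proof -
    have d0: "distr R.NS (noise \<sigma>) (\<lambda>\<omega>. \<omega> 0) = noise \<sigma>" by (rule R.seq.PiM_component) simp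
    have "distr \<mu> \<mu> (\<lambda>x. x) \<Otimes>\<^sub>M distr R.NS (noise \<sigma>) (\<lambda>\<omega>. \<omega> 0) = distr ?Q (\<mu> \<Otimes>\<^sub>M noise \<sigma>) (\<lambda>(x, \<omega>). (x, \<omega> 0))"
      by (rule pair_measure_distr) (auto simp: d0 intro: N.sigma_finite_measure)
    then have e: "\<mu> \<Otimes>\<^sub>M noise \<sigma> = distr ?Q (\<mu> \<Otimes>\<^sub>M noise \<sigma>) (\<lambda>z. (fst z, snd z 0))"
      by (simp add: d0 case_prod_beta')
    show ?thesis by (subst e, subst integral_distr[OF m0 pm]) simp
  qed
  also have "\<dots> = (\<integral>z. phi (fst z) (snd z) \<partial>(mu' \<Otimes>\<^sub>M noise \<sigma>))"
  proof -
    have im: "(\<lambda>x. x) \<in> mu' \<rightarrow>\<^sub>M \<mu>" unfolding mu'_def by (rule measurable_restrict_space1) simp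
    have dn: "distr (noise \<sigma>) (noise \<sigma>) (\<lambda>x. x) = (noise \<sigma> :: (real^'k) measure)" by (simp add:)
    have "distr mu' \<mu> (\<lambda>x. x) \<Otimes>\<^sub>M distr (noise \<sigma> :: (real^'k) measure) (noise \<sigma>) (\<lambda>x. x) = distr (mu' \<Otimes>\<^sub>M noise \<sigma>) (\<mu> \<Otimes>\<^sub>M noise \<sigma>) (\<lambda>(x, y). (x, y))"
      by (rule pair_measure_distr[OF im]) (auto simp: dn intro: N.sigma_finite_measure)
    then have e: "\<mu> \<Otimes>\<^sub>M (noise \<sigma> :: (real^'k) measure) = distr (mu' \<Otimes>\<^sub>M noise \<sigma>) (\<mu> \<Otimes>\<^sub>M noise \<sigma>) (\<lambda>z. z)"
      by (simp add: dn distr_mu' case_prod_beta')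
    have "(\<lambda>z. (fst z, snd z)) \<in> mu' \<Otimes>\<^sub>M (noise \<sigma> :: (real^'k) measure) \<rightarrow>\<^sub>M \<mu> \<Otimes>\<^sub>M noise \<sigma>"
      by (intro measurable_Pair measurable_snd measurable_compose[OF measurable_fst im])
    then have m1: "(\<lambda>z. z) \<in> mu' \<Otimes>\<^sub>M (noise \<sigma> :: (real^'k) measure) \<rightarrow>\<^sub>M \<mu> \<Otimes>\<^sub>M noise \<sigma>" by simp
    show ?thesis by (subst e, subst integral_distr[OF m1 pm]) simp
  qed
  finally show ?thesis by (simp add: lyap_def noise_seq_eq case_prod_beta')
qed

section \<open>Moments of the truncated distance and of the derivative\<close>

definition zeta :: "real \<Rightarrow> 'm \<Rightarrow> real^'k \<Rightarrow> real" where
  "zeta r x t = - ln (tdist r x (crit t))"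

lemma zeta_eq: "zeta r x t = (if r < cd x t then 0 else - ln (cd x t))"
  by (simp add: zeta_def tdist_def)

lemma zeta_measurable: "(\<lambda>z. zeta r (fst z) (snd z)) \<in> borel_measurable (mstar m \<mu> \<Otimes>\<^sub>M noise \<sigma>)"
  unfolding zeta_eq using cd_m by measurable

lemma exp_zeta_le:
  assumes "r < 1" shows "exp (3/4 * \<bar>zeta r x t\<bar>) \<le> 1 + min 1 (cd x t) powr - (3/4)"
\<comment> \<open>At distance 0 the logarithm has the default value 0. Otherwise r < 1 makes the
  distance less than 1, so that the exponential is exactly the weight.\<close>
proof (cases "r < cd x t \<or> cd x t = 0")
  case True
  then have "zeta r x t = 0" by (auto simp: zeta_eq)
  then show ?thesis by simp
next
  case False
  then have c: "0 < cd x t" "cd x t < 1" "cd x t \<le> r" using assms cd_nonneg[of x t] by auto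
  then have "exp (3/4 * \<bar>zeta r x t\<bar>) = min 1 (cd x t) powr - (3/4)"
    by (simp add: zeta_eq powr_def abs_if min_def)
  then show ?thesis by simp
qed

text \<open>The logarithm costs an arbitrarily small power, here
  \<open>- ln c <= 8 * c powr (- 1/8)\<close>. As 1/8 = 3/4 - 5/8, the weight splits off and leaves
  c to the power 5/8, where c is at most r.\<close>

lemma zeta_le:
  assumes "0 < r" "r < 1"
  shows "0 \<le> zeta r x t" "zeta r x t \<le> 8 * r powr (5/8) * min 1 (cd x t) powr - (3/4)"
proof -
  consider "r < cd x t" | "cd x t = 0" | "0 < cd x t" "cd x t \<le> r" using cd_nonneg[of x t] by linarith
  then have "0 \<le> zeta r x t \<and> zeta r x t \<le> 8 * r powr (5/8) * min 1 (cd x t) powr - (3/4)"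
  proof cases
    case 3
    let ?c = "cd x t"
    have c1: "?c < 1" using 3 assms by simp
    have "ln (?c powr - (1/8)) \<le> ?c powr - (1/8) - 1" by (rule ln_le_minus_one) (use 3 in simp)
    then have "- ln ?c \<le> 8 * ?c powr - (1/8)" using 3 by (simp add: ln_powr)
    also have "?c powr - (1/8) = ?c powr (5/8) * ?c powr - (3/4)" by (simp add: powr_add[symmetric])
    also have "\<dots> \<le> r powr (5/8) * ?c powr - (3/4)"
      using 3 by (intro mult_right_mono powr_mono2) auto
    finally have "- ln ?c \<le> 8 * r powr (5/8) * ?c powr - (3/4)" by simp
    then show ?thesis using 3 c1 by (simp add: zeta_eq min_def)
  qed (use assms in \<open>auto simp: zeta_eq\<close>)
  then show "0 \<le> zeta r x t" "zeta r x t \<le> 8 * r powr (5/8) * min 1 (cd x t) powr - (3/4)" by auto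
qed

lemma exp_phi_le: "\<exists>\<kappa>>0. \<exists>c>0. \<forall>x. \<forall>t\<in>cube \<sigma>.
    exp (\<kappa> * \<bar>phi x t\<bar>) \<le> c * (1 + min 1 (cd x t) powr - (3/4))"
proof -
  obtain c \<alpha> where \<alpha>: "0 < \<alpha>" and b: "\<And>x t. t \<in> cube \<sigma> \<Longrightarrow> \<bar>phi x t\<bar> \<le> c + \<alpha> * (- ln (min 1 (cd x t)))"
    using phi_bound by blast
  \<comment> \<open>Chosen so that \<open>\<kappa> * \<alpha>\<close> is the exponent 3/4 of the
    weight.\<close>
  define \<kappa> where "\<kappa> = 3 / (4 * \<alpha>)"
  have \<kappa>: "0 < \<kappa>" "\<kappa> * \<alpha> = 3/4" using \<alpha> by (auto simp: \<kappa>_def)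
  have "exp (\<kappa> * \<bar>phi x t\<bar>) \<le> exp (\<kappa> * c) * (1 + min 1 (cd x t) powr - (3/4))" if t: "t \<in> cube \<sigma>" for x t
  proof -
    let ?y = "min 1 (cd x t)"
    have "\<kappa> * \<bar>phi x t\<bar> \<le> \<kappa> * (c + \<alpha> * (- ln ?y))" using b[OF t] \<kappa> by (intro mult_left_mono) auto
    also have "\<dots> = \<kappa> * c + (\<kappa> * \<alpha>) * (- ln ?y)" by (simp add: algebra_simps)
    finally have "exp (\<kappa> * \<bar>phi x t\<bar>) \<le> exp (\<kappa> * c) * exp (3/4 * (- ln ?y))"
      unfolding \<kappa>(2) exp_add[symmetric] by simp
    also have "exp (3/4 * (- ln ?y)) \<le> 1 + ?y powr - (3/4)"
      by (cases "cd x t = 0") (auto simp: powr_def min_def)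
    finally show ?thesis by simp
  qed
  then show ?thesis using \<kappa>(1) exp_gt_zero[of "\<kappa> * c"] by blast
qed

section \<open>Decay of the bad event\<close>

lemma bad_event_eq:
  assumes z: "z \<in> space (mstar m \<mu> \<Otimes>\<^sub>M noise_seq \<sigma>)"
    and nc: "\<And>i. riter g i (snd z) (fst z) \<notin> crit (snd z i)"
  shows "z \<in> bad_event M m g \<sigma> \<mu> r n \<longleftrightarrow>
    (\<Sum>i\<le>n. phi (riter g i (snd z) (fst z)) (snd z i)) > - (lyap M g \<sigma> \<mu> / 2) * real n \<or>
    (\<Sum>i\<le>n. zeta r (riter g i (snd z) (fst z)) (snd z i)) > - (sqrt r * ln r * real n)"
proof -
  have "S_sum M g n (fst z) (snd z) = (\<Sum>i\<le>n. phi (riter g i (snd z) (fst z)) (snd z i))"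
    unfolding S_sum_def phi_def using nc by (simp add: rmap_def shift_funpow)
  moreover have "Z_sum M g n (fst z) (snd z) r = (\<Sum>i\<le>n. zeta r (riter g i (snd z) (fst z)) (snd z i))"
    unfolding Z_sum_def zeta_def by (simp add: sum_negf)
  ultimately show ?thesis using z by (simp add: bad_event_def case_prod_beta)
qed

theorem bad_event_decay:
  assumes H4: "H4 M m g \<sigma> \<mu>" and lyap: "0 < lyap M g \<sigma> \<mu>"
  shows "\<exists>C\<^sub>4>0. \<forall>\<^sub>F r in at_right 0. \<exists>\<gamma>>0. \<forall>n.
    bad_event M m g \<sigma> \<mu> r n \<in> sets (completion (mstar m \<mu> \<Otimes>\<^sub>M noise_seq \<sigma>)) \<and>
    emeasure (completion (mstar m \<mu> \<Otimes>\<^sub>M noise_seq \<sigma>)) (bad_event M m g \<sigma> \<mu> r n)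
      < ennreal (C\<^sub>4 * exp (- \<gamma> * real n))"
proof -
  obtain D where "random_map (mstar m \<mu>) (noise \<sigma>) g D mu'" using exists_random_map by blast
  then interpret R: random_map "mstar m \<mu>" "noise \<sigma>" g D mu' .
  let ?P = "mstar m \<mu> \<Otimes>\<^sub>M (noise \<sigma> :: (real^'k) measure)"
  let ?PS = "mstar m \<mu> \<Otimes>\<^sub>M R.NS"
  let ?X = "\<lambda>i z. riter g i (snd z) (fst z)"
  note [measurable] = cd_m phi_m zeta_measurable
  note [measurable (raw)] = measurable_pair_compose[OF phi_m]
  note [measurable (raw)] = measurable_pair_compose[OF zeta_measurable]
  have spP: "\<And>z. z \<in> space ?P \<Longrightarrow> snd z \<in> cube \<sigma>" by (auto simp: space_pair_measure)
  define T where "T = measure ?PS (space ?PS)"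
  have T: "emeasure ?PS (space ?PS) = ennreal T" and T0: "0 \<le> T"
  proof -
    have "emeasure ?PS (K \<times> space R.NS) = emeasure (mstar m \<mu>) K * emeasure R.NS (space R.NS)"
      by (rule R.seq.emeasure_pair_measure_Times) (auto simp: sets_mstar)
    then have "emeasure ?PS (space ?PS) \<noteq> \<infinity>"
      using R.M.emeasure_finite[of K] R.seq.emeasure_space_1 by (simp add: space_pair_measure)
    then show "emeasure ?PS (space ?PS) = ennreal T" "0 \<le> T" by (auto simp: T_def emeasure_eq_ennreal_measure)
  qed
  obtain I where I: "0 \<le> I" "(\<integral>\<^sup>+z. ennreal (w z) \<partial>?P) = ennreal I"
    using moment[OF H4] by (cases "(\<integral>\<^sup>+z. ennreal (w z) \<partial>?P)") auto
  have PT: "emeasure ?P (space ?P) < \<infinity>"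
  proof -
    have "emeasure ?P (K \<times> cube \<sigma>) = emeasure (mstar m \<mu>) K * emeasure (noise \<sigma>) (cube \<sigma> :: (real^'k) set)"
      by (rule N.emeasure_pair_measure_Times) (auto simp: sets_mstar sets_noise_iff cube_props)
    then show ?thesis using N.emeasure_space_1 R.M.emeasure_finite[of K] by (simp add: space_pair_measure less_top[symmetric])
  qed
  have fin: "(\<integral>\<^sup>+z. ennreal (exp (\<kappa> * \<bar>f z\<bar>)) \<partial>?P) < \<infinity>"
    if le: "\<And>z. z \<in> space ?P \<Longrightarrow> exp (\<kappa> * \<bar>f z\<bar>) \<le> c * (1 + w z)" and c: "0 < c" for f \<kappa> c
  proof -
    have "(\<integral>\<^sup>+z. ennreal (exp (\<kappa> * \<bar>f z\<bar>)) \<partial>?P) \<le> (\<integral>\<^sup>+z. ennreal c * (1 + ennreal (w z)) \<partial>?P)"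
    proof (rule nn_integral_mono)
      fix z assume "z \<in> space ?P"
      have "ennreal (exp (\<kappa> * \<bar>f z\<bar>)) \<le> ennreal (c * (1 + w z))" by (rule ennreal_leI[OF le]) fact
      also have "\<dots> = ennreal c * (1 + ennreal (w z))" using c by (simp add: ennreal_mult ennreal_plus[symmetric] del: ennreal_plus flip: ennreal_1)
      finally show "ennreal (exp (\<kappa> * \<bar>f z\<bar>)) \<le> ennreal c * (1 + ennreal (w z))" .
    qed
    also have "\<dots> = ennreal c * (emeasure ?P (space ?P) + ennreal I)"
      by (simp add: nn_integral_cmult nn_integral_add I)
    also have "\<dots> < \<infinity>" using PT by (simp add: ennreal_mult_less_top)
    finally show ?thesis .
  qed
  obtain \<kappa> c where \<kappa>: "0 < \<kappa>" and pe: "\<And>x t. t \<in> cube \<sigma> \<Longrightarrow> exp (\<kappa> * \<bar>phi x t\<bar>) \<le> c * (1 + min 1 (cd x t) powr - (3/4))" and c0: "0 < c"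
    using exp_phi_le by blast
  let ?ly = "lyap M g \<sigma> \<mu>"
  have "\<exists>C \<gamma>. 0 < \<gamma> \<and> (\<forall>n. emeasure ?PS {z\<in>space ?PS. (\<Sum>i\<le>n. phi (?X i z) (snd z i)) > ((\<integral>z. phi (fst z) (snd z) \<partial>(mu' \<Otimes>\<^sub>M noise \<sigma>)) + ?ly / 2) * n}
     \<le> ennreal (C * exp (- \<gamma> * n)))"
    by (rule R.large_deviation[OF phi_m \<kappa> fin]) (use pe spP c0 lyap in auto)
  \<comment> \<open>The mean of \<open>phi\<close> is minus the exponent, so a deviation by half of
    the exponent gives exactly the threshold of the theorem.\<close>
  moreover have "(\<integral>z. phi (fst z) (snd z) \<partial>(mu' \<Otimes>\<^sub>M noise \<sigma>)) + ?ly / 2 = - (?ly / 2)"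
    using lyap_eq by simp
  ultimately obtain CS \<gamma>S where \<gamma>S: "0 < \<gamma>S" and S: "\<And>n. emeasure ?PS {z\<in>space ?PS. (\<Sum>i\<le>n. phi (?X i z) (snd z i)) > - (?ly / 2) * real n}
     \<le> ennreal (CS * exp (- \<gamma>S * n))"
    by auto
  \<comment> \<open>The mean of \<open>zeta r\<close> under the stationary measure is at most
    \<open>A * r powr (5/8)\<close>: 8 from \<open>zeta_le\<close>, D from the density of \<mu>, and
    I the moment of the weight.\<close>
  define A where "A = 8 * D * I"
  have A0: "0 \<le> A" using R.D_nonneg I by (simp add: A_def)
  \<comment> \<open>The bound on r ensures both r < 1 and A < - ln r.\<close>
  have main: "\<exists>\<gamma>>0. \<forall>n. bad_event M m g \<sigma> \<mu> r n \<in> sets (completion (mstar m \<mu> \<Otimes>\<^sub>M noise_seq \<sigma>)) \<and>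
    emeasure (completion (mstar m \<mu> \<Otimes>\<^sub>M noise_seq \<sigma>)) (bad_event M m g \<sigma> \<mu> r n)
      < ennreal ((2 * T + 1) * exp (- \<gamma> * real n))" if r: "0 < r" "r < exp (- (A + 1))" for r
  proof -
    have "exp (- (A + 1)) < 1" using A0 by simp
    then have r1: "r < 1" using r by linarith
    have lnr: "A < - ln r" using r A0 ln_less_cancel_iff[of r "exp (- (A + 1))"] by simp
    let ?mean = "\<integral>z. zeta r (fst z) (snd z) \<partial>(mu' \<Otimes>\<^sub>M noise \<sigma>)"
    have "ennreal ?mean \<le> ennreal (D * (8 * r powr (5/8) * I))"
    \<comment> \<open>A non-integrable function would have integral 0 by convention, which satisfies
      the bound too.\<close>
    proof (cases "integrable (mu' \<Otimes>\<^sub>M noise \<sigma>) (\<lambda>z. zeta r (fst z) (snd z))")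
      case True
      then have "ennreal ?mean = (\<integral>\<^sup>+z. ennreal (zeta r (fst z) (snd z)) \<partial>(mu' \<Otimes>\<^sub>M noise \<sigma>))"
        using zeta_le(1)[OF r(1) r1] by (intro nn_integral_eq_integral[symmetric]) auto
      also have "\<dots> = (\<integral>\<^sup>+x. \<integral>\<^sup>+t. ennreal (zeta r x t) \<partial>noise \<sigma> \<partial>mu')"
        by (subst N.nn_integral_fst[symmetric]) auto
      also have "\<dots> \<le> ennreal D * (\<integral>\<^sup>+x. \<integral>\<^sup>+t. ennreal (zeta r x t) \<partial>noise \<sigma> \<partial>mstar m \<mu>)"
        by (rule R.mu_nn_integral_le) measurable
      also have "(\<integral>\<^sup>+x. \<integral>\<^sup>+t. ennreal (zeta r x t) \<partial>noise \<sigma> \<partial>mstar m \<mu>) = (\<integral>\<^sup>+z. ennreal (zeta r (fst z) (snd z)) \<partial>?P)"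
        by (subst N.nn_integral_fst[symmetric]) auto
      also have "\<dots> \<le> (\<integral>\<^sup>+z. ennreal (8 * r powr (5/8)) * ennreal (w z) \<partial>?P)"
        using zeta_le(2)[OF r(1) r1] by (intro nn_integral_mono) (simp add: ennreal_mult[symmetric] ennreal_leI)
      also have "\<dots> = ennreal (8 * r powr (5/8)) * ennreal I"
        by (subst nn_integral_cmult) (auto simp: I)
      finally show ?thesis using R.D_nonneg I by (simp add: ennreal_mult mult_left_mono)
    next
      case False
      then show ?thesis by (simp add: not_integrable_integral_eq)
    qed
    then have mean: "?mean \<le> D * (8 * r powr (5/8) * I)" using R.D_nonneg I by (simp add: ennreal_le_iff)
    \<comment> \<open>The power 5/8 is split as 1/2 + 1/8; the second factor is at most 1, and A is
      below - ln r. So the mean lies strictly below the threshold, and their difference is an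
      admissible deviation.\<close>
    have "D * (8 * r powr (5/8) * I) = A * (r powr (1/2) * r powr (1/8))"
      by (simp add: A_def powr_add[symmetric])
    also have "\<dots> \<le> A * (r powr (1/2) * 1)"
      using A0 r r1 by (intro mult_left_mono) (auto intro: powr_le1)
    also have "\<dots> = A * sqrt r" using r by (simp add: powr_half_sqrt)
    also have "\<dots> < - ln r * sqrt r" using lnr r by (intro mult_strict_right_mono) auto
    finally have eps: "0 < - (sqrt r * ln r) - ?mean" using mean by (simp add: mult.commute)
    have "\<exists>C \<gamma>. 0 < \<gamma> \<and> (\<forall>n. emeasure ?PS {z\<in>space ?PS. (\<Sum>i\<le>n. zeta r (?X i z) (snd z i)) > (?mean + (- (sqrt r * ln r) - ?mean)) * n}
       \<le> ennreal (C * exp (- \<gamma> * n)))"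
    proof (rule R.large_deviation[OF zeta_measurable _ _ eps])
      show "(\<integral>\<^sup>+z. ennreal (exp (3/4 * \<bar>zeta r (fst z) (snd z)\<bar>)) \<partial>?P) < \<infinity>"
      proof (rule fin)
        fix z show "exp (3/4 * \<bar>zeta r (fst z) (snd z)\<bar>) \<le> 1 * (1 + w z)" using exp_zeta_le[OF r1] by simp
      qed simp
    qed simp
    then obtain CZ \<gamma>Z where \<gamma>Z: "0 < \<gamma>Z" and Z: "\<And>n. emeasure ?PS {z\<in>space ?PS. (\<Sum>i\<le>n. zeta r (?X i z) (snd z i)) > - (sqrt r * ln r * real n)}
       \<le> ennreal (CZ * exp (- \<gamma>Z * n))"
      by auto
    let ?BS = "\<lambda>n. {z\<in>space ?PS. (\<Sum>i\<le>n. phi (?X i z) (snd z i)) > - (?ly / 2) * real n}"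
    let ?BZ = "\<lambda>n. {z\<in>space ?PS. (\<Sum>i\<le>n. zeta r (?X i z) (snd z i)) > - (sqrt r * ln r * real n)}"
    let ?E = "{z \<in> space ?P. fst z \<in> crit (snd z)}"
    \<comment> \<open>The orbits that ever meet a critical set. Off this null set the sums of the
      theorem are Birkhoff sums of \<open>phi\<close> and \<open>zeta r\<close>.\<close>
    let ?N = "\<Union>i. {z \<in> space ?PS. (?X i z, snd z i) \<in> ?E}"
    have N0: "?N \<in> null_sets ?PS" by (intro null_sets_UN R.orbit_null[OF crit_null])
    have BSm[measurable]: "?BS n \<in> sets ?PS" and BZm[measurable]: "?BZ n \<in> sets ?PS" for n
      by (measurable)
    have diff: "bad_event M m g \<sigma> \<mu> r n - ?N = (?BS n \<union> ?BZ n) - ?N" for n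
    proof -
      have "z \<in> bad_event M m g \<sigma> \<mu> r n \<longleftrightarrow> z \<in> ?BS n \<union> ?BZ n" if z: "z \<in> space ?PS" "z \<notin> ?N" for z
      proof -
        have z': "fst z \<in> K" "snd z \<in> space R.NS" using z(1) by (auto simp: space_pair_measure)
        have "?X i z \<notin> crit (snd z i)" for i
        proof -
          have "(?X i z, snd z i) \<in> space ?P"
            using R.riter_in[of "fst z" "snd z" i] R.NS_in[of "snd z" i] z' by (simp add: space_pair_measure)
          then show ?thesis using z by auto
        qed
        then show ?thesis using bad_event_eq[of z r n] z(1) by (simp add: noise_seq_eq)
      qed
      moreover have "bad_event M m g \<sigma> \<mu> r n \<subseteq> space ?PS" by (auto simp: bad_event_def noise_seq_eq)
      ultimately show ?thesis by blast
    qed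
    have B: "bad_event M m g \<sigma> \<mu> r n \<in> sets (completion ?PS)"
      "emeasure (completion ?PS) (bad_event M m g \<sigma> \<mu> r n) = emeasure ?PS (?BS n \<union> ?BZ n)" for n
      by (rule sets_completion_cong[OF _ N0 diff], measurable)+
    \<comment> \<open>The constants from \<open>large_deviation\<close> carry no sign, hence the
      truncation at 0 before they are added.\<close>
    define C where "C = max 0 CS + max 0 CZ"
    define \<gamma>0 where "\<gamma>0 = min \<gamma>S \<gamma>Z"
    have \<gamma>0: "0 < \<gamma>0" using \<gamma>S \<gamma>Z by (simp add: \<gamma>0_def)
    have bound: "emeasure ?PS (?BS n \<union> ?BZ n) \<le> ennreal (C * exp (- \<gamma>0 * n))" for n
    proof -
      have le: "ennreal (c * exp (- \<gamma> * n)) \<le> ennreal (max 0 c * exp (- \<gamma>0 * n))" if "\<gamma>0 \<le> \<gamma>" for c \<gamma>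
        by (intro ennreal_leI mult_mono) (use mult_right_mono[OF that, of "real n"] in auto)
      have "emeasure ?PS (?BS n \<union> ?BZ n) \<le> emeasure ?PS (?BS n) + emeasure ?PS (?BZ n)"
        by (rule emeasure_subadditive) measurable
      also have "\<dots> \<le> ennreal (max 0 CS * exp (- \<gamma>0 * n)) + ennreal (max 0 CZ * exp (- \<gamma>0 * n))"
        by (intro add_mono order_trans[OF S le] order_trans[OF Z le]) (auto simp: \<gamma>0_def)
      also have "\<dots> = ennreal (C * exp (- \<gamma>0 * n))"
        by (subst ennreal_plus[symmetric]) (auto simp: C_def distrib_right)
      finally show ?thesis .
    qed
    have "emeasure ?PS (?BS n \<union> ?BZ n) \<le> ennreal T" for n
      unfolding T[symmetric] by (rule emeasure_mono) auto
    from exponential_bound_uniform[OF T0 this \<gamma>0 bound]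
    show ?thesis using B by (simp add: noise_seq_eq)
  qed
  have "\<forall>\<^sub>F r in at_right 0. 0 < r \<and> r < exp (- (A + 1))"
    unfolding eventually_at_right_field by (intro exI[of _ "exp (- (A + 1))"]) auto
  then have "\<forall>\<^sub>F r in at_right 0. \<exists>\<gamma>>0. \<forall>n. bad_event M m g \<sigma> \<mu> r n \<in> sets (completion (mstar m \<mu> \<Otimes>\<^sub>M noise_seq \<sigma>)) \<and>
    emeasure (completion (mstar m \<mu> \<Otimes>\<^sub>M noise_seq \<sigma>)) (bad_event M m g \<sigma> \<mu> r n)
      < ennreal ((2 * T + 1) * exp (- \<gamma> * real n))"
    by (rule eventually_mono) (rule main, simp_all)
  moreover have "0 < 2 * T + 1" using T0 by simp
  ultimately show ?thesis by (rule exI[of _ "2 * T + 1", OF conjI, rotated])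
qed

end

theorem proposition3p1:
  fixes M :: "('m::metric_space, 'k::finite) riem"
    and m \<mu> :: "'m measure"
    and g :: "'m \<Rightarrow> real^'k \<Rightarrow> 'm"
    and \<sigma> \<beta> :: real
  assumes "riemannian_manifold M" and "compact (UNIV :: 'm set)"
    and "volume_measure M m"
    and "\<sigma> > 0" and "\<beta> > 0"
    and "H1 M g \<sigma> \<beta>"
    and "H2 M m g \<sigma> \<beta>"
    and "H3 M g \<sigma> \<mu>"
    and "H4 M m g \<sigma> \<mu>"
  shows "\<exists>C\<^sub>4>0. \<forall>\<^sub>F r in at_right 0. \<exists>\<gamma>>0. \<forall>n.
    bad_event M m g \<sigma> \<mu> r n \<in> sets (completion (mstar m \<mu> \<Otimes>\<^sub>M noise_seq \<sigma>)) \<and>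
    emeasure (completion (mstar m \<mu> \<Otimes>\<^sub>M noise_seq \<sigma>)) (bad_event M m g \<sigma> \<mu> r n)
      < ennreal (C\<^sub>4 * exp (- \<gamma> * real n))"
proof -
  interpret singular_riem M m g \<sigma> \<beta> \<mu>
    using assms by unfold_locales (auto simp: H3_def)
  show ?thesis using assms by (intro bad_event_decay) (auto simp: H3_def)
qed

end
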